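(* Every Harada module satisfies the perspective-Schröder-Bernstein (PSB) property. In particular, every discrete module satisfies the PSB-property.
   Context: Rings are associative with unity and modules are unital. A decomposition $M=\bigoplus_{i\in I}M_i$ complements summands if for every direct summand $N$ of $M$ there is a subset $J\subseteq I$ with $M=N\oplus\bigoplus_{j\in J}M_j$. A module $M$ is a Harada module if it has a decomposition $M=\bigoplus_{i\in I}M_i$ that complements summands and such that each $\mathrm{End}(M_i)$ is a local ring. A module $M$ is discrete if it satisfies: $(D_1)$ for every submodule $A$ of $M$ there is a decomposition $M=M_1\oplus M_2$ with $M_1\subseteq A$ and $A\cap M_2$ small (superfluous) in $M$; and $(D_2)$ if $A$ is a submodule of $M$ such that $M/A$ is isomorphic to a direct summand of $M$, then $A$ is a direct summand of $M$. Write $A\subseteq^{\oplus}M$ if $A$ is a direct summand of $M$. Two direct summands $A,B$ of $M$ are perspective, written $A\sim_p B$, if there is a submodule $C$ with $M=A\oplus C=B\oplus C$. $M$ has the PSB-property if for any direct summands $A,B$ of $M$: whenever $A\sim_p B'$ for some $B'\subseteq^{\oplus}B$ and $B\sim_p A'$ for some $A'\subseteq^{\oplus}A$ (perspectivity taken in $M$), then $A\sim_p B$. *)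

theory Defs
  imports "HOL-Algebra.Module" "HOL-Algebra.AbelCoset" "HOL-Algebra.Ideal"
begin

text \<open>
  The locale \<^verbatim>\<open>module\<close> of HOL-Algebra presupposes a commutative ring of scalars. We keep its
  record type and its notion of submodule (which does not mention commutativity), but work with
  unital left modules over an arbitrary associative ring with unity. Right modules are
  covered by passing to the opposite ring.
\<close>

locale left_module = R?: ring R + M?: abelian_group M for R (structure) and M (structure) +
  assumes smult_closed [simp, intro]:
      "\<lbrakk>a \<in> carrier R; x \<in> carrier M\<rbrakk> \<Longrightarrow> a \<odot>\<^bsub>M\<^esub> x \<in> carrier M"
    and smult_l_distr:
      "\<lbrakk>a \<in> carrier R; b \<in> carrier R; x \<in> carrier M\<rbrakk> \<Longrightarrow>
        (a \<oplus> b) \<odot>\<^bsub>M\<^esub> x = a \<odot>\<^bsub>M\<^esub> x \<oplus>\<^bsub>M\<^esub> b \<odot>\<^bsub>M\<^esub> x"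
    and smult_r_distr:
      "\<lbrakk>a \<in> carrier R; x \<in> carrier M; y \<in> carrier M\<rbrakk> \<Longrightarrow>
        a \<odot>\<^bsub>M\<^esub> (x \<oplus>\<^bsub>M\<^esub> y) = a \<odot>\<^bsub>M\<^esub> x \<oplus>\<^bsub>M\<^esub> a \<odot>\<^bsub>M\<^esub> y"
    and smult_assoc1:
      "\<lbrakk>a \<in> carrier R; b \<in> carrier R; x \<in> carrier M\<rbrakk> \<Longrightarrow>
        (a \<otimes> b) \<odot>\<^bsub>M\<^esub> x = a \<odot>\<^bsub>M\<^esub> (b \<odot>\<^bsub>M\<^esub> x)"
    and smult_one [simp]:
      "x \<in> carrier M \<Longrightarrow> \<one> \<odot>\<^bsub>M\<^esub> x = x"

text \<open>
  A submodule \<^verbatim>\<open>N\<close> of \<^verbatim>\<open>M\<close> regarded as a module in its own right is \<^verbatim>\<open>M\<lparr>carrier := N\<rparr>\<close>.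
\<close>

definition lmodule_hom ::
  "('r, 's) ring_scheme \<Rightarrow> ('r, 'm, 't) module_scheme \<Rightarrow> ('r, 'n, 'u) module_scheme \<Rightarrow> ('m \<Rightarrow> 'n) set"
  where "lmodule_hom R M N =
    {f \<in> carrier M \<rightarrow> carrier N.
       (\<forall>x \<in> carrier M. \<forall>y \<in> carrier M. f (x \<oplus>\<^bsub>M\<^esub> y) = f x \<oplus>\<^bsub>N\<^esub> f y) \<and>
       (\<forall>r \<in> carrier R. \<forall>x \<in> carrier M. f (r \<odot>\<^bsub>M\<^esub> x) = r \<odot>\<^bsub>N\<^esub> f x)}"

definition lmodule_isomorphic ::
  "('r, 's) ring_scheme \<Rightarrow> ('r, 'm, 't) module_scheme \<Rightarrow> ('r, 'n, 'u) module_scheme \<Rightarrow> bool"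
  where "lmodule_isomorphic R M N \<longleftrightarrow>
    (\<exists>f \<in> lmodule_hom R M N. bij_betw f (carrier M) (carrier N))"

text \<open>Endomorphisms are made extensional, so that equal maps on the carrier are equal elements.\<close>

definition End_ring :: "('r, 's) ring_scheme \<Rightarrow> ('r, 'm, 't) module_scheme \<Rightarrow> ('m \<Rightarrow> 'm) ring"
  where "End_ring R M =
    \<lparr>carrier = lmodule_hom R M M \<inter> extensional (carrier M),
     mult = compose (carrier M),
     one = (\<lambda>x \<in> carrier M. x),
     zero = (\<lambda>x \<in> carrier M. \<zero>\<^bsub>M\<^esub>),
     add = (\<lambda>f g. \<lambda>x \<in> carrier M. f x \<oplus>\<^bsub>M\<^esub> g x)\<rparr>"

text \<open>
  A not necessarily commutative ring is local if its non-units form a (two-sided) ideal. This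
  excludes the zero ring, in which the set of non-units is empty.
\<close>

definition local_ring :: "('a, 'b) ring_scheme \<Rightarrow> bool"
  where "local_ring R \<longleftrightarrow> ideal (carrier R - Units R) R"

text \<open>
  The components \<^verbatim>\<open>mult\<close> and \<^verbatim>\<open>one\<close> are present in the record type only because it extends that
  of rings; they play no role for modules.
\<close>

definition quotient_module :: "('r, 'm, 't) module_scheme \<Rightarrow> 'm set \<Rightarrow> ('r, 'm set) module"
  where "quotient_module M A =
    \<lparr>carrier = a_rcosets\<^bsub>M\<^esub> A,
     mult = undefined,
     one = undefined,
     zero = A,
     add = set_add M,
     smult = (\<lambda>r X. \<Union>x \<in> X. A +>\<^bsub>M\<^esub> (r \<odot>\<^bsub>M\<^esub> x))\<rparr>"

definition direct_sum ::
  "('r, 's) ring_scheme \<Rightarrow> ('r, 'm, 't) module_scheme \<Rightarrow> 'm set \<Rightarrow> 'm set \<Rightarrow> bool"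
  where "direct_sum R M A B \<longleftrightarrow>
    submodule A R M \<and> submodule B R M \<and> A <+>\<^bsub>M\<^esub> B = carrier M \<and> A \<inter> B = {\<zero>\<^bsub>M\<^esub>}"

definition direct_summand ::
  "('r, 's) ring_scheme \<Rightarrow> ('r, 'm, 't) module_scheme \<Rightarrow> 'm set \<Rightarrow> bool"
  where "direct_summand R M A \<longleftrightarrow> (\<exists>B. direct_sum R M A B)"

definition family_sum :: "('r, 'm, 't) module_scheme \<Rightarrow> ('i \<Rightarrow> 'm set) \<Rightarrow> 'i set \<Rightarrow> 'm set"
  where "family_sum M N J =
    {(\<Oplus>\<^bsub>M\<^esub>i \<in> F. f i) |F f. finite F \<and> F \<subseteq> J \<and> f \<in> (\<Pi> i \<in> F. N i)}"

definition direct_decomposition ::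
  "('r, 's) ring_scheme \<Rightarrow> ('r, 'm, 't) module_scheme \<Rightarrow> 'i set \<Rightarrow> ('i \<Rightarrow> 'm set) \<Rightarrow> bool"
  where "direct_decomposition R M I N \<longleftrightarrow>
    (\<forall>i \<in> I. submodule (N i) R M) \<and>
    family_sum M N I = carrier M \<and>
    (\<forall>i \<in> I. N i \<inter> family_sum M N (I - {i}) = {\<zero>\<^bsub>M\<^esub>})"

definition complements_summands ::
  "('r, 's) ring_scheme \<Rightarrow> ('r, 'm, 't) module_scheme \<Rightarrow> 'i set \<Rightarrow> ('i \<Rightarrow> 'm set) \<Rightarrow> bool"
  where "complements_summands R M I N \<longleftrightarrow>
    (\<forall>K. direct_summand R M K \<longrightarrow> (\<exists>J \<subseteq> I. direct_sum R M K (family_sum M N J)))"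

definition harada_decomposition ::
  "('r, 's) ring_scheme \<Rightarrow> ('r, 'm, 't) module_scheme \<Rightarrow> 'i set \<Rightarrow> ('i \<Rightarrow> 'm set) \<Rightarrow> bool"
  where "harada_decomposition R M I N \<longleftrightarrow>
    direct_decomposition R M I N \<and> complements_summands R M I N \<and>
    (\<forall>i \<in> I. local_ring (End_ring R (M\<lparr>carrier := N i\<rparr>)))"

text \<open>
  HOL cannot quantify existentially over the type of indices. Indexing by sets of elements
  of \<^verbatim>\<open>M\<close> loses no generality, see \<^verbatim>\<open>harada_moduleI\<close> below.
\<close>

definition harada_module :: "('r, 's) ring_scheme \<Rightarrow> ('r, 'm, 't) module_scheme \<Rightarrow> bool"
  where "harada_module R M \<longleftrightarrow>
    (\<exists>(I :: 'm set set) (N :: 'm set \<Rightarrow> 'm set). harada_decomposition R M I N)"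

definition small_in ::
  "('r, 's) ring_scheme \<Rightarrow> ('r, 'm, 't) module_scheme \<Rightarrow> 'm set \<Rightarrow> bool"
  where "small_in R M A \<longleftrightarrow>
    submodule A R M \<and> (\<forall>K. submodule K R M \<longrightarrow> A <+>\<^bsub>M\<^esub> K = carrier M \<longrightarrow> K = carrier M)"

definition cond_D1 :: "('r, 's) ring_scheme \<Rightarrow> ('r, 'm, 't) module_scheme \<Rightarrow> bool"
  where "cond_D1 R M \<longleftrightarrow>
    (\<forall>A. submodule A R M \<longrightarrow>
      (\<exists>M1 M2. direct_sum R M M1 M2 \<and> M1 \<subseteq> A \<and> small_in R M (A \<inter> M2)))"

definition cond_D2 :: "('r, 's) ring_scheme \<Rightarrow> ('r, 'm, 't) module_scheme \<Rightarrow> bool"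
  where "cond_D2 R M \<longleftrightarrow>
    (\<forall>A. submodule A R M \<longrightarrow>
      (\<exists>K. direct_summand R M K \<and>
        lmodule_isomorphic R (quotient_module M A) (M\<lparr>carrier := K\<rparr>)) \<longrightarrow>
      direct_summand R M A)"

definition discrete_module :: "('r, 's) ring_scheme \<Rightarrow> ('r, 'm, 't) module_scheme \<Rightarrow> bool"
  where "discrete_module R M \<longleftrightarrow> cond_D1 R M \<and> cond_D2 R M"

definition perspective ::
  "('r, 's) ring_scheme \<Rightarrow> ('r, 'm, 't) module_scheme \<Rightarrow> 'm set \<Rightarrow> 'm set \<Rightarrow> bool"
  where "perspective R M A B \<longleftrightarrow> (\<exists>C. direct_sum R M A C \<and> direct_sum R M B C)"

definition PSB_property :: "('r, 's) ring_scheme \<Rightarrow> ('r, 'm, 't) module_scheme \<Rightarrow> bool"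
  where "PSB_property R M \<longleftrightarrow>
    (\<forall>A B. direct_summand R M A \<longrightarrow> direct_summand R M B \<longrightarrow>
      (\<exists>B'. direct_summand R (M\<lparr>carrier := B\<rparr>) B' \<and> perspective R M A B') \<longrightarrow>
      (\<exists>A'. direct_summand R (M\<lparr>carrier := A\<rparr>) A' \<and> perspective R M B A') \<longrightarrow>
      perspective R M A B)"

subsection \<open>The constructions are well defined\<close>

lemma (in left_module) smult_r_null:
  assumes "a \<in> carrier R"
  shows "a \<odot>\<^bsub>M\<^esub> \<zero>\<^bsub>M\<^esub> = \<zero>\<^bsub>M\<^esub>"
proof -
  have "a \<odot>\<^bsub>M\<^esub> \<zero>\<^bsub>M\<^esub> \<oplus>\<^bsub>M\<^esub> a \<odot>\<^bsub>M\<^esub> \<zero>\<^bsub>M\<^esub> = a \<odot>\<^bsub>M\<^esub> \<zero>\<^bsub>M\<^esub>"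
    using smult_r_distr[OF assms M.zero_closed M.zero_closed] by simp
  then show ?thesis
    using assms by (metis M.add.r_cancel_one' M.zero_closed smult_closed)
qed

lemma (in left_module) submodule_is_left_module:
  assumes "submodule H R M"
  shows "left_module R (M\<lparr>carrier := H\<rparr>)"
proof -
  have sub: "subgroup H (add_monoid M)" using assms by (rule submodule.axioms)
  have HM: "x \<in> carrier M" if "x \<in> H" for x using subgroup.mem_carrier[OF sub that] by simp
  have neg: "\<ominus>\<^bsub>M\<^esub> x \<in> H" if "x \<in> H" for x
    using subgroup.m_inv_closed[OF sub that] by (simp add: a_inv_def)
  have "abelian_group (M\<lparr>carrier := H\<rparr>)"
  proof (rule abelian_groupI)
    fix x assume "x \<in> carrier (M\<lparr>carrier := H\<rparr>)"
    then have x: "x \<in> H" by simp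
    have "\<ominus>\<^bsub>M\<^esub> x \<oplus>\<^bsub>M\<^esub> x = \<zero>\<^bsub>M\<^esub>" using HM[OF x] by (rule M.l_neg)
    then show "\<exists>y\<in>carrier (M\<lparr>carrier := H\<rparr>).
        y \<oplus>\<^bsub>M\<lparr>carrier := H\<rparr>\<^esub> x = \<zero>\<^bsub>M\<lparr>carrier := H\<rparr>\<^esub>"
      using neg[OF x] by auto
  qed (use subgroup.m_closed[OF sub] subgroup.one_closed[OF sub] HM
       in \<open>auto simp: M.a_ac\<close>)
  then show ?thesis
    using HM submodule.smult_closed[OF assms]
    by (auto intro!: left_module.intro R.ring_axioms left_module_axioms.intro
        simp: smult_l_distr smult_r_distr smult_assoc1)
qed

lemma (in left_module) smult_r_neg:
  assumes "a \<in> carrier R" "x \<in> carrier M"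
  shows "a \<odot>\<^bsub>M\<^esub> (\<ominus>\<^bsub>M\<^esub> x) = \<ominus>\<^bsub>M\<^esub> (a \<odot>\<^bsub>M\<^esub> x)"
proof -
  have "a \<odot>\<^bsub>M\<^esub> (\<ominus>\<^bsub>M\<^esub> x) \<oplus>\<^bsub>M\<^esub> a \<odot>\<^bsub>M\<^esub> x = \<zero>\<^bsub>M\<^esub>"
    using assms by (simp add: smult_r_distr[symmetric] M.l_neg smult_r_null)
  then show ?thesis using assms by (simp add: M.minus_equality)
qed

lemma (in left_module) End_ring_is_ring: "ring (End_ring R M)"
proof (rule ringI)
  show "abelian_group (End_ring R M)"
  proof (rule abelian_groupI)
    fix f assume "f \<in> carrier (End_ring R M)"
    then have f: "f \<in> lmodule_hom R M M" "f \<in> extensional (carrier M)"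
      by (auto simp: End_ring_def)
    let ?g = "\<lambda>x \<in> carrier M. \<ominus>\<^bsub>M\<^esub> f x"
    have "?g \<in> carrier (End_ring R M)"
      using f by (auto simp: End_ring_def lmodule_hom_def Pi_iff M.minus_add smult_r_neg)
    moreover have "?g \<oplus>\<^bsub>End_ring R M\<^esub> f = \<zero>\<^bsub>End_ring R M\<^esub>"
      using f by (auto simp: End_ring_def lmodule_hom_def Pi_iff M.l_neg cong: restrict_cong)
    ultimately show "\<exists>g\<in>carrier (End_ring R M). g \<oplus>\<^bsub>End_ring R M\<^esub> f = \<zero>\<^bsub>End_ring R M\<^esub>"
      by blast
  qed (auto simp: End_ring_def lmodule_hom_def Pi_iff M.a_ac smult_r_distr smult_r_null
        intro!: restrict_ext intro: extensionalityI[where A = "carrier M"])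
  show "monoid (End_ring R M)"
    by (rule monoidI)
       (auto simp: End_ring_def lmodule_hom_def Pi_iff compose_def extensional_def fun_eq_iff)
qed (auto simp: End_ring_def lmodule_hom_def Pi_iff compose_def cong: restrict_cong)

lemma (in left_module) quotient_is_left_module:
  assumes "submodule A R M"
  shows "left_module R (quotient_module M A)"
proof -
  have sub: "subgroup A (add_monoid M)" using assms by (rule submodule.axioms)
  have AM: "x \<in> carrier M" if "x \<in> A" for x using subgroup.mem_carrier[OF sub that] by simp
  interpret A: abelian_subgroup A M
    using sub by (intro abelian_subgroupI3 additive_subgroup.intro M.abelian_group_axioms) auto
  let ?Q = "quotient_module M A"
  have carr: "X \<in> carrier ?Q \<longleftrightarrow> (\<exists>x \<in> carrier M. X = A +>\<^bsub>M\<^esub> x)" for X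
    by (auto simp: quotient_module_def A_RCOSETS_def')
  have add: "(A +>\<^bsub>M\<^esub> x) \<oplus>\<^bsub>?Q\<^esub> (A +>\<^bsub>M\<^esub> y) = A +>\<^bsub>M\<^esub> (x \<oplus>\<^bsub>M\<^esub> y)"
    if "x \<in> carrier M" "y \<in> carrier M" for x y
    using A.a_rcos_sum[OF that] by (simp add: quotient_module_def)
  have zero: "\<zero>\<^bsub>?Q\<^esub> = A +>\<^bsub>M\<^esub> \<zero>\<^bsub>M\<^esub>"
    using AM by (auto simp: quotient_module_def a_r_coset_def')
  have smult: "r \<odot>\<^bsub>?Q\<^esub> (A +>\<^bsub>M\<^esub> x) = A +>\<^bsub>M\<^esub> (r \<odot>\<^bsub>M\<^esub> x)"
    if r: "r \<in> carrier R" and x: "x \<in> carrier M" for r x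
  proof -
    have "A +>\<^bsub>M\<^esub> (r \<odot>\<^bsub>M\<^esub> y) = A +>\<^bsub>M\<^esub> (r \<odot>\<^bsub>M\<^esub> x)" if y: "y \<in> A +>\<^bsub>M\<^esub> x" for y
    proof -
      obtain a where a: "a \<in> A" "y = a \<oplus>\<^bsub>M\<^esub> x" using y by (auto simp: a_r_coset_def')
      have "r \<odot>\<^bsub>M\<^esub> y = r \<odot>\<^bsub>M\<^esub> a \<oplus>\<^bsub>M\<^esub> r \<odot>\<^bsub>M\<^esub> x"
        using a r x AM by (simp add: smult_r_distr)
      then have "r \<odot>\<^bsub>M\<^esub> y \<in> A +>\<^bsub>M\<^esub> (r \<odot>\<^bsub>M\<^esub> x)"
        using submodule.smult_closed[OF assms r a(1)] by (auto simp: a_r_coset_def')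
      then show ?thesis
        using M.a_repr_independence[OF _ smult_closed[OF r x] sub] by blast
    qed
    moreover have "x \<in> A +>\<^bsub>M\<^esub> x" using x by (rule A.a_rcos_self)
    ultimately have "(\<Union>y \<in> A +>\<^bsub>M\<^esub> x. A +>\<^bsub>M\<^esub> (r \<odot>\<^bsub>M\<^esub> y)) = A +>\<^bsub>M\<^esub> (r \<odot>\<^bsub>M\<^esub> x)"
      by blast
    then show ?thesis by (simp add: quotient_module_def)
  qed
  have "abelian_group ?Q"
  proof (rule abelian_groupI)
    fix X assume "X \<in> carrier ?Q"
    then obtain x where x: "x \<in> carrier M" "X = A +>\<^bsub>M\<^esub> x" using carr by auto
    have "(A +>\<^bsub>M\<^esub> (\<ominus>\<^bsub>M\<^esub> x)) \<oplus>\<^bsub>?Q\<^esub> X = \<zero>\<^bsub>?Q\<^esub>"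
      using x by (simp add: add zero M.l_neg)
    then show "\<exists>Y\<in>carrier ?Q. Y \<oplus>\<^bsub>?Q\<^esub> X = \<zero>\<^bsub>?Q\<^esub>" using x carr by blast
  next
    fix X Y assume "X \<in> carrier ?Q" "Y \<in> carrier ?Q"
    then show "X \<oplus>\<^bsub>?Q\<^esub> Y \<in> carrier ?Q" using carr add M.a_closed by metis
  next
    show "\<zero>\<^bsub>?Q\<^esub> \<in> carrier ?Q" using carr zero by blast
  qed (auto simp: carr add zero M.a_ac)
  then show ?thesis
    by (intro left_module.intro[OF R.ring_axioms] left_module_axioms.intro)
       (auto simp: carr smult add smult_l_distr smult_r_distr smult_assoc1)
qed

lemma (in left_module) harada_moduleI:
  fixes I :: "'i set"
  assumes "harada_decomposition R M I N"
  shows "harada_module R M"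
proof -
  have dec: "direct_decomposition R M I N" and comp: "complements_summands R M I N"
    and loc: "\<And>i. i \<in> I \<Longrightarrow> local_ring (End_ring R (M\<lparr>carrier := N i\<rparr>))"
    using assms by (auto simp: harada_decomposition_def)
  have subm: "submodule (N i) R M" if "i \<in> I" for i
    using dec that by (auto simp: direct_decomposition_def)
  have NM: "N i \<subseteq> carrier M" if "i \<in> I" for i
    using subgroup.subset[OF submodule.axioms(1)[OF subm[OF that]]] by simp
  have nz: "N i \<noteq> {\<zero>\<^bsub>M\<^esub>}" if i: "i \<in> I" for i
  proof
    assume N: "N i = {\<zero>\<^bsub>M\<^esub>}"
    let ?E = "End_ring R (M\<lparr>carrier := N i\<rparr>)"
    have "ideal (carrier ?E - Units ?E) ?E" using loc[OF i] by (simp add: local_ring_def)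
    then have "\<zero>\<^bsub>?E\<^esub> \<in> carrier ?E - Units ?E"
      by (intro additive_subgroup.zero_closed ideal.axioms(1))
    moreover have "\<zero>\<^bsub>?E\<^esub> = \<one>\<^bsub>?E\<^esub>" by (auto simp: End_ring_def N)
    moreover have "ring ?E"
      using left_module.End_ring_is_ring[OF submodule_is_left_module[OF subm[OF i]]] .
    ultimately show False by (metis DiffD2 monoid.Units_one_closed ring.is_monoid)
  qed
  have mem: "N i \<subseteq> family_sum M N J" if "i \<in> J" "i \<in> I" for i J
  proof
    fix x assume x: "x \<in> N i"
    then have "x = (\<Oplus>\<^bsub>M\<^esub>k \<in> {i}. x)" using NM[OF that(2)] by auto
    then show "x \<in> family_sum M N J"
      using that x unfolding family_sum_def
      by (intro CollectI exI[of _ "{i}"] exI[of _ "\<lambda>_. x"]) auto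
  qed
  have inj: "inj_on N I"
  proof (rule inj_onI, rule ccontr)
    fix i j assume ij: "i \<in> I" "j \<in> I" "N i = N j" "i \<noteq> j"
    then have "N i \<subseteq> family_sum M N (I - {i})" using mem[of j "I - {i}"] by auto
    moreover have "N i \<inter> family_sum M N (I - {i}) = {\<zero>\<^bsub>M\<^esub>}"
      using dec ij(1) by (simp add: direct_decomposition_def)
    ultimately show False using nz[OF ij(1)] by auto
  qed
  have sum: "family_sum M (\<lambda>X. X) (N ` J) = family_sum M N J" if J: "J \<subseteq> I" for J
  proof (intro equalityI subsetI)
    fix x assume "x \<in> family_sum M (\<lambda>X. X) (N ` J)"
    then obtain F f where F: "finite F" "F \<subseteq> N ` J" "f \<in> (\<Pi> X \<in> F. X)"
      and x: "x = (\<Oplus>\<^bsub>M\<^esub>X \<in> F. f X)" by (auto simp: family_sum_def)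
    obtain G where G: "G \<subseteq> J" "finite G" "F = N ` G"
      using finite_subset_image[OF F(1,2)] by blast
    have injG: "inj_on N G" using inj G J by (meson inj_on_subset subset_trans)
    have "f \<in> N ` G \<rightarrow> carrier M" using F(3) G J NM by fastforce
    then have "x = (\<Oplus>\<^bsub>M\<^esub>i \<in> G. f (N i))" using M.finsum_reindex[OF _ injG] x G(3) by simp
    then show "x \<in> family_sum M N J"
      using G F(3) unfolding family_sum_def
      by (intro CollectI exI[of _ G] exI[of _ "\<lambda>i. f (N i)"]) auto
  next
    fix x assume "x \<in> family_sum M N J"
    then obtain G f where G: "finite G" "G \<subseteq> J" "f \<in> (\<Pi> i \<in> G. N i)"
      and x: "x = (\<Oplus>\<^bsub>M\<^esub>i \<in> G. f i)" by (auto simp: family_sum_def)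
    have injG: "inj_on N G" using inj G J by (meson inj_on_subset subset_trans)
    let ?g = "\<lambda>X. f (inv_into G N X)"
    have g: "?g (N i) = f i" if "i \<in> G" for i using injG that by simp
    have fM: "f i \<in> carrier M" if "i \<in> G" for i using that G J NM by blast
    then have "?g \<in> N ` G \<rightarrow> carrier M" using g by auto
    then have "(\<Oplus>\<^bsub>M\<^esub>X \<in> N ` G. ?g X) = (\<Oplus>\<^bsub>M\<^esub>i \<in> G. ?g (N i))"
      by (rule M.finsum_reindex[OF _ injG])
    also have "\<dots> = x" unfolding x using g fM by (intro M.finsum_cong') auto
    finally show "x \<in> family_sum M (\<lambda>X. X) (N ` J)"
      using G g unfolding family_sum_def
      by (intro CollectI exI[of _ "N ` G"] exI[of _ ?g]) auto
  qed
  have "direct_decomposition R M (N ` I) (\<lambda>X. X)"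
  proof -
    have "N ` I - {N i} = N ` (I - {i})" if "i \<in> I" for i
      using inj that by (auto dest: inj_onD)
    then show ?thesis using dec sum by (simp add: direct_decomposition_def)
  qed
  moreover have "complements_summands R M (N ` I) (\<lambda>X. X)"
    unfolding complements_summands_def
  proof (intro allI impI)
    fix K assume "direct_summand R M K"
    then obtain J where "J \<subseteq> I" "direct_sum R M K (family_sum M N J)"
      using comp by (auto simp: complements_summands_def)
    then show "\<exists>J' \<subseteq> N ` I. direct_sum R M K (family_sum M (\<lambda>X. X) J')"
      using sum by (intro exI[of _ "N ` J"]) auto
  qed
  ultimately have "harada_decomposition R M (N ` I) (\<lambda>X. X)"
    using loc by (auto simp: harada_decomposition_def)
  then show ?thesis unfolding harada_module_def by blast
qed

end

theory Submission
  imports Defs "HOL-Library.Multiset"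
begin

text \<open>
  Both kinds of modules satisfy two conditions: the union of a chain of direct summands is a
  direct summand, and every non-zero direct summand contains a non-zero one with local
  endomorphism ring. These conditions imply the PSB-property.

  By Zorn's lemma, each endomorphism \<^verbatim>\<open>h\<close> and summand \<^verbatim>\<open>A\<close> give \<^verbatim>\<open>A = X \<oplus> A0\<close>, where \<^verbatim>\<open>h\<close> splits on
  \<^verbatim>\<open>A0\<close> and on no non-zero summand inside \<^verbatim>\<open>X\<close>; and \<^verbatim>\<open>1 - h\<close> is bijective if \<^verbatim>\<open>h\<close> splits on no non-zero
  summand at all. For summands \<^verbatim>\<open>A\<close>, \<^verbatim>\<open>B\<close> and \<^verbatim>\<open>h\<close> the projection along \<^verbatim>\<open>B\<close>, this yields
  \<^verbatim>\<open>A = X \<oplus> A0\<close>, \<^verbatim>\<open>B = X' \<oplus> B0\<close> and \<^verbatim>\<open>M = A0 \<oplus> X' \<oplus> B0 \<oplus> D\<close> such that \<^verbatim>\<open>X\<close> and \<^verbatim>\<open>X'\<close>, the substitutes for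
  \<^verbatim>\<open>A \<inter> B\<close>, are interchangeable in direct decompositions. If \<^verbatim>\<open>A\<close> is perspective to a summand of \<^verbatim>\<open>B\<close>,
  then \<^verbatim>\<open>A0\<close> embeds into \<^verbatim>\<open>B0\<close> as a summand. A Cantor--Bernstein argument gives an isomorphism of
  \<^verbatim>\<open>A0\<close> and \<^verbatim>\<open>B0\<close>, and its graph together with \<^verbatim>\<open>D\<close> is a common complement of \<^verbatim>\<open>A\<close> and \<^verbatim>\<open>B\<close>.

  For a discrete module, \<^verbatim>\<open>1 - h\<close> is bijective whenever the image of \<^verbatim>\<open>h\<close> is small; this and \<^verbatim>\<open>D1\<close>
  show that the union of a chain of summands is a summand. For a Harada module, the same is
  deduced from the semi-T-nilpotency of the components.
\<close>

section \<open>Submodules and endomorphisms\<close>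

text \<open>Two obstacles shape the proof. The intersection of two summands need not be a summand,
  and isomorphic summands cannot be cancelled: \<open>A0 \<oplus> X\<close> may embed into
  \<open>B0 \<oplus> X'\<close> with \<open>X\<close> isomorphic to \<open>X'\<close> although
  \<open>A0\<close> does not embed into \<open>B0\<close>, as happens for vector spaces of infinite
  dimension. The first is met by working modulo maps that are invertible on no non-zero summand. The
  map \<open>h\<close> splits on \<open>A0\<close> precisely when \<open>A0\<close> meets
  \<open>B\<close> in zero and \<open>A0 + B\<close> is a summand, so \<open>A0\<close> is a maximal
  part of \<open>A\<close> independent of \<open>B\<close>. On \<open>X\<close> the projection
  \<open>1 - h\<close> onto \<open>B\<close> is the identity up to such a map, and therefore moves
  \<open>X\<close> into \<open>B\<close> without changing its complements. The second is met because
  perspectivity is stronger than isomorphism: a common complement of \<open>A\<close> and a summand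
  \<open>B'\<close> of \<open>B\<close> allows the part that \<open>X\<close> shares with
  \<open>B'\<close> to be cancelled. Conversely, an isomorphism yields a perspectivity as soon as
  the two summands are independent, which \<open>A0\<close> and \<open>B0\<close> are.\<close>

lemma set_add_iff: "x \<in> A <+>\<^bsub>G\<^esub> B \<longleftrightarrow> (\<exists>a\<in>A. \<exists>b\<in>B. x = a \<oplus>\<^bsub>G\<^esub> b)"
  by (auto simp: set_add_def')

lemma set_addI: "\<lbrakk>a \<in> A; b \<in> B\<rbrakk> \<Longrightarrow> a \<oplus>\<^bsub>G\<^esub> b \<in> A <+>\<^bsub>G\<^esub> B"
  by (auto simp: set_add_iff)

context left_module
begin

abbreviation endo where "endo \<equiv> lmodule_hom R M M"
abbreviation sub where "sub A \<equiv> submodule A R M"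
abbreviation summand where "summand A \<equiv> direct_summand R M A"
abbreviation dsum where "dsum A B \<equiv> direct_sum R M A B"

lemma endoI:
  assumes "\<And>x. x \<in> carrier M \<Longrightarrow> f x \<in> carrier M"
    and "\<And>x y. \<lbrakk>x \<in> carrier M; y \<in> carrier M\<rbrakk> \<Longrightarrow> f (x \<oplus>\<^bsub>M\<^esub> y) = f x \<oplus>\<^bsub>M\<^esub> f y"
    and "\<And>r x. \<lbrakk>r \<in> carrier R; x \<in> carrier M\<rbrakk> \<Longrightarrow> f (r \<odot>\<^bsub>M\<^esub> x) = r \<odot>\<^bsub>M\<^esub> f x"
  shows "f \<in> endo"
  using assms by (auto simp: lmodule_hom_def)

lemma endo_closed [simp]: "\<lbrakk>f \<in> endo; x \<in> carrier M\<rbrakk> \<Longrightarrow> f x \<in> carrier M"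
  by (auto simp: lmodule_hom_def)

lemma endo_add: "\<lbrakk>f \<in> endo; x \<in> carrier M; y \<in> carrier M\<rbrakk> \<Longrightarrow> f (x \<oplus>\<^bsub>M\<^esub> y) = f x \<oplus>\<^bsub>M\<^esub> f y"
  unfolding lmodule_hom_def by blast

lemma endo_smult: "\<lbrakk>f \<in> endo; r \<in> carrier R; x \<in> carrier M\<rbrakk> \<Longrightarrow> f (r \<odot>\<^bsub>M\<^esub> x) = r \<odot>\<^bsub>M\<^esub> f x"
  unfolding lmodule_hom_def by blast

lemma endo_zero [simp]: "f \<in> endo \<Longrightarrow> f \<zero>\<^bsub>M\<^esub> = \<zero>\<^bsub>M\<^esub>"
  using endo_add[of f "\<zero>\<^bsub>M\<^esub>" "\<zero>\<^bsub>M\<^esub>"] endo_closed[of f "\<zero>\<^bsub>M\<^esub>"] by (metis M.add.r_cancel_one' M.zero_closed M.l_zero)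

lemma endo_neg: "\<lbrakk>f \<in> endo; x \<in> carrier M\<rbrakk> \<Longrightarrow> f (\<ominus>\<^bsub>M\<^esub> x) = \<ominus>\<^bsub>M\<^esub> f x"
  using endo_add[of f "\<ominus>\<^bsub>M\<^esub> x" x] by (simp add: M.l_neg M.minus_equality)

lemma endo_minus: "\<lbrakk>f \<in> endo; x \<in> carrier M; y \<in> carrier M\<rbrakk> \<Longrightarrow> f (x \<ominus>\<^bsub>M\<^esub> y) = f x \<ominus>\<^bsub>M\<^esub> f y"
  by (simp add: a_minus_def endo_add endo_neg)

lemmas endo_simps = endo_add endo_smult endo_neg endo_minus

lemma neg_zero [simp]: "\<ominus>\<^bsub>M\<^esub> \<zero>\<^bsub>M\<^esub> = \<zero>\<^bsub>M\<^esub>"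
  using M.r_neg[of "\<zero>\<^bsub>M\<^esub>"] by simp

lemma minus_zero [simp]: "x \<in> carrier M \<Longrightarrow> x \<ominus>\<^bsub>M\<^esub> \<zero>\<^bsub>M\<^esub> = x"
  by (simp add: a_minus_def)

lemma add_neg_cancel: "\<lbrakk>x \<in> carrier M; y \<in> carrier M\<rbrakk> \<Longrightarrow> y \<oplus>\<^bsub>M\<^esub> (x \<oplus>\<^bsub>M\<^esub> \<ominus>\<^bsub>M\<^esub> y) = x"
  by (simp add: M.a_lcomm M.r_neg)

text \<open>These rules move every subtraction outwards and across the equality, after which
  associativity and commutativity decide the identities between elements of
  \<open>M\<close>.\<close>

lemma diff_solve:
  assumes "x \<in> carrier M" "y \<in> carrier M" "z \<in> carrier M"
  shows "x \<ominus>\<^bsub>M\<^esub> y = z \<longleftrightarrow> x = z \<oplus>\<^bsub>M\<^esub> y" "z = x \<ominus>\<^bsub>M\<^esub> y \<longleftrightarrow> x = z \<oplus>\<^bsub>M\<^esub> y"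
    "x \<oplus>\<^bsub>M\<^esub> (y \<ominus>\<^bsub>M\<^esub> z) = (x \<oplus>\<^bsub>M\<^esub> y) \<ominus>\<^bsub>M\<^esub> z" "(y \<ominus>\<^bsub>M\<^esub> z) \<oplus>\<^bsub>M\<^esub> x = (y \<oplus>\<^bsub>M\<^esub> x) \<ominus>\<^bsub>M\<^esub> z"
    "x \<ominus>\<^bsub>M\<^esub> (y \<ominus>\<^bsub>M\<^esub> z) = (x \<oplus>\<^bsub>M\<^esub> z) \<ominus>\<^bsub>M\<^esub> y" "(x \<ominus>\<^bsub>M\<^esub> y) \<ominus>\<^bsub>M\<^esub> z = x \<ominus>\<^bsub>M\<^esub> (y \<oplus>\<^bsub>M\<^esub> z)"
  using assms by (auto simp: M.minus_eq M.a_ac M.r_neg M.l_neg M.minus_add add_neg_cancel)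

lemmas diff_simps = diff_solve M.a_ac

lemma minus_self [simp]: "x \<in> carrier M \<Longrightarrow> x \<ominus>\<^bsub>M\<^esub> x = \<zero>\<^bsub>M\<^esub>"
  by (simp add: diff_simps)

lemma minus_add_cancel [simp]: "\<lbrakk>x \<in> carrier M; y \<in> carrier M\<rbrakk> \<Longrightarrow> (x \<ominus>\<^bsub>M\<^esub> y) \<oplus>\<^bsub>M\<^esub> y = x"
  by (simp add: diff_simps)

lemma add_minus_cancel [simp]: "\<lbrakk>x \<in> carrier M; y \<in> carrier M\<rbrakk> \<Longrightarrow> (x \<oplus>\<^bsub>M\<^esub> y) \<ominus>\<^bsub>M\<^esub> y = x"
  by (simp add: diff_simps)

lemma add_minus_cancel_right [simp]: "\<lbrakk>x \<in> carrier M; y \<in> carrier M\<rbrakk> \<Longrightarrow> y \<oplus>\<^bsub>M\<^esub> (x \<ominus>\<^bsub>M\<^esub> y) = x"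
  by (simp add: diff_simps)

lemma minus_minus_cancel [simp]: "\<lbrakk>x \<in> carrier M; y \<in> carrier M\<rbrakk> \<Longrightarrow> x \<ominus>\<^bsub>M\<^esub> (x \<ominus>\<^bsub>M\<^esub> y) = y"
  by (simp add: diff_simps)

lemma endo_id [simp, intro]: "(\<lambda>x. x) \<in> endo"
  by (rule endoI) auto

lemma endo_const [simp, intro]: "(\<lambda>x. \<zero>\<^bsub>M\<^esub>) \<in> endo"
  by (rule endoI) (auto simp: smult_r_null)

lemma endo_comp: "\<lbrakk>f \<in> endo; g \<in> endo\<rbrakk> \<Longrightarrow> (\<lambda>x. f (g x)) \<in> endo"
  by (rule endoI) (auto simp: endo_simps)

lemma endo_plus: "\<lbrakk>f \<in> endo; g \<in> endo\<rbrakk> \<Longrightarrow> (\<lambda>x. f x \<oplus>\<^bsub>M\<^esub> g x) \<in> endo"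
  by (rule endoI) (auto simp: endo_simps smult_r_distr M.a_ac)

lemma endo_uminus: "f \<in> endo \<Longrightarrow> (\<lambda>x. \<ominus>\<^bsub>M\<^esub> f x) \<in> endo"
  by (rule endoI) (auto simp: endo_simps smult_r_neg M.minus_add)

lemma endo_diff: "\<lbrakk>f \<in> endo; g \<in> endo\<rbrakk> \<Longrightarrow> (\<lambda>x. f x \<ominus>\<^bsub>M\<^esub> g x) \<in> endo"
  unfolding a_minus_def by (intro endo_plus endo_uminus)

section \<open>Submodules: sums, images, kernels and unions of chains\<close>

lemma subI:
  assumes "A \<subseteq> carrier M" "\<zero>\<^bsub>M\<^esub> \<in> A" "\<And>x y. \<lbrakk>x \<in> A; y \<in> A\<rbrakk> \<Longrightarrow> x \<oplus>\<^bsub>M\<^esub> y \<in> A"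
    "\<And>r x. \<lbrakk>r \<in> carrier R; x \<in> A\<rbrakk> \<Longrightarrow> r \<odot>\<^bsub>M\<^esub> x \<in> A"
  shows "sub A"
proof (intro submodule.intro subgroup.intro submodule_axioms.intro)
  fix x assume "x \<in> A"
  then have x: "x \<in> carrier M" using assms(1) by auto
  \<comment> \<open>Closure under negation comes from the scalar
    \<open>\<ominus> \<one>\<close>.\<close>
  have "(\<ominus> \<one>) \<odot>\<^bsub>M\<^esub> x \<oplus>\<^bsub>M\<^esub> x = ((\<ominus> \<one>) \<oplus> \<one>) \<odot>\<^bsub>M\<^esub> x" using x by (simp add: smult_l_distr)
  also have "\<dots> = \<zero>\<^bsub>M\<^esub> " using x smult_l_distr[of "\<zero>" "\<zero>" x]
    by (metis M.add.r_cancel_one' R.l_neg R.l_zero R.one_closed R.zero_closed smult_closed)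
  finally have "\<ominus>\<^bsub>M\<^esub> x = (\<ominus> \<one>) \<odot>\<^bsub>M\<^esub> x" using x by (simp add: M.minus_equality)
  then show "inv\<^bsub>add_monoid M\<^esub> x \<in> A"
    using assms(4)[OF R.a_inv_closed[OF R.one_closed] \<open>x \<in> A\<close>] by (simp add: a_inv_def)
qed (use assms in auto)

lemma subD:
  assumes "sub A"
  shows "A \<subseteq> carrier M" "\<zero>\<^bsub>M\<^esub> \<in> A" "\<And>x y. \<lbrakk>x \<in> A; y \<in> A\<rbrakk> \<Longrightarrow> x \<oplus>\<^bsub>M\<^esub> y \<in> A"
    "\<And>r x. \<lbrakk>r \<in> carrier R; x \<in> A\<rbrakk> \<Longrightarrow> r \<odot>\<^bsub>M\<^esub> x \<in> A"
    "\<And>x. x \<in> A \<Longrightarrow> \<ominus>\<^bsub>M\<^esub> x \<in> A" "\<And>x y. \<lbrakk>x \<in> A; y \<in> A\<rbrakk> \<Longrightarrow> x \<ominus>\<^bsub>M\<^esub> y \<in> A"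
    "\<And>x. x \<in> A \<Longrightarrow> x \<in> carrier M"
proof -
  have s: "subgroup A (add_monoid M)" using assms by (rule submodule.axioms)
  show "A \<subseteq> carrier M" "\<zero>\<^bsub>M\<^esub> \<in> A" "\<And>x y. \<lbrakk>x \<in> A; y \<in> A\<rbrakk> \<Longrightarrow> x \<oplus>\<^bsub>M\<^esub> y \<in> A"
    using subgroup.subset[OF s] subgroup.one_closed[OF s] subgroup.m_closed[OF s] by auto
  then show "\<And>x. x \<in> A \<Longrightarrow> x \<in> carrier M" by auto
  show "\<And>r x. \<lbrakk>r \<in> carrier R; x \<in> A\<rbrakk> \<Longrightarrow> r \<odot>\<^bsub>M\<^esub> x \<in> A" by (rule submodule.smult_closed[OF assms])
  show n: "\<ominus>\<^bsub>M\<^esub> x \<in> A" if "x \<in> A" for x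
    using subgroup.m_inv_closed[OF s that] by (simp add: a_inv_def)
  show "x \<ominus>\<^bsub>M\<^esub> y \<in> A" if "x \<in> A" "y \<in> A" for x y
    using subgroup.m_closed[OF s that(1) n[OF that(2)]] by (simp add: a_minus_def)
qed

lemma sub_zero [simp, intro]: "sub {\<zero>\<^bsub>M\<^esub>}"
  by (rule subI) (auto simp: smult_r_null)

lemma sub_carrier [simp, intro]: "sub (carrier M)"
  by (rule subI) auto

lemma sub_inter [intro]: "\<lbrakk>sub A; sub B\<rbrakk> \<Longrightarrow> sub (A \<inter> B)"
  by (rule subI) (auto dest: subD intro: subD(3,4))

lemma sub_plus [intro]:
  assumes A: "sub A" and B: "sub B"
  shows "sub (A <+>\<^bsub>M\<^esub> B)"
proof (rule subI)
  show "A <+>\<^bsub>M\<^esub> B \<subseteq> carrier M" using A B by (auto simp: set_add_iff intro!: M.a_closed dest: subD(7))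
  show "\<zero>\<^bsub>M\<^esub> \<in> A <+>\<^bsub>M\<^esub> B" unfolding set_add_iff using subD(2)[OF A] subD(2)[OF B] M.l_zero M.zero_closed by metis
  fix x y assume "x \<in> A <+>\<^bsub>M\<^esub> B" "y \<in> A <+>\<^bsub>M\<^esub> B"
  then obtain a b c d where *: "a \<in> A" "b \<in> B" "x = a \<oplus>\<^bsub>M\<^esub> b" "c \<in> A" "d \<in> B" "y = c \<oplus>\<^bsub>M\<^esub> d"
    by (auto simp: set_add_iff)
  then have "x \<oplus>\<^bsub>M\<^esub> y = (a \<oplus>\<^bsub>M\<^esub> c) \<oplus>\<^bsub>M\<^esub> (b \<oplus>\<^bsub>M\<^esub> d)" using A B by (simp add: M.a_ac subD(7))
  then show "x \<oplus>\<^bsub>M\<^esub> y \<in> A <+>\<^bsub>M\<^esub> B" unfolding set_add_iff using * subD(3)[OF A] subD(3)[OF B] by blast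
next
  fix r x assume r: "r \<in> carrier R" and "x \<in> A <+>\<^bsub>M\<^esub> B"
  then obtain a b where *: "a \<in> A" "b \<in> B" "x = a \<oplus>\<^bsub>M\<^esub> b" by (auto simp: set_add_iff)
  then have "r \<odot>\<^bsub>M\<^esub> x = r \<odot>\<^bsub>M\<^esub> a \<oplus>\<^bsub>M\<^esub> r \<odot>\<^bsub>M\<^esub> b" using A B r by (simp add: smult_r_distr subD(7))
  then show "r \<odot>\<^bsub>M\<^esub> x \<in> A <+>\<^bsub>M\<^esub> B" unfolding set_add_iff using * r subD(4)[OF A] subD(4)[OF B] by blast
qed

lemma sub_image [intro]:
  assumes f: "f \<in> endo" and A: "sub A"
  shows "sub (f ` A)"
proof (rule subI)
  show "f ` A \<subseteq> carrier M" using f subD(7)[OF A] by auto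
  show "\<zero>\<^bsub>M\<^esub> \<in> f ` A" using endo_zero[OF f] subD(2)[OF A] by force
next
  fix x y assume "x \<in> f ` A" "y \<in> f ` A"
  then obtain a b where "a \<in> A" "b \<in> A" "x = f a" "y = f b" by auto
  then show "x \<oplus>\<^bsub>M\<^esub> y \<in> f ` A"
    using endo_add[OF f] subD(3,7)[OF A] by (intro image_eqI[of _ _ "a \<oplus>\<^bsub>M\<^esub> b"]) auto
next
  fix r x assume "r \<in> carrier R" "x \<in> f ` A"
  then obtain a where "a \<in> A" "x = f a" by auto
  then show "r \<odot>\<^bsub>M\<^esub> x \<in> f ` A"
    using endo_smult[OF f] subD(4,7)[OF A] \<open>r \<in> carrier R\<close> by (intro image_eqI[of _ _ "r \<odot>\<^bsub>M\<^esub> a"]) auto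
qed

lemma sub_ker [intro]: "f \<in> endo \<Longrightarrow> sub {x \<in> carrier M. f x = \<zero>\<^bsub>M\<^esub>}"
  by (rule subI) (auto simp: endo_simps smult_r_null)

lemma sub_Union_chain:
  assumes "C \<noteq> {}" "subset.chain UNIV C" "\<And>A. A \<in> C \<Longrightarrow> sub A"
  shows "sub (\<Union>C)"
proof (rule subI)
  show "\<Union>C \<subseteq> carrier M" using assms(3) subD(1) by blast
  show "\<zero>\<^bsub>M\<^esub> \<in> \<Union>C" using assms(1,3) subD(2) by blast
  fix x y assume "x \<in> \<Union>C" "y \<in> \<Union>C"
  then obtain A B where AB: "A \<in> C" "B \<in> C" "x \<in> A" "y \<in> B" by auto
  then have "A \<subseteq> B \<or> B \<subseteq> A" using assms(2) by (auto simp: subset_chain_def)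
  then show "x \<oplus>\<^bsub>M\<^esub> y \<in> \<Union>C" using AB subD(3)[OF assms(3)] by blast
next
  fix r x assume "r \<in> carrier R" "x \<in> \<Union>C" then show "r \<odot>\<^bsub>M\<^esub> x \<in> \<Union>C" using subD(4)[OF assms(3)] by blast
qed

lemma plus_zero [simp]: "sub A \<Longrightarrow> A <+>\<^bsub>M\<^esub> {\<zero>\<^bsub>M\<^esub>} = A" "sub A \<Longrightarrow> {\<zero>\<^bsub>M\<^esub>} <+>\<^bsub>M\<^esub> A = A"
  by (auto simp: set_add_iff subD(7))

lemma plus_upper:
  assumes "sub A" "sub B" shows "A \<subseteq> A <+>\<^bsub>M\<^esub> B" "B \<subseteq> A <+>\<^bsub>M\<^esub> B"
proof
  fix x assume "x \<in> A" then show "x \<in> A <+>\<^bsub>M\<^esub> B"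
    unfolding set_add_iff using assms subD(2,7) M.r_zero by metis
next
  show "B \<subseteq> A <+>\<^bsub>M\<^esub> B"
  proof
    fix x assume "x \<in> B" then show "x \<in> A <+>\<^bsub>M\<^esub> B"
    unfolding set_add_iff using assms subD(2,7) M.l_zero by metis
  qed
qed

lemma plus_least: "\<lbrakk>sub C; A \<subseteq> C; B \<subseteq> C\<rbrakk> \<Longrightarrow> A <+>\<^bsub>M\<^esub> B \<subseteq> C"
  by (fastforce simp: set_add_iff intro: subD(3))

lemma plus_mono: "\<lbrakk>A \<subseteq> A'; B \<subseteq> B'\<rbrakk> \<Longrightarrow> A <+>\<^bsub>M\<^esub> B \<subseteq> A' <+>\<^bsub>M\<^esub> B'"
  by (fastforce simp: set_add_iff)

lemma plus_comm: "\<lbrakk>sub A; sub B\<rbrakk> \<Longrightarrow> A <+>\<^bsub>M\<^esub> B = B <+>\<^bsub>M\<^esub> A"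
  by (intro equalityI plus_least sub_plus plus_upper)

lemma plus_assoc: "\<lbrakk>sub A; sub B; sub C\<rbrakk> \<Longrightarrow> (A <+>\<^bsub>M\<^esub> B) <+>\<^bsub>M\<^esub> C = A <+>\<^bsub>M\<^esub> (B <+>\<^bsub>M\<^esub> C)"
  by (intro equalityI plus_least sub_plus)
    (meson plus_upper sub_plus subset_trans)+

section \<open>Projections\<close>

lemma dsumD:
  assumes "dsum A B" shows "sub A" "sub B" "A <+>\<^bsub>M\<^esub> B = carrier M" "A \<inter> B = {\<zero>\<^bsub>M\<^esub>}"
  using assms by (auto simp: direct_sum_def)

lemma dsum_sym: "dsum A B \<Longrightarrow> dsum B A"
  by (auto simp: direct_sum_def plus_comm)

text \<open>The component in \<open>A\<close> is unique because two candidates differ by an element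
  of \<open>A \<inter> B\<close>; uniqueness gives linearity. Projections are endomorphisms of all
  of \<open>M\<close>, so that they can be composed freely.\<close>

lemma dsum_proj:
  assumes "dsum A B"
  obtains e where "e \<in> endo" "\<And>x. x \<in> carrier M \<Longrightarrow> e x \<in> A" "\<And>x. x \<in> A \<Longrightarrow> e x = x"
    "\<And>x. x \<in> carrier M \<Longrightarrow> e x = \<zero>\<^bsub>M\<^esub> \<longleftrightarrow> x \<in> B" "\<And>x. x \<in> carrier M \<Longrightarrow> x \<ominus>\<^bsub>M\<^esub> e x \<in> B"
proof -
  note AB = dsumD[OF assms]
  note A = subD[OF AB(1)] and B = subD[OF AB(2)]
  have ex: "\<exists>a\<in>A. x \<ominus>\<^bsub>M\<^esub> a \<in> B" if x: "x \<in> carrier M" for x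
  proof -
    obtain a b where "a \<in> A" "b \<in> B" "x = a \<oplus>\<^bsub>M\<^esub> b" using x unfolding AB(3)[symmetric] set_add_iff by blast
    moreover then have "x \<ominus>\<^bsub>M\<^esub> a = b" using A(7)[of a] B(7)[of b] by (simp add: diff_simps)
    ultimately show ?thesis by metis
  qed
  define e where "e x = (SOME a. a \<in> A \<and> x \<ominus>\<^bsub>M\<^esub> a \<in> B)" for x
  have e: "e x \<in> A" "x \<ominus>\<^bsub>M\<^esub> e x \<in> B" if "x \<in> carrier M" for x
    using someI_ex[of "\<lambda>a. a \<in> A \<and> x \<ominus>\<^bsub>M\<^esub> a \<in> B"] ex[OF that] unfolding e_def by blast+
  have uniq: "e x = a" if x: "x \<in> carrier M" and a: "a \<in> A" and b: "x \<ominus>\<^bsub>M\<^esub> a \<in> B" for x a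
  proof -
    have "e x \<ominus>\<^bsub>M\<^esub> a = (x \<ominus>\<^bsub>M\<^esub> a) \<ominus>\<^bsub>M\<^esub> (x \<ominus>\<^bsub>M\<^esub> e x)"
      using x A(7)[OF a] A(7)[OF e(1)[OF x]] by (simp add: diff_simps)
    also have "\<dots> \<in> B" using b e(2)[OF x] by (rule B(6))
    finally have "e x \<ominus>\<^bsub>M\<^esub> a \<in> A \<inter> B" using A(6)[OF e(1)[OF x] a] by simp
    then have "e x \<ominus>\<^bsub>M\<^esub> a = \<zero>\<^bsub>M\<^esub>" using AB(4) by simp
    then show ?thesis using A(7)[OF a] A(7)[OF e(1)[OF x]] by (simp add: diff_solve(1))
  qed
  show thesis
  proof
    show "e \<in> endo"
    proof (rule endoI)
      show c: "e x \<in> carrier M" if "x \<in> carrier M" for x using A(7) e(1)[OF that] .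
      fix x y assume x: "x \<in> carrier M" and y: "y \<in> carrier M"
      have "(x \<oplus>\<^bsub>M\<^esub> y) \<ominus>\<^bsub>M\<^esub> (e x \<oplus>\<^bsub>M\<^esub> e y) = (x \<ominus>\<^bsub>M\<^esub> e x) \<oplus>\<^bsub>M\<^esub> (y \<ominus>\<^bsub>M\<^esub> e y)"
        using x y c[OF x] c[OF y] by (simp add: diff_simps)
      then show "e (x \<oplus>\<^bsub>M\<^esub> y) = e x \<oplus>\<^bsub>M\<^esub> e y" using x y e A(3) B(3) by (intro uniq) auto
    next
      fix r x assume r: "r \<in> carrier R" and x: "x \<in> carrier M"
      have "r \<odot>\<^bsub>M\<^esub> x \<ominus>\<^bsub>M\<^esub> r \<odot>\<^bsub>M\<^esub> e x = r \<odot>\<^bsub>M\<^esub> (x \<ominus>\<^bsub>M\<^esub> e x)"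
        using r x A(7)[OF e(1)[OF x]] by (simp add: a_minus_def smult_r_distr smult_r_neg)
      then show "e (r \<odot>\<^bsub>M\<^esub> x) = r \<odot>\<^bsub>M\<^esub> e x" using r x e A(4) B(4) by (intro uniq) auto
    qed
    fix x assume x: "x \<in> carrier M"
    show "e x \<in> A" "x \<ominus>\<^bsub>M\<^esub> e x \<in> B" using e x by auto
    show "e x = \<zero>\<^bsub>M\<^esub> \<longleftrightarrow> x \<in> B"
      using uniq[OF x A(2)] e(2)[OF x] x by (metis minus_zero)
  next
    fix x assume "x \<in> A" then show "e x = x" using A(7)[of x] B(2) by (intro uniq) auto
  qed
qed

text \<open>An idempotent splits the module by \<open>x = e x \<oplus> (x \<ominus> e x)\<close>.
  Exhibiting an idempotent with image \<open>A\<close> is the way in which summands are recognized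
  throughout.\<close>

lemma dsum_ker:
  assumes "e \<in> endo" "\<And>x. x \<in> carrier M \<Longrightarrow> e x \<in> A" "\<And>x. x \<in> A \<Longrightarrow> e x = x" "A \<subseteq> carrier M"
  shows "dsum A {x \<in> carrier M. e x = \<zero>\<^bsub>M\<^esub>}"
proof -
  have A: "A = e ` carrier M" using assms(2-4) by force
  then have "sub A" using assms(1) by auto
  moreover have "carrier M \<subseteq> A <+>\<^bsub>M\<^esub> {x \<in> carrier M. e x = \<zero>\<^bsub>M\<^esub>}"
  proof
    fix x assume x: "x \<in> carrier M"
    then have "x \<ominus>\<^bsub>M\<^esub> e x \<in> {x \<in> carrier M. e x = \<zero>\<^bsub>M\<^esub>}"
      using assms by (auto simp: endo_simps)
    moreover have "x = e x \<oplus>\<^bsub>M\<^esub> (x \<ominus>\<^bsub>M\<^esub> e x)" using x assms(1) by simp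
    ultimately show "x \<in> A <+>\<^bsub>M\<^esub> {x \<in> carrier M. e x = \<zero>\<^bsub>M\<^esub>}"
      unfolding set_add_iff using assms(2)[OF x] by blast
  qed
  moreover have "A \<inter> {x \<in> carrier M. e x = \<zero>\<^bsub>M\<^esub>} = {\<zero>\<^bsub>M\<^esub>}"
    using assms(1,3) subD(2)[OF \<open>sub A\<close>] by auto
  ultimately show ?thesis unfolding direct_sum_def
    using assms(1) plus_least[of "carrier M" A "{x \<in> carrier M. e x = \<zero>\<^bsub>M\<^esub>}"] assms(4) by auto
qed

lemma summandI:
  assumes "e \<in> endo" "\<And>x. x \<in> carrier M \<Longrightarrow> e x \<in> A" "\<And>x. x \<in> A \<Longrightarrow> e x = x" "A \<subseteq> carrier M"
  shows "summand A"
  using dsum_ker[OF assms] by (auto simp: direct_summand_def)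

lemma summand_proj:
  assumes "summand A"
  obtains e where "e \<in> endo" "\<And>x. x \<in> carrier M \<Longrightarrow> e x \<in> A" "\<And>x. x \<in> A \<Longrightarrow> e x = x"
  using assms dsum_proj unfolding direct_summand_def by metis

lemma summand_sub: "summand A \<Longrightarrow> sub A"
  by (auto simp: direct_summand_def direct_sum_def)

lemma dsum_zero [simp]: "dsum {\<zero>\<^bsub>M\<^esub>} (carrier M)" "dsum (carrier M) {\<zero>\<^bsub>M\<^esub>}"
  by (auto simp: direct_sum_def)

lemma summand_zero [simp]: "summand {\<zero>\<^bsub>M\<^esub>}" and summand_carrier [simp]: "summand (carrier M)"
  unfolding direct_summand_def using dsum_zero by blast+

text \<open>The inverse of \<open>f\<close> on \<open>B\<close> is composed with a projection onto
  \<open>B\<close>, which turns it into an endomorphism of \<open>M\<close>. In this way all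
  homomorphisms between summands occur as restrictions of endomorphisms.\<close>

lemma iso_inverse:
  assumes f: "f \<in> endo" and A: "summand A" and B: "summand B" and bij: "bij_betw f A B"
  obtains g where "g \<in> endo" "\<And>x. x \<in> carrier M \<Longrightarrow> g x \<in> A" "\<And>x. x \<in> A \<Longrightarrow> g (f x) = x"
    "\<And>y. y \<in> B \<Longrightarrow> f (g y) = y"
proof -
  obtain e where e: "e \<in> endo" "\<And>x. x \<in> carrier M \<Longrightarrow> e x \<in> B" "\<And>x. x \<in> B \<Longrightarrow> e x = x"
    using summand_proj[OF B] by blast
  note sA = subD[OF summand_sub[OF A]]
  define g where "g x = inv_into A f (e x)" for x
  have inj: "inj_on f A" and img: "f ` A = B" using bij by (auto simp: bij_betw_def)
  have gA: "g x \<in> A" "f (g x) = e x" if "x \<in> carrier M" for x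
    using e(2)[OF that] img unfolding g_def by (metis inv_into_into, metis f_inv_into_f)
  have uniq: "g x = a" if "x \<in> carrier M" "a \<in> A" "f a = e x" for x a
    using gA[OF that(1)] that inj by (metis inj_onD)
  show thesis
  proof
    show "g \<in> endo"
    proof (rule endoI)
      show "g x \<in> carrier M" if "x \<in> carrier M" for x using gA(1)[OF that] sA(7) by auto
      fix x y assume x: "x \<in> carrier M" and y: "y \<in> carrier M"
      then have "f (g x \<oplus>\<^bsub>M\<^esub> g y) = e (x \<oplus>\<^bsub>M\<^esub> y)"
        using gA(1)[THEN sA(7)] by (simp add: endo_add[OF f] endo_add[OF e(1)] gA(2))
      then show "g (x \<oplus>\<^bsub>M\<^esub> y) = g x \<oplus>\<^bsub>M\<^esub> g y" using x y gA(1) sA(3) by (intro uniq) auto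
    next
      fix r x assume r: "r \<in> carrier R" and x: "x \<in> carrier M"
      then have "f (r \<odot>\<^bsub>M\<^esub> g x) = e (r \<odot>\<^bsub>M\<^esub> x)"
        using gA(1)[THEN sA(7)] by (simp add: endo_smult[OF f] endo_smult[OF e(1)] gA(2))
      then show "g (r \<odot>\<^bsub>M\<^esub> x) = r \<odot>\<^bsub>M\<^esub> g x" using r x gA(1) sA(4) by (intro uniq) auto
    qed
    show "x \<in> carrier M \<Longrightarrow> g x \<in> A" for x using gA by auto
    show "x \<in> A \<Longrightarrow> g (f x) = x" for x using sA(7)[of x] e(3) img by (intro uniq) (auto simp: f)
    show "y \<in> B \<Longrightarrow> f (g y) = y" for y using subD(7)[OF summand_sub[OF B]] gA(2) e(3) by auto
  qed
qed

lemma endo_inverse: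
  assumes "f \<in> endo" "bij_betw f (carrier M) (carrier M)"
  obtains g where "g \<in> endo" "\<And>x. x \<in> carrier M \<Longrightarrow> g (f x) = x" "\<And>x. x \<in> carrier M \<Longrightarrow> f (g x) = x"
  using iso_inverse[OF assms(1) summand_carrier summand_carrier assms(2)] by metis

lemma dsum_image:
  assumes f: "f \<in> endo" and bij: "bij_betw f (carrier M) (carrier M)" and d: "dsum A B"
  shows "dsum (f ` A) (f ` B)"
proof -
  note d = dsumD[OF d]
  have inj: "inj_on f (carrier M)" and img: "f ` carrier M = carrier M" using bij by (auto simp: bij_betw_def)
  have "f ` A \<inter> f ` B = f ` (A \<inter> B)"
    using inj_on_image_Int[OF inj subD(1)[OF d(1)] subD(1)[OF d(2)]] by simp
  moreover have "f ` A <+>\<^bsub>M\<^esub> f ` B = carrier M"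
  proof
    show "f ` A <+>\<^bsub>M\<^esub> f ` B \<subseteq> carrier M" using d f by (meson subD(1) sub_image sub_plus)
    show "carrier M \<subseteq> f ` A <+>\<^bsub>M\<^esub> f ` B"
    proof
      fix x assume "x \<in> carrier M"
      then obtain y where y: "y \<in> carrier M" "x = f y" using img by auto
      then obtain a b where "a \<in> A" "b \<in> B" "y = a \<oplus>\<^bsub>M\<^esub> b" unfolding d(3)[symmetric] set_add_iff by blast
      then show "x \<in> f ` A <+>\<^bsub>M\<^esub> f ` B" using y f d subD(7) by (auto simp: set_add_iff endo_add)
    qed
  qed
  ultimately show ?thesis using d f by (auto simp: direct_sum_def)
qed

lemma summand_image:
  assumes "f \<in> endo" "bij_betw f (carrier M) (carrier M)" "summand A"
  shows "summand (f ` A)"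
  using assms dsum_image by (fastforce simp: direct_summand_def)

text \<open>The restriction of \<open>f\<close> to \<open>A\<close> is a split monomorphism, with a
  left inverse that is defined on the whole of \<open>M\<close>.\<close>

definition split_on where "split_on f A \<longleftrightarrow> (\<exists>g\<in>endo. \<forall>x\<in>A. g (f x) = x)"

lemma split_onI:
  assumes "g \<in> endo" "\<And>x. x \<in> A \<Longrightarrow> g (f x) = x" shows "split_on f A"
  using assms by (auto simp: split_on_def)

lemma split_on_inj: "split_on f A \<Longrightarrow> inj_on f A"
  unfolding split_on_def by (metis inj_onI)

lemma split_on_summand:
  assumes f: "f \<in> endo" and A: "summand A" and "split_on f A"
  shows "summand (f ` A)"
proof -
  obtain g where g: "g \<in> endo" "\<And>x. x \<in> A \<Longrightarrow> g (f x) = x" using assms(3) by (auto simp: split_on_def)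
  obtain e where e: "e \<in> endo" "\<And>x. x \<in> carrier M \<Longrightarrow> e x \<in> A" "\<And>x. x \<in> A \<Longrightarrow> e x = x"
    using summand_proj[OF A] by blast
  show ?thesis
    by (rule summandI[OF endo_comp[OF f endo_comp[OF e(1) g(1)]]])
      (use f g e subD[OF summand_sub[OF A]] in auto)
qed

text \<open>Left inverses on the members of a chain need not fit together, whereas injectivity
  passes to the union, and so does being a summand under the chain condition. This is the form of
  splitting to which Zorn's lemma applies.\<close>

lemma split_on_iff:
  assumes f: "f \<in> endo" and A: "summand A"
  shows "split_on f A \<longleftrightarrow> inj_on f A \<and> summand (f ` A)"
proof
  assume "split_on f A" then show "inj_on f A \<and> summand (f ` A)"
    using split_on_inj split_on_summand[OF f A] by auto
next
  assume "inj_on f A \<and> summand (f ` A)"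
  then have "bij_betw f A (f ` A)" "summand (f ` A)" by (auto simp: bij_betw_def)
  then show "split_on f A" using iso_inverse[OF f A] split_onI by metis
qed

section \<open>Finite internal direct sums\<close>

text \<open>An internal direct sum of finitely many submodules with total \<open>N\<close>, kept as
  a list so that exchanging, refining and grouping summands become rules on lists.\<close>

fun decomp where
  "decomp N [] \<longleftrightarrow> N = {\<zero>\<^bsub>M\<^esub>}"
| "decomp N (A # As) \<longleftrightarrow> sub A \<and> (\<exists>N'. decomp N' As \<and> N = A <+>\<^bsub>M\<^esub> N' \<and> A \<inter> N' = {\<zero>\<^bsub>M\<^esub>})"

lemma decomp_sub: "decomp N As \<Longrightarrow> sub N"
  by (induction As arbitrary: N) auto

text \<open>Modular argument: if \<open>b = a \<oplus> k\<close>, then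
  \<open>a = b \<ominus> k\<close> lies in \<open>A\<close> and in \<open>B + K\<close>, so
  \<open>a\<close> is zero and \<open>b\<close> lies in \<open>B \<inter> K\<close>.\<close>

lemma decomp_swap:
  assumes "decomp N (A # B # L)" shows "decomp N (B # A # L)"
proof -
  obtain K where K: "decomp K L" "sub A" "sub B" "N = A <+>\<^bsub>M\<^esub> (B <+>\<^bsub>M\<^esub> K)"
    "B \<inter> K = {\<zero>\<^bsub>M\<^esub>}" "A \<inter> (B <+>\<^bsub>M\<^esub> K) = {\<zero>\<^bsub>M\<^esub>}" using assms by auto
  note sK = decomp_sub[OF K(1)]
  have "A \<inter> K \<subseteq> {\<zero>\<^bsub>M\<^esub>}" using K plus_upper[OF K(3) sK] by auto
  then have "A \<inter> K = {\<zero>\<^bsub>M\<^esub>}" using subD(2)[OF K(2)] subD(2)[OF sK] by auto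
  moreover have "B \<inter> (A <+>\<^bsub>M\<^esub> K) \<subseteq> {\<zero>\<^bsub>M\<^esub>}"
  proof
    fix b assume "b \<in> B \<inter> (A <+>\<^bsub>M\<^esub> K)"
    then obtain a k where *: "b \<in> B" "a \<in> A" "k \<in> K" "b = a \<oplus>\<^bsub>M\<^esub> k" by (auto simp: set_add_iff)
    have c: "a \<in> carrier M" "k \<in> carrier M" using * K(2) sK subD(7) by auto
    have "a = b \<ominus>\<^bsub>M\<^esub> k" using c *(4) by (simp add: diff_simps)
    moreover have "b \<ominus>\<^bsub>M\<^esub> k \<in> B <+>\<^bsub>M\<^esub> K"
      using * plus_upper[OF K(3) sK] subD(6)[OF sub_plus[OF K(3) sK]] by blast
    ultimately have "a \<in> B <+>\<^bsub>M\<^esub> K" by simp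
    then have "a = \<zero>\<^bsub>M\<^esub>" using * K(6) by auto
    then have "b = k" using * c by simp
    then show "b \<in> {\<zero>\<^bsub>M\<^esub>}" using * K(5) by auto
  qed
  then have "B \<inter> (A <+>\<^bsub>M\<^esub> K) = {\<zero>\<^bsub>M\<^esub>}"
    using subD(2)[OF K(3)] subD(2)[OF sub_plus[OF K(2) sK]] by auto
  moreover have "N = B <+>\<^bsub>M\<^esub> (A <+>\<^bsub>M\<^esub> K)" using K sK by (metis plus_assoc plus_comm)
  ultimately show ?thesis using K by auto
qed

lemma decomp_move: "decomp N (xs @ a # ys) \<longleftrightarrow> decomp N (a # xs @ ys)"
proof (induction xs arbitrary: N)
  case (Cons b xs)
  have "decomp N ((b # xs) @ a # ys) \<longleftrightarrow> decomp N (b # a # xs @ ys)"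
    using Cons.IH by auto
  also have "\<dots> \<longleftrightarrow> decomp N (a # b # xs @ ys)" using decomp_swap by blast
  finally show ?case by simp
qed simp

lemma decomp_mset: "mset xs = mset ys \<Longrightarrow> decomp N xs \<longleftrightarrow> decomp N ys"
proof (induction xs arbitrary: ys N)
  case (Cons a xs)
  then have "a \<in> set ys" by (metis list.set_intros(1) set_mset_mset)
  then obtain y1 y2 where ys: "ys = y1 @ a # y2" by (meson split_list)
  then have "mset xs = mset (y1 @ y2)" using Cons.prems by simp
  then have "decomp N' xs \<longleftrightarrow> decomp N' (y1 @ y2)" for N' by (rule Cons.IH)
  then show ?case unfolding ys decomp_move by auto
qed simp

lemma decomp_perm: "\<lbrakk>decomp N xs; mset xs = mset ys\<rbrakk> \<Longrightarrow> decomp N ys"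
  using decomp_mset by blast

lemma decomp_pair: "decomp N [A, B] \<longleftrightarrow> sub A \<and> sub B \<and> N = A <+>\<^bsub>M\<^esub> B \<and> A \<inter> B = {\<zero>\<^bsub>M\<^esub>}"
  using subD(2) by auto

lemma dsum_decomp: "dsum A B \<longleftrightarrow> decomp (carrier M) [A, B]"
  unfolding decomp_pair by (auto simp: direct_sum_def)

text \<open>Serves in both directions: a summand is replaced by its parts, or parts are collected
  into a sum that is already known.\<close>

lemma decomp_refine:
  "decomp S Ls \<Longrightarrow> decomp N (S # L) \<longleftrightarrow> decomp N (Ls @ L)"
proof (induction Ls arbitrary: S N L)
  case Nil
  have "{\<zero>\<^bsub>M\<^esub>} <+>\<^bsub>M\<^esub> N' = N'" "{\<zero>\<^bsub>M\<^esub>} \<inter> N' = {\<zero>\<^bsub>M\<^esub>}" if "decomp N' L" for N'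
    using subD(2)[OF decomp_sub[OF that]] decomp_sub[OF that] by auto
  then show ?case using Nil by (metis append_Nil decomp.simps sub_zero)
next
  case (Cons A Ls)
  then obtain S' where S': "sub A" "decomp S' Ls" "S = A <+>\<^bsub>M\<^esub> S'" "A \<inter> S' = {\<zero>\<^bsub>M\<^esub>}" by auto
  note sS = decomp_sub[OF S'(2)]
  have "decomp N (S # L) \<longleftrightarrow> decomp N (A # S' # L)"
  proof
    assume "decomp N (S # L)"
    then obtain K where K: "decomp K L" "N = S <+>\<^bsub>M\<^esub> K" "S \<inter> K = {\<zero>\<^bsub>M\<^esub>}" by auto
    note sK = decomp_sub[OF K(1)]
    have "S' \<inter> K = {\<zero>\<^bsub>M\<^esub>}" using K S' plus_upper[OF S'(1) sS] subD(2)[OF sS] subD(2)[OF sK] by auto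
    moreover have "A \<inter> (S' <+>\<^bsub>M\<^esub> K) \<subseteq> {\<zero>\<^bsub>M\<^esub>}"
    proof
      fix a assume "a \<in> A \<inter> (S' <+>\<^bsub>M\<^esub> K)"
      then obtain s k where *: "a \<in> A" "s \<in> S'" "k \<in> K" "a = s \<oplus>\<^bsub>M\<^esub> k" by (auto simp: set_add_iff)
      have c: "s \<in> carrier M" "k \<in> carrier M" using * sS sK subD(7) by auto
      have "k = a \<ominus>\<^bsub>M\<^esub> s" using c *(4) by (simp add: diff_simps)
      moreover have "a \<ominus>\<^bsub>M\<^esub> s \<in> S" unfolding S'(3)
        using * plus_upper[OF S'(1) sS] subD(6)[OF sub_plus[OF S'(1) sS]] by blast
      ultimately have "k \<in> S" by simp
      then have "k = \<zero>\<^bsub>M\<^esub>" using * K(3) by auto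
      then have "a = s" using * c by simp
      then show "a \<in> {\<zero>\<^bsub>M\<^esub>}" using * S'(4) by auto
    qed
    then have "A \<inter> (S' <+>\<^bsub>M\<^esub> K) = {\<zero>\<^bsub>M\<^esub>}"
      using subD(2)[OF S'(1)] subD(2)[OF sub_plus[OF sS sK]] by auto
    ultimately show "decomp N (A # S' # L)"
      using K S' sS sK plus_assoc by auto
  next
    assume "decomp N (A # S' # L)"
    then obtain K where K: "decomp K L" "N = A <+>\<^bsub>M\<^esub> (S' <+>\<^bsub>M\<^esub> K)" "S' \<inter> K = {\<zero>\<^bsub>M\<^esub>}" "A \<inter> (S' <+>\<^bsub>M\<^esub> K) = {\<zero>\<^bsub>M\<^esub>}"
      by auto
    note sK = decomp_sub[OF K(1)]
    have "S \<inter> K \<subseteq> {\<zero>\<^bsub>M\<^esub>}"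
    proof
      fix k assume "k \<in> S \<inter> K"
      then obtain a s where *: "k \<in> K" "a \<in> A" "s \<in> S'" "k = a \<oplus>\<^bsub>M\<^esub> s" using S' by (auto simp: set_add_iff)
      have c: "s \<in> carrier M" "a \<in> carrier M" using * sS S'(1) subD(7) by auto
      have "a = k \<ominus>\<^bsub>M\<^esub> s" using c *(4) by (simp add: diff_simps)
      moreover have "k \<ominus>\<^bsub>M\<^esub> s \<in> S' <+>\<^bsub>M\<^esub> K"
        using * plus_upper[OF sS sK] subD(6)[OF sub_plus[OF sS sK]] by blast
      ultimately have "a \<in> S' <+>\<^bsub>M\<^esub> K" by simp
      then have "a = \<zero>\<^bsub>M\<^esub>" using * K(4) by auto
      then have "k = s" using * c by simp
      then show "k \<in> {\<zero>\<^bsub>M\<^esub>}" using * K(3) by auto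
    qed
    then have "S \<inter> K = {\<zero>\<^bsub>M\<^esub>}" using subD(2)[OF sK] decomp_sub[OF Cons.prems] subD(2) by auto
    then show "decomp N (S # L)" using K S' sS sK plus_assoc by auto
  qed
  also have "\<dots> \<longleftrightarrow> decomp N (S' # A # L)" using decomp_swap by blast
  also have "\<dots> \<longleftrightarrow> decomp N (Ls @ A # L)" by (rule Cons.IH[OF S'(2)])
  finally show ?case by (simp add: decomp_move)
qed

text \<open>Modular law: with \<open>K\<close> the sum of the remaining list, \<open>B\<close> is
  the direct sum of \<open>A\<close> and \<open>K \<inter> B\<close>, since
  \<open>k = b \<ominus> a\<close> stays in \<open>B\<close>.\<close>

lemma decomp_restrict:
  assumes d: "decomp N (A # L)" and AB: "A \<subseteq> B" and B: "sub B" "B \<subseteq> N"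
  obtains W where "decomp B [A, W]"
proof -
  obtain K where K: "decomp K L" "sub A" "N = A <+>\<^bsub>M\<^esub> K" "A \<inter> K = {\<zero>\<^bsub>M\<^esub>}" using d by auto
  note sK = decomp_sub[OF K(1)]
  have "B \<subseteq> A <+>\<^bsub>M\<^esub> (K \<inter> B)"
  proof
    fix b assume b: "b \<in> B"
    then obtain a k where *: "a \<in> A" "k \<in> K" "b = a \<oplus>\<^bsub>M\<^esub> k"
      using B(2) unfolding K(3) set_add_iff subset_iff by blast
    have "k = b \<ominus>\<^bsub>M\<^esub> a" using * K(2) sK subD(7) by (simp add: diff_simps)
    moreover have "b \<ominus>\<^bsub>M\<^esub> a \<in> B" using * b AB subD(6)[OF B(1)] by blast
    ultimately have "k \<in> B" by simp
    then show "b \<in> A <+>\<^bsub>M\<^esub> (K \<inter> B)" unfolding set_add_iff using * by blast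
  qed
  then have "decomp B [A, K \<inter> B]" unfolding decomp_pair
    using K(2,4) B sK AB subD(2)[OF B(1)] plus_least[OF B(1) AB, of "K \<inter> B"] by auto
  then show thesis by (rule that)
qed

lemma decomp_summand:
  assumes "summand B" "decomp B L"
  shows "\<exists>Y. decomp (carrier M) (Y # L)"
proof -
  obtain Y where "dsum B Y" using assms by (auto simp: direct_summand_def)
  then have "decomp (carrier M) (L @ [Y])" using decomp_refine[OF assms(2)] dsum_decomp by blast
  then show ?thesis by (auto simp: decomp_move)
qed

lemma summand_decomp_mem:
  assumes "decomp (carrier M) L" "A \<in> set L"
  shows "summand A"
proof -
  obtain L' where "decomp (carrier M) (A # L')" using assms split_list decomp_move by metis
  then obtain K where "decomp K L'" "sub A" "carrier M = A <+>\<^bsub>M\<^esub> K" "A \<inter> K = {\<zero>\<^bsub>M\<^esub>}" by auto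
  then show ?thesis by (auto simp: direct_summand_def direct_sum_def dest: decomp_sub)
qed

text \<open>The sum of an initial segment is again direct, so it can stand as a single summand.
  Together with permutations this groups arbitrary members of a list.\<close>

lemma decomp_merge:
  assumes "decomp N (L1 @ L2)"
  obtains S where "decomp S L1" "decomp N (S # L2)"
proof -
  have "\<exists>S. decomp S L1"
    using assms
  proof (induction L1 arbitrary: N)
    case (Cons A L1)
    then obtain K where K: "sub A" "decomp K (L1 @ L2)" "A \<inter> K = {\<zero>\<^bsub>M\<^esub>}" by auto
    then obtain S where S: "decomp S L1" using Cons.IH by blast
    then have "decomp K (S # L2)" using K(2) decomp_refine by blast
    then have "S \<subseteq> K" using plus_upper(1) decomp_sub by auto
    then have "A \<inter> S = {\<zero>\<^bsub>M\<^esub>}" using K(1,3) subD(2)[OF K(1)] subD(2)[OF decomp_sub[OF S]] by auto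
    then show ?case using K(1) S by auto
  qed auto
  then show thesis using that assms decomp_refine by blast
qed

lemma summand_within:
  assumes "summand A" "A \<subseteq> B" "sub B"
  obtains W where "decomp B [A, W]"
proof -
  obtain Y where "dsum A Y" using assms by (auto simp: direct_summand_def)
  then show thesis using decomp_restrict[of "carrier M" A "[Y]" B] assms dsum_decomp subD(1) that by blast
qed

lemma direct_summand_within:
  assumes B: "sub B" and "direct_summand R (M\<lparr>carrier := B\<rparr>) A"
  obtains W where "decomp B [A, W]"
proof -
  obtain W where W: "direct_sum R (M\<lparr>carrier := B\<rparr>) A W" using assms by (auto simp: direct_summand_def)
  have s: "sub N" if "submodule N R (M\<lparr>carrier := B\<rparr>)" for N
  proof -
    interpret MB: left_module R "M\<lparr>carrier := B\<rparr>" by (rule submodule_is_left_module[OF B])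
    show ?thesis using MB.subD[OF that] subD(1)[OF B] by (intro subI) auto
  qed
  show thesis
    using W s by (intro that[of W] decomp_pair[THEN iffD2]) (auto simp: direct_sum_def set_add_defs)
qed

section \<open>Embeddings and local summands\<close>

text \<open>Endomorphisms of a summand \<^verbatim>\<open>Z\<close> are the restrictions of those of \<^verbatim>\<open>M\<close> that preserve \<^verbatim>\<open>Z\<close>. Hence,
  for a non-zero summand, \<^verbatim>\<open>local_on\<close> says that its endomorphism ring is local.\<close>

definition local_on where "local_on Z \<longleftrightarrow>
  (\<forall>f\<in>endo. f ` Z \<subseteq> Z \<longrightarrow> bij_betw f Z Z \<or> bij_betw (\<lambda>x. x \<ominus>\<^bsub>M\<^esub> f x) Z Z)"

text \<open>With \<open>f\<close> a projection onto \<open>B\<close>, the map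
  \<open>r + f (1 - r)\<close> is a projection onto \<open>A + B\<close>: from
  \<open>a \<oplus> b\<close> the map \<open>r\<close> reads off \<open>a\<close>, because it kills
  \<open>B\<close>, and \<open>f\<close> is applied to the remaining \<open>b\<close>.\<close>

lemma summand_extend:
  assumes B: "summand B" and r: "r \<in> endo" "\<And>x. x \<in> carrier M \<Longrightarrow> r x \<in> A" "\<And>x. x \<in> A \<Longrightarrow> r x = x"
    and A: "sub A" and rB: "\<And>x. x \<in> B \<Longrightarrow> r x = \<zero>\<^bsub>M\<^esub>"
  shows "A \<inter> B = {\<zero>\<^bsub>M\<^esub>}" "summand (A <+>\<^bsub>M\<^esub> B)"
proof -
  note sB = summand_sub[OF B]
  obtain f where f: "f \<in> endo" "\<And>x. x \<in> carrier M \<Longrightarrow> f x \<in> B" "\<And>x. x \<in> B \<Longrightarrow> f x = x"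
    using summand_proj[OF B] by blast
  have "x = \<zero>\<^bsub>M\<^esub>" if "x \<in> A" "x \<in> B" for x using rB[OF that(2)] r(3)[OF that(1)] by simp
  then show "A \<inter> B = {\<zero>\<^bsub>M\<^esub>}" using subD(2)[OF A] subD(2)[OF sB] by blast
  show "summand (A <+>\<^bsub>M\<^esub> B)"
  proof (rule summandI)
    show "(\<lambda>x. r x \<oplus>\<^bsub>M\<^esub> f (x \<ominus>\<^bsub>M\<^esub> r x)) \<in> endo" by (intro endo_plus endo_comp[OF f(1)] endo_diff endo_id r(1))
    show "r x \<oplus>\<^bsub>M\<^esub> f (x \<ominus>\<^bsub>M\<^esub> r x) \<in> A <+>\<^bsub>M\<^esub> B" if "x \<in> carrier M" for x
      using r(1,2) f(2) that by (intro set_addI) auto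
    show "A <+>\<^bsub>M\<^esub> B \<subseteq> carrier M" using A sB subD(1) by blast
    fix x assume "x \<in> A <+>\<^bsub>M\<^esub> B"
    then obtain a b where *: "a \<in> A" "b \<in> B" "x = a \<oplus>\<^bsub>M\<^esub> b" by (auto simp: set_add_iff)
    have c: "a \<in> carrier M" "b \<in> carrier M" using * A sB subD(7) by auto
    have "r x = a" using * c r rB by (simp add: endo_add)
    moreover have "x \<ominus>\<^bsub>M\<^esub> a = b" using * c by (simp add: diff_simps)
    ultimately show "r x \<oplus>\<^bsub>M\<^esub> f (x \<ominus>\<^bsub>M\<^esub> r x) = x" using * f by simp
  qed
qed

lemma split_on_mono: "\<lbrakk>split_on f A; B \<subseteq> A\<rbrakk> \<Longrightarrow> split_on f B"
  unfolding split_on_def by blast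

text \<open>For summands \<open>P\<close> and \<open>Q\<close>, this says that \<open>P\<close> is
  isomorphic to a summand of \<open>Q\<close>.\<close>

definition embeds where "embeds P Q \<longleftrightarrow> (\<exists>f\<in>endo. f ` P \<subseteq> Q \<and> split_on f P)"

lemma embeds_trans:
  assumes "embeds P Q" "embeds Q T" shows "embeds P T"
proof -
  obtain f f' where f: "f \<in> endo" "f ` P \<subseteq> Q" "f' \<in> endo" "\<And>x. x \<in> P \<Longrightarrow> f' (f x) = x"
    using assms(1) by (auto simp: embeds_def split_on_def)
  obtain g g' where g: "g \<in> endo" "g ` Q \<subseteq> T" "g' \<in> endo" "\<And>x. x \<in> Q \<Longrightarrow> g' (g x) = x"
    using assms(2) by (auto simp: embeds_def split_on_def)
  have "f' (g' (g (f x))) = x" if "x \<in> P" for x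
    using that f(2) g(4)[of "f x"] f(4) by auto
  then have "split_on (\<lambda>x. g (f x)) P" by (rule split_onI[OF endo_comp[OF f(3) g(3)]])
  moreover have "(\<lambda>x. g (f x)) ` P \<subseteq> T" using f(2) g(2) by auto
  ultimately show ?thesis unfolding embeds_def using endo_comp[OF g(1) f(1)] by blast
qed

lemma embeds_subset: "P \<subseteq> Q \<Longrightarrow> embeds P Q"
  unfolding embeds_def by (intro bexI[of _ "\<lambda>x. x"]) (auto intro: split_onI[OF endo_id])

lemma decomp_unique: "decomp N L \<Longrightarrow> decomp N' L \<Longrightarrow> N = N'"
  by (induction L arbitrary: N N') auto

text \<open>Complements of the same submodule \<open>K\<close> are isomorphic: the projection onto
  \<open>Q\<close> along \<open>K\<close>, restricted to \<open>P\<close>, is inverted by the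
  projection onto \<open>P\<close> along \<open>K\<close>, since \<open>x\<close> and
  \<open>f x\<close> differ by an element of \<open>K\<close>.\<close>

lemma common_complement_embeds:
  assumes P: "decomp (carrier M) (P # L)" and Q: "decomp (carrier M) (Q # L)"
  shows "embeds P Q"
proof -
  obtain K where K: "decomp K L" "dsum P K"
    using P decomp_sub by (auto simp: direct_sum_def)
  obtain K' where "decomp K' L" "dsum Q K'"
    using Q decomp_sub by (auto simp: direct_sum_def)
  then have "dsum Q K" using decomp_unique[OF K(1)] by simp
  then obtain f where f: "f \<in> endo" "\<And>x. x \<in> carrier M \<Longrightarrow> f x \<in> Q"
    "\<And>x. x \<in> carrier M \<Longrightarrow> x \<ominus>\<^bsub>M\<^esub> f x \<in> K" using dsum_proj by metis
  obtain g where g: "g \<in> endo" "\<And>x. x \<in> P \<Longrightarrow> g x = x"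
    "\<And>x. x \<in> carrier M \<Longrightarrow> g x = \<zero>\<^bsub>M\<^esub> \<longleftrightarrow> x \<in> K" using dsum_proj[OF K(2)] by metis
  have PM: "x \<in> carrier M" if "x \<in> P" for x using subD(7)[OF dsumD(1)[OF K(2)] that] .
  have "g (f x) = x" if "x \<in> P" for x
  proof -
    note x = PM[OF that]
    have "g (x \<ominus>\<^bsub>M\<^esub> f x) = \<zero>\<^bsub>M\<^esub>" using g(3)[of "x \<ominus>\<^bsub>M\<^esub> f x"] f x by auto
    then have "x \<ominus>\<^bsub>M\<^esub> g (f x) = \<zero>\<^bsub>M\<^esub>" using g(1) g(2)[OF that] x f(1) by (simp add: endo_minus)
    then show ?thesis using x f(1) g(1) by (simp add: diff_solve(1))
  qed
  then have "split_on f P" by (rule split_onI[OF g(1)])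
  moreover have "f ` P \<subseteq> Q" using f(2) PM by auto
  ultimately show ?thesis unfolding embeds_def using f(1) by blast
qed

declare decomp.simps(2) [simp del]

lemma decomp_pair_eq:
  assumes d: "decomp N [A, B]" and "a \<in> A" "b \<in> B" "a' \<in> A" "b' \<in> B" and e: "a \<oplus>\<^bsub>M\<^esub> b = a' \<oplus>\<^bsub>M\<^esub> b'"
  shows "a = a'" "b = b'"
proof -
  have AB: "sub A" "sub B" "A \<inter> B = {\<zero>\<^bsub>M\<^esub>}" using d decomp_pair by simp_all
  have c: "a \<in> carrier M" "a' \<in> carrier M" "b \<in> carrier M" "b' \<in> carrier M"
    using assms AB subD(7) by auto
  have "a \<ominus>\<^bsub>M\<^esub> a' = b' \<ominus>\<^bsub>M\<^esub> b" using c e by (simp add: diff_simps)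
  moreover have "a \<ominus>\<^bsub>M\<^esub> a' \<in> A" "b' \<ominus>\<^bsub>M\<^esub> b \<in> B" using assms AB subD(6) by auto
  ultimately have "a \<ominus>\<^bsub>M\<^esub> a' \<in> A \<inter> B" by simp
  then have "a \<ominus>\<^bsub>M\<^esub> a' = \<zero>\<^bsub>M\<^esub>" using AB(3) by simp
  then show "a = a'" using c by (simp add: diff_solve(1))
  then show "b = b'" using c e by simp
qed

text \<open>The graph \<open>G\<close> of a map from \<open>A\<close> to \<open>B\<close> always
  complements \<open>B\<close>. Injectivity makes it meet \<open>A\<close> in zero, and surjectivity
  makes \<open>A\<close> and \<open>G\<close> span \<open>S\<close>.\<close>

lemma graph_complement:
  assumes S: "decomp S [A, B]" and f: "f \<in> endo" and bij: "bij_betw f A B"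
  obtains G where "decomp S [A, G]" "decomp S [B, G]"
proof -
  have AB: "sub A" "sub B" "S = A <+>\<^bsub>M\<^esub> B" "A \<inter> B = {\<zero>\<^bsub>M\<^esub>}" using S decomp_pair by simp_all
  have sS: "sub S" using decomp_sub[OF S] .
  have fB: "f a \<in> B" if "a \<in> A" for a using bij that by (auto simp: bij_betw_def)
  define G where "G = (\<lambda>x. x \<oplus>\<^bsub>M\<^esub> f x) ` A"
  have sG: "sub G" unfolding G_def by (rule sub_image[OF endo_plus[OF endo_id f] AB(1)])
  have GE: "\<exists>a\<in>A. x = a \<oplus>\<^bsub>M\<^esub> f a" if "x \<in> G" for x using that by (auto simp: G_def)
  have GS: "G \<subseteq> S" using fB by (auto simp: G_def AB(3) intro: set_addI)
  have SE: "\<exists>a\<in>A. \<exists>b\<in>A. x = a \<oplus>\<^bsub>M\<^esub> f b" if x: "x \<in> S" for x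
  proof -
    obtain a c where "a \<in> A" "c \<in> B" "x = a \<oplus>\<^bsub>M\<^esub> c" using x unfolding AB(3) set_add_iff by blast
    then show ?thesis using bij by (auto simp: bij_betw_def)
  qed
  have z: "\<zero>\<^bsub>M\<^esub> \<in> A" "\<zero>\<^bsub>M\<^esub> \<in> B" "\<zero>\<^bsub>M\<^esub> \<in> G" using AB sG subD(2) by auto
  have 1: "x = \<zero>\<^bsub>M\<^esub>" if "x \<in> A" "x \<in> G" for x
  proof -
    obtain a where a: "a \<in> A" "x = a \<oplus>\<^bsub>M\<^esub> f a" using GE[OF \<open>x \<in> G\<close>] by blast
    have c: "x \<in> carrier M" "a \<in> carrier M" using a that AB(1) subD(7) by auto
    have "x \<oplus>\<^bsub>M\<^esub> \<zero>\<^bsub>M\<^esub> = a \<oplus>\<^bsub>M\<^esub> f a" using a c by simp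
    then have "x = a" "f a = \<zero>\<^bsub>M\<^esub>" using decomp_pair_eq[OF S that(1) z(2) a(1) fB[OF a(1)]] by auto
    then show ?thesis using bij a(1) z(1) endo_zero[OF f] by (metis bij_betw_inv_into_left)
  qed
  have 2: "x = \<zero>\<^bsub>M\<^esub>" if "x \<in> B" "x \<in> G" for x
  proof -
    obtain a where a: "a \<in> A" "x = a \<oplus>\<^bsub>M\<^esub> f a" using GE[OF \<open>x \<in> G\<close>] by blast
    have c: "x \<in> carrier M" using that AB(2) subD(7) by auto
    have "\<zero>\<^bsub>M\<^esub> \<oplus>\<^bsub>M\<^esub> x = a \<oplus>\<^bsub>M\<^esub> f a" using a c by simp
    then have "a = \<zero>\<^bsub>M\<^esub>" using decomp_pair_eq(1)[OF S z(1) that(1) a(1) fB[OF a(1)]] by simp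
    then show ?thesis using a f by simp
  qed
  have "x \<in> A <+>\<^bsub>M\<^esub> G" "x \<in> B <+>\<^bsub>M\<^esub> G" if x: "x \<in> S" for x
  proof -
    obtain a b where ab: "a \<in> A" "b \<in> A" "x = a \<oplus>\<^bsub>M\<^esub> f b" using SE[OF x] by blast
    have c: "a \<in> carrier M" "b \<in> carrier M" using ab AB(1) subD(7) by auto
    have "x = (a \<ominus>\<^bsub>M\<^esub> b) \<oplus>\<^bsub>M\<^esub> (b \<oplus>\<^bsub>M\<^esub> f b)" using ab c f by (simp add: diff_simps)
    then show "x \<in> A <+>\<^bsub>M\<^esub> G" using set_addI[OF subD(6)[OF AB(1) ab(1,2)], of "b \<oplus>\<^bsub>M\<^esub> f b" G M] ab by (simp add: G_def)
    have "x = (f b \<ominus>\<^bsub>M\<^esub> f a) \<oplus>\<^bsub>M\<^esub> (a \<oplus>\<^bsub>M\<^esub> f a)" using ab c f by (simp add: diff_simps)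
    then show "x \<in> B <+>\<^bsub>M\<^esub> G"
      using set_addI[OF subD(6)[OF AB(2) fB[OF ab(2)] fB[OF ab(1)]], of "a \<oplus>\<^bsub>M\<^esub> f a" G M] ab by (simp add: G_def)
  qed
  moreover have "A <+>\<^bsub>M\<^esub> G \<subseteq> S" "B <+>\<^bsub>M\<^esub> G \<subseteq> S"
    using plus_least[OF sS] plus_upper[OF AB(1,2)] GS AB(3) by simp_all
  ultimately have "S = A <+>\<^bsub>M\<^esub> G" "S = B <+>\<^bsub>M\<^esub> G" by blast+
  moreover have "A \<inter> G = {\<zero>\<^bsub>M\<^esub>}" "B \<inter> G = {\<zero>\<^bsub>M\<^esub>}" using 1 2 z by blast+
  ultimately show thesis
    using AB(1,2) sG by (intro that[of G] decomp_pair[THEN iffD2] conjI)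
qed

end

section \<open>The PSB-property from chains of summands\<close>

locale chain_local_module = left_module +
  assumes chain_summand: "\<lbrakk>C \<noteq> {}; subset.chain {A. direct_summand R M A} C\<rbrakk> \<Longrightarrow> direct_summand R M (\<Union>C)"
    and local_summand: "\<lbrakk>direct_summand R M K; K \<noteq> {\<zero>\<^bsub>M\<^esub>}\<rbrakk> \<Longrightarrow>
      \<exists>Z \<subseteq> K. direct_summand R M Z \<and> Z \<noteq> {\<zero>\<^bsub>M\<^esub>} \<and> local_on Z"
begin

text \<open>For \<open>A = carrier M\<close>, this says that \<open>h\<close> induces no isomorphism
  between non-zero summands, that is, \<open>h\<close> lies in the total of the endomorphism ring in
  the sense of Kasch. Under the axioms of the locale, such maps behave like elements of the Jacobson
  radical.\<close>

definition radical where "radical h A \<longleftrightarrow> (\<forall>Z \<subseteq> A. summand Z \<longrightarrow> split_on h Z \<longrightarrow> Z = {\<zero>\<^bsub>M\<^esub>})"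

section \<open>Splitting off a maximal summand\<close>

lemma maximal_split:
  assumes h: "h \<in> endo" and A: "summand A"
  obtains X A0 where "decomp A [X, A0]" "split_on h A0" "radical h X"
proof -
  let ?P = "{W. W \<subseteq> A \<and> summand W \<and> split_on h W}"
  note sA = summand_sub[OF A]
  have "\<exists>W\<in>?P. \<forall>V\<in>?P. W \<subseteq> V \<longrightarrow> V = W"
  proof (rule subset_Zorn_nonempty)
    have "split_on h {\<zero>\<^bsub>M\<^esub>}" using h by (intro split_onI[of "\<lambda>x. x"]) auto
    then have "{\<zero>\<^bsub>M\<^esub>} \<in> ?P" using subD(2)[OF sA] by simp
    then show "?P \<noteq> {}" by blast
    fix C assume C: "C \<noteq> {}" "subset.chain ?P C"
    have "subset.chain {A. summand A} C" using C(2) by (auto simp: subset_chain_def)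
    then have s: "summand (\<Union>C)" by (rule chain_summand[OF C(1)])
    \<comment> \<open>The images under \<open>h\<close> form a chain of summands as well, so the
      image of the union is a summand; this avoids any choice of compatible left inverses.\<close>
    have "subset.chain {A. summand A} ((`) h ` C)"
      unfolding subset_chain_def
    proof (intro conjI ballI subsetI)
      fix V W assume "V \<in> (`) h ` C" "W \<in> (`) h ` C"
      then obtain V' W' where "V' \<in> C" "W' \<in> C" "V = h ` V'" "W = h ` W'" by blast
      moreover then have "V' \<subseteq> W' \<or> W' \<subseteq> V'" using C(2) unfolding subset_chain_def by blast
      ultimately show "V \<subseteq> W \<or> W \<subseteq> V" by blast
    qed (use C(2) split_on_summand[OF h] in \<open>auto simp: subset_chain_def\<close>)
    then have "summand (\<Union>((`) h ` C))" using C(1) by (intro chain_summand) auto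
    moreover have "\<Union>((`) h ` C) = h ` \<Union>C" by auto
    moreover have "inj_on h (\<Union>C)"
    proof (rule inj_onI)
      fix x y assume xy: "x \<in> \<Union>C" "y \<in> \<Union>C" "h x = h y"
      then obtain W where "W \<in> C" "x \<in> W" "y \<in> W" using C(2) unfolding subset_chain_def by blast
      moreover then have "inj_on h W" using C(2) split_on_inj by (auto simp: subset_chain_def)
      ultimately show "x = y" using xy by (auto dest: inj_onD)
    qed
    ultimately have "split_on h (\<Union>C)" using split_on_iff[OF h s] by simp
    then show "\<Union>C \<in> ?P" using s C(2) by (auto simp: subset_chain_def)
  qed
  then obtain A0 where "A0 \<in> ?P" and "\<forall>V\<in>?P. A0 \<subseteq> V \<longrightarrow> V = A0" ..
  then have A0: "A0 \<subseteq> A" "summand A0" "split_on h A0"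
    and max: "\<And>V. \<lbrakk>V \<subseteq> A; summand V; split_on h V; A0 \<subseteq> V\<rbrakk> \<Longrightarrow> V = A0" by simp_all
  note sA0 = summand_sub[OF A0(2)]
  obtain a where a: "a \<in> endo" "\<And>x. x \<in> A0 \<Longrightarrow> a (h x) = x" using A0(3) by (auto simp: split_on_def)
  obtain p where p: "p \<in> endo" "\<And>x. x \<in> carrier M \<Longrightarrow> p x \<in> A0" "\<And>x. x \<in> A0 \<Longrightarrow> p x = x"
    using summand_proj[OF A0(2)] by blast
  define k where "k x = p (a x)" for x
  have k: "k \<in> endo" unfolding k_def by (rule endo_comp[OF p(1) a(1)])
  have kA: "x \<in> carrier M \<Longrightarrow> k x \<in> A0" "x \<in> A0 \<Longrightarrow> k (h x) = x" for x
    unfolding k_def using p a by auto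
  have r: "(\<lambda>x. k (h x)) \<in> endo" by (rule endo_comp[OF k h])
  \<comment> \<open>\<open>k h\<close> is idempotent with image \<open>A0\<close>. Its kernel is
    taken as the complement, and not an arbitrary one, because the maximality argument below depends
    on \<open>k h\<close> vanishing on \<open>X\<close>.\<close>
  define Y where "Y = {x \<in> carrier M. k (h x) = \<zero>\<^bsub>M\<^esub>}"
  have "dsum A0 Y" unfolding Y_def using kA h subD(1)[OF sA0] by (intro dsum_ker[OF r]) auto
  define X where "X = Y \<inter> A"
  have "decomp A [X, A0]"
  proof -
    have sY: "sub Y" unfolding Y_def by (rule sub_ker[OF r])
    have sX: "sub X" unfolding X_def using sA sY by auto
    have "A \<subseteq> X <+>\<^bsub>M\<^esub> A0"
    proof
      fix x assume x: "x \<in> A"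
      have xM: "x \<in> carrier M" using x subD(7)[OF sA] by auto
      have "k (h x) \<in> A0" using kA h xM by auto
      moreover have "x \<ominus>\<^bsub>M\<^esub> k (h x) \<in> X" unfolding X_def Y_def
        using xM kA h k subD(6)[OF sA x, of "k (h x)"] subsetD[OF A0(1) \<open>k (h x) \<in> A0\<close>] by (auto simp: endo_simps)
      moreover have "x = (x \<ominus>\<^bsub>M\<^esub> k (h x)) \<oplus>\<^bsub>M\<^esub> k (h x)" using xM k h by simp
      ultimately show "x \<in> X <+>\<^bsub>M\<^esub> A0" unfolding set_add_iff by blast
    qed
    then have "A = X <+>\<^bsub>M\<^esub> A0" using plus_least[OF sA, of X A0] A0(1) by (auto simp: X_def)
    moreover have "X \<inter> A0 = {\<zero>\<^bsub>M\<^esub>}"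
      using subD(2)[OF sX] subD(2)[OF sA0] kA by (auto simp: X_def Y_def)
    ultimately show ?thesis using sX sA0 by (intro decomp_pair[THEN iffD2]) auto
  qed
  moreover have "radical h X"
    unfolding radical_def
  proof (intro allI impI)
    fix Z assume Z: "Z \<subseteq> X" "summand Z" "split_on h Z"
    note sZ = summand_sub[OF Z(2)]
    obtain b where b: "b \<in> endo" "\<And>x. x \<in> Z \<Longrightarrow> b (h x) = x" using Z(3) by (auto simp: split_on_def)
    obtain q where q: "q \<in> endo" "\<And>x. x \<in> carrier M \<Longrightarrow> q x \<in> Z" "\<And>x. x \<in> Z \<Longrightarrow> q x = x"
      using summand_proj[OF Z(2)] by blast
    \<comment> \<open>A left inverse of \<open>h\<close> on \<open>A0 + Z\<close>: from
      \<open>h (y \<oplus> z)\<close> the map \<open>k\<close> recovers \<open>y\<close>, since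
      \<open>k h\<close> kills \<open>z\<close>; what remains is \<open>h z\<close>, from which
      \<open>q b\<close> recovers \<open>z\<close>.\<close>
    define c where "c x = k x \<oplus>\<^bsub>M\<^esub> q (b (x \<ominus>\<^bsub>M\<^esub> h (k x)))" for x
    have c: "c \<in> endo" unfolding c_def
      by (intro endo_plus k endo_comp[OF q(1)] endo_comp[OF b(1)] endo_diff endo_id endo_comp[OF h])
    have cS: "c x \<in> A0 <+>\<^bsub>M\<^esub> Z" if "x \<in> carrier M" for x
      unfolding c_def using that kA(1) q b(1) k h by (intro set_addI) auto
    have ch: "c (h x) = x" if x: "x \<in> A0 <+>\<^bsub>M\<^esub> Z" for x
    proof -
      obtain y z where *: "y \<in> A0" "z \<in> Z" "x = y \<oplus>\<^bsub>M\<^esub> z" using x by (auto simp: set_add_iff)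
      have m: "y \<in> carrier M" "z \<in> carrier M" using * sA0 sZ subD(7) by auto
      have "k (h z) = \<zero>\<^bsub>M\<^esub>" using * Z(1) by (auto simp: X_def Y_def)
      then have 1: "k (h x) = y" using * m k h kA by (simp add: endo_add)
      have "h x \<ominus>\<^bsub>M\<^esub> h y = h z" using * m h by (simp add: endo_add diff_simps)
      then show ?thesis unfolding c_def 1 using * b q m by (simp add: 1)
    qed
    have "summand (A0 <+>\<^bsub>M\<^esub> Z)"
      using h ch cS subD(1)[OF sub_plus[OF sA0 sZ]] by (intro summandI[OF endo_comp[OF c h]]) auto
    moreover have "split_on h (A0 <+>\<^bsub>M\<^esub> Z)" using c ch by (rule split_onI)
    moreover have "A0 <+>\<^bsub>M\<^esub> Z \<subseteq> A" using A0(1) Z(1) by (intro plus_least[OF sA]) (auto simp: X_def)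
    ultimately have "A0 <+>\<^bsub>M\<^esub> Z = A0" using max plus_upper(1)[OF sA0 sZ] by blast
    then have "Z \<subseteq> A0" using plus_upper(2)[OF sA0 sZ] by simp
    then show "Z = {\<zero>\<^bsub>M\<^esub>}" using Z(1) subD(2)[OF sZ] kA(2) by (force simp: X_def Y_def)
  qed
  ultimately show thesis using that A0(3) by blast
qed

text \<open>The compressions of \<open>h\<close> and of \<open>t = 1 - h\<close> to a local summand
  \<open>Z\<close> add up to the identity, so one of them is invertible, and \<open>h\<close> or
  \<open>t\<close> splits on \<open>Z\<close>. As \<open>h\<close> never does, no non-zero summand
  is left on which \<open>t\<close> is radical, and \<open>t\<close> splits on all of
  \<open>M\<close>.\<close>

lemma radical_minus_bij:
  assumes h: "h \<in> endo" and rad: "radical h (carrier M)"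
  shows "bij_betw (\<lambda>x. x \<ominus>\<^bsub>M\<^esub> h x) (carrier M) (carrier M)"
proof -
  define t where "t x = x \<ominus>\<^bsub>M\<^esub> h x" for x
  have t: "t \<in> endo" unfolding t_def using endo_diff[OF endo_id h] .
  obtain X A0 where XA: "decomp (carrier M) [X, A0]" "split_on t A0" "radical t X"
    using maximal_split[OF t summand_carrier] .
  have X: "summand X" using summand_decomp_mem[OF XA(1)] by simp
  have "X = {\<zero>\<^bsub>M\<^esub>}"
  proof (rule ccontr)
    assume "X \<noteq> {\<zero>\<^bsub>M\<^esub>}"
    then obtain Z where Z: "Z \<subseteq> X" "summand Z" "Z \<noteq> {\<zero>\<^bsub>M\<^esub>}" "local_on Z" using local_summand[OF X] by auto
    note sZ = subD(7)[OF summand_sub[OF Z(2)]]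
    obtain e where e: "e \<in> endo" "\<And>x. x \<in> carrier M \<Longrightarrow> e x \<in> Z" "\<And>x. x \<in> Z \<Longrightarrow> e x = x"
      using summand_proj[OF Z(2)] by blast
    have eh: "(\<lambda>x. e (h x)) \<in> endo" and et: "(\<lambda>x. e (t x)) \<in> endo"
      using endo_comp[OF e(1)] h t by auto
    have "(\<lambda>x. e (h x)) ` Z \<subseteq> Z" using e(2) h sZ by auto
    then consider "bij_betw (\<lambda>x. e (h x)) Z Z" | "bij_betw (\<lambda>x. x \<ominus>\<^bsub>M\<^esub> e (h x)) Z Z"
      using Z(4) eh unfolding local_on_def by blast
    then show False
    proof cases
      case 1
      then obtain g where g: "g \<in> endo" "\<And>x. x \<in> Z \<Longrightarrow> g (e (h x)) = x" using iso_inverse[OF eh Z(2,2)] by metis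
      then have "split_on h Z" using e by (intro split_onI[OF endo_comp[OF g(1) e(1)]]) auto
      then show False using rad Z(2,3) subD(1)[OF summand_sub[OF Z(2)]] unfolding radical_def by blast
    next
      case 2
      have "e (t x) = x \<ominus>\<^bsub>M\<^esub> e (h x)" if "x \<in> Z" for x
        using that e h sZ[OF that] by (simp add: t_def endo_simps)
      then have "bij_betw (\<lambda>x. e (t x)) Z Z"
        using 2 by (subst bij_betw_cong[of Z _ "\<lambda>x. x \<ominus>\<^bsub>M\<^esub> e (h x)"])
      then obtain g where g: "g \<in> endo" "\<And>x. x \<in> Z \<Longrightarrow> g (e (t x)) = x" using iso_inverse[OF et Z(2,2)] by metis
      then have "split_on t Z" using e by (intro split_onI[OF endo_comp[OF g(1) e(1)]]) auto
      then show False using XA(3) Z unfolding radical_def by blast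
    qed
  qed
  then have "A0 = carrier M" using XA(1) plus_zero(2) unfolding decomp_pair by metis
  then obtain a where a: "a \<in> endo" "\<And>x. x \<in> carrier M \<Longrightarrow> a (t x) = x"
    using XA(2) by (auto simp: split_on_def)
  \<comment> \<open>The projection onto a complement of the image of \<open>t\<close>. From
    \<open>q t = 0\<close> follows \<open>q h = q\<close>, so \<open>h\<close> splits on the image
    of \<open>q\<close>; hence \<open>q\<close> is zero and \<open>t\<close> is surjective.\<close>
  define q where "q x = x \<ominus>\<^bsub>M\<^esub> t (a x)" for x
  have q: "q \<in> endo" unfolding q_def by (rule endo_diff[OF endo_id endo_comp[OF t a(1)]])
  have qq: "q (q x) = q x" if "x \<in> carrier M" for x
    using that t a unfolding q_def by (simp add: endo_simps)
  have "summand (q ` carrier M)" using q qq by (intro summandI[OF q]) auto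
  moreover have "split_on h (q ` carrier M)"
  proof (rule split_onI[OF q])
    fix y assume "y \<in> q ` carrier M"
    then obtain x where x: "x \<in> carrier M" "y = q x" by auto
    have qt: "q (t z) = \<zero>\<^bsub>M\<^esub>" if "z \<in> carrier M" for z unfolding q_def using a that t by simp
    have y: "y \<in> carrier M" "q y = y" using x q qq by auto
    have "q y \<ominus>\<^bsub>M\<^esub> q (h y) = \<zero>\<^bsub>M\<^esub>" using qt[OF y(1)] y(1) h q by (simp add: t_def endo_simps)
    then show "q (h y) = y" using y h q by (simp add: diff_solve(1))
  qed
  moreover have "q ` carrier M \<subseteq> carrier M" using q by auto
  ultimately have "q ` carrier M = {\<zero>\<^bsub>M\<^esub>}" using rad by (simp add: radical_def)
  then have "q x = \<zero>\<^bsub>M\<^esub>" if "x \<in> carrier M" for x using that by auto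
  then have ta: "t (a x) = x" if "x \<in> carrier M" for x
    using that t a unfolding q_def by (simp add: diff_solve(1))
  have "bij_betw t (carrier M) (carrier M)"
    using a t ta by (intro bij_betwI[of _ _ _ a]) auto
  then show ?thesis by (simp add: t_def[abs_def])
qed

text \<open>If \<open>h k\<close> splits on \<open>W\<close>, then \<open>k\<close> carries
  \<open>W\<close> onto a summand inside \<open>X\<close> on which \<open>h\<close> splits. This
  summand is zero, and so is \<open>W\<close>, because \<open>k\<close> is injective on it.\<close>

lemma radical_comp_bij:
  assumes h: "h \<in> endo" and k: "k \<in> endo" "\<And>x. x \<in> carrier M \<Longrightarrow> k x \<in> X" and rad: "radical h X"
  shows "bij_betw (\<lambda>x. x \<ominus>\<^bsub>M\<^esub> h (k x)) (carrier M) (carrier M)"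
proof (rule radical_minus_bij)
  show "(\<lambda>x. h (k x)) \<in> endo" by (rule endo_comp[OF h k(1)])
  show "radical (\<lambda>x. h (k x)) (carrier M)"
    unfolding radical_def
  proof (intro allI impI)
    fix W assume W: "W \<subseteq> carrier M" "summand W" "split_on (\<lambda>x. h (k x)) W"
    obtain c where c: "c \<in> endo" "\<And>x. x \<in> W \<Longrightarrow> c (h (k x)) = x" using W(3) by (auto simp: split_on_def)
    have "split_on k W" using c by (intro split_onI[OF endo_comp[OF c(1) h]]) auto
    then have "summand (k ` W)" by (rule split_on_summand[OF k(1) W(2)])
    moreover have "split_on h (k ` W)" using c by (intro split_onI[OF endo_comp[OF k(1) c(1)]]) auto
    moreover have "k ` W \<subseteq> X" using k W(1) by auto
    ultimately have "k ` W = {\<zero>\<^bsub>M\<^esub>}" using rad unfolding radical_def by blast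
    then have "k x = \<zero>\<^bsub>M\<^esub>" if "x \<in> W" for x using imageI[OF that, of k] by simp
    then have "x = \<zero>\<^bsub>M\<^esub>" if "x \<in> W" for x using c(2)[OF that] that c(1) h by simp
    then show "W = {\<zero>\<^bsub>M\<^esub>}" using subD(2)[OF summand_sub[OF W(2)]] by blast
  qed
qed

text \<open>\<^verbatim>\<open>similar_via u v X X'\<close> makes precise that \<^verbatim>\<open>X\<close> and \<^verbatim>\<open>X'\<close> agree modulo the radical of the
  endomorphism ring: each submodule of \<^verbatim>\<open>X\<close> has the same complements as its image in \<^verbatim>\<open>X'\<close>.\<close>

definition similar_via where "similar_via u v X X' \<longleftrightarrow> u \<in> endo \<and> v \<in> endo \<and> u ` X \<subseteq> X' \<and> v ` X' \<subseteq> X \<and>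
  (\<forall>x\<in>X. v (u x) = x) \<and> (\<forall>x\<in>X'. u (v x) = x) \<and> (\<forall>Z Y. sub Z \<longrightarrow> Z \<subseteq> X \<longrightarrow> (dsum Z Y \<longleftrightarrow> dsum (u ` Z) Y))"

lemma similar_viaD:
  assumes "similar_via u v X X'"
  shows "u \<in> endo" "v \<in> endo" "u ` X = X'" "v ` X' = X" "\<And>x. x \<in> X \<Longrightarrow> v (u x) = x" "\<And>x. x \<in> X' \<Longrightarrow> u (v x) = x"
    "\<And>Z Y. \<lbrakk>sub Z; Z \<subseteq> X\<rbrakk> \<Longrightarrow> dsum Z Y \<longleftrightarrow> dsum (u ` Z) Y"
proof -
  note s = assms[unfolded similar_via_def]
  show "u \<in> endo" "v \<in> endo" using s by simp_all
  show "\<And>Z Y. \<lbrakk>sub Z; Z \<subseteq> X\<rbrakk> \<Longrightarrow> dsum Z Y \<longleftrightarrow> dsum (u ` Z) Y" using s by simp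
  have i: "u ` X \<subseteq> X'" "v ` X' \<subseteq> X" and vu: "\<And>x. x \<in> X \<Longrightarrow> v (u x) = x" and uv: "\<And>x. x \<in> X' \<Longrightarrow> u (v x) = x"
    using s by simp_all
  have "u ` v ` X' = X'" "v ` u ` X = X" using uv vu by (simp_all add: image_image)
  then show "u ` X = X'" "v ` X' = X" using i image_mono[OF i(1), of v] image_mono[OF i(2), of u] by simp_all
  fix x show "x \<in> X \<Longrightarrow> v (u x) = x" "x \<in> X' \<Longrightarrow> u (v x) = x" using vu uv by simp_all
qed

lemma similar_sym:
  assumes s: "similar_via u v X X'" shows "similar_via v u X' X"
proof -
  note s = similar_viaD[OF s]
  have "dsum Z Y \<longleftrightarrow> dsum (v ` Z) Y" if Z: "sub Z" "Z \<subseteq> X'" for Z Y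
  proof -
    have "u (v x) = x" if "x \<in> Z" for x using that Z(2) s(6) by auto
    then have "u ` v ` Z = Z" by (simp add: image_image)
    moreover have "v ` Z \<subseteq> X" using Z(2) s(4) by auto
    ultimately show ?thesis using s(7)[OF sub_image[OF s(2) Z(1)], of Y] by simp
  qed
  then show ?thesis unfolding similar_via_def using s(1-6) by simp
qed

lemma similar_sub:
  assumes s: "similar_via u v X X'" and Z: "Z \<subseteq> X" shows "similar_via u v Z (u ` Z)"
proof -
  note s = similar_viaD[OF s]
  have "v (u x) = x" if "x \<in> Z" for x using that Z s(5) by auto
  moreover have "dsum W Y \<longleftrightarrow> dsum (u ` W) Y" if "sub W" "W \<subseteq> Z" for W Y
    using that(2) Z by (intro s(7)[OF that(1)]) auto
  ultimately show ?thesis unfolding similar_via_def using s(1,2) by auto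
qed

lemma similar_swap:
  assumes s: "similar_via u v X X'" and d: "decomp (carrier M) (X # L)"
  shows "decomp (carrier M) (X' # L)"
proof -
  note s = similar_viaD[OF s]
  obtain K where K: "decomp K L" "sub X" "carrier M = X <+>\<^bsub>M\<^esub> K" "X \<inter> K = {\<zero>\<^bsub>M\<^esub>}"
    using d by (auto simp: decomp.simps(2))
  then have "dsum X K" using decomp_sub[OF K(1)] by (simp add: direct_sum_def)
  then have "dsum X' K" using s(7)[OF K(2), of K] s(3) by simp
  then show ?thesis using K(1) dsumD[of X' K] by (auto simp: decomp.simps(2))
qed

section \<open>The relative position of two summands\<close>

lemma relative_decomposition:
  assumes A: "summand A" and B: "summand B"
  obtains X X' A0 B0 D u v where "decomp A [X, A0]" "decomp B [X', B0]"
    "decomp (carrier M) [A0, X', B0, D]" "similar_via u v X X'"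
proof -
  note sA = summand_sub[OF A] and sB = summand_sub[OF B]
  obtain f where f: "f \<in> endo" "\<And>x. x \<in> carrier M \<Longrightarrow> f x \<in> B" "\<And>x. x \<in> B \<Longrightarrow> f x = x"
    using summand_proj[OF B] by blast
  \<comment> \<open>The kernel of \<open>h\<close> is \<open>B\<close>. Where \<open>h\<close> is
    radical, the projection \<open>f = 1 - h\<close> is a radical perturbation of the
    identity.\<close>
  define h where "h x = x \<ominus>\<^bsub>M\<^esub> f x" for x
  have h: "h \<in> endo" unfolding h_def by (rule endo_diff[OF endo_id f(1)])
  have fh: "f x = x \<ominus>\<^bsub>M\<^esub> h x" if "x \<in> carrier M" for x using that f by (simp add: h_def)
  obtain X A0 where XA: "decomp A [X, A0]" "split_on h A0" "radical h X"
    using maximal_split[OF h A] .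
  obtain Y0 where Y0: "decomp (carrier M) [Y0, X, A0]" using decomp_summand[OF A XA(1)] by blast
  have X: "summand X" and A0: "summand A0" using summand_decomp_mem[OF Y0] by auto
  note sX = summand_sub[OF X] and sA0 = summand_sub[OF A0]
  have fwd: "dsum (f ` Z) Y \<and> inj_on f Z" if Z: "sub Z" "Z \<subseteq> X" and d: "dsum Z Y" for Z Y
  proof -
    obtain p where p: "p \<in> endo" "\<And>x. x \<in> carrier M \<Longrightarrow> p x \<in> Z" "\<And>x. x \<in> Z \<Longrightarrow> p x = x"
      "\<And>x. x \<in> carrier M \<Longrightarrow> p x = \<zero>\<^bsub>M\<^esub> \<longleftrightarrow> x \<in> Y" using dsum_proj[OF d] by metis
    \<comment> \<open>This automorphism agrees with \<open>f\<close> on \<open>Z\<close> and with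
      the identity on \<open>Y\<close>, so it carries \<open>Z \<oplus> Y\<close> to
      \<open>f Z \<oplus> Y\<close>.\<close>
    let ?t = "\<lambda>x. x \<ominus>\<^bsub>M\<^esub> h (p x)"
    have t: "?t \<in> endo" by (rule endo_diff[OF endo_id endo_comp[OF h p(1)]])
    have bij: "bij_betw ?t (carrier M) (carrier M)"
      using p Z(2) by (intro radical_comp_bij[OF h p(1) _ XA(3)]) auto
    have tZ: "?t x = f x" if "x \<in> Z" for x using that p(3) fh subD(7)[OF Z(1)] by simp
    have "?t x = x" if "x \<in> Y" for x
      using that p(4)[of x] h subD(7)[OF dsumD(2)[OF d] that] by simp
    then have "?t ` Y = Y" by simp
    moreover have "?t ` Z = f ` Z" using tZ by simp
    ultimately have "dsum (f ` Z) Y" using dsum_image[OF t bij d] by simp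
    moreover have "inj_on ?t Z" using bij_betw_imp_inj_on[OF bij] subD(1)[OF Z(1)] by (rule inj_on_subset)
    then have "inj_on f Z" using tZ by (subst (asm) inj_on_cong[of Z _ f])
    ultimately show ?thesis by simp
  qed
  obtain YX where YX: "dsum X YX" using X by (auto simp: direct_summand_def)
  define X' where "X' = f ` X"
  have X': "summand X'" "inj_on f X" using fwd[OF sX _ YX] by (auto simp: X'_def direct_summand_def)
  then have "bij_betw f X X'" by (simp add: X'_def bij_betw_def)
  then obtain v where v: "v \<in> endo" "\<And>x. x \<in> carrier M \<Longrightarrow> v x \<in> X" "\<And>x. x \<in> X \<Longrightarrow> v (f x) = x"
    "\<And>y. y \<in> X' \<Longrightarrow> f (v y) = y" using iso_inverse[OF f(1) X X'(1)] by metis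
  have bwd: "dsum Z Y" if Z: "sub Z" "Z \<subseteq> X" and d: "dsum (f ` Z) Y" for Z Y
  proof -
    obtain p where p: "p \<in> endo" "\<And>x. x \<in> carrier M \<Longrightarrow> p x \<in> f ` Z" "\<And>x. x \<in> f ` Z \<Longrightarrow> p x = x"
      "\<And>x. x \<in> carrier M \<Longrightarrow> p x = \<zero>\<^bsub>M\<^esub> \<longleftrightarrow> x \<in> Y" using dsum_proj[OF d] by metis
    \<comment> \<open>The sign makes \<open>?t\<close> equal to \<open>1 + h v p\<close>. It fixes
      \<open>Y\<close> and sends \<open>f z\<close> to \<open>f z \<oplus> h z = z\<close>, which
      moves \<open>f Z\<close> back to \<open>Z\<close>.\<close>
    let ?k = "\<lambda>x. \<ominus>\<^bsub>M\<^esub> v (p x)"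
    let ?t = "\<lambda>x. x \<ominus>\<^bsub>M\<^esub> h (?k x)"
    have k: "?k \<in> endo" by (rule endo_uminus[OF endo_comp[OF v(1) p(1)]])
    have t: "?t \<in> endo" by (rule endo_diff[OF endo_id endo_comp[OF h k]])
    have bij: "bij_betw ?t (carrier M) (carrier M)"
      using p v subD(5)[OF sX] by (intro radical_comp_bij[OF h k _ XA(3)]) auto
    have "?t (f z) = z" if "z \<in> Z" for z
    proof -
      have z: "z \<in> carrier M" "p (f z) = f z" "v (f z) = z" using that p(3) v(3) Z subD(7)[OF sX] by auto
      then have "?t (f z) = f z \<oplus>\<^bsub>M\<^esub> h z" using h f by (simp add: endo_neg a_minus_def)
      then show ?thesis using z f by (simp add: h_def)
    qed
    then have "?t ` f ` Z = Z" by (simp add: image_image)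
    moreover have "?t x = x" if "x \<in> Y" for x
      using that p(4)[of x] h v(1) subD(7)[OF dsumD(2)[OF d] that] by simp
    then have "?t ` Y = Y" by simp
    ultimately show ?thesis using dsum_image[OF t bij d] by simp
  qed
  have sim: "similar_via f v X X'"
    unfolding similar_via_def using f(1) v fwd bwd subD(7)[OF summand_sub[OF X'(1)]]
    by (auto simp: X'_def)
  have X'B: "X' \<subseteq> B" using f(2) subD(7)[OF sX] by (auto simp: X'_def)
  obtain B0 where B0: "decomp B [X', B0]" using summand_within[OF X'(1) X'B sB] .
  obtain a where a: "a \<in> endo" "\<And>x. x \<in> A0 \<Longrightarrow> a (h x) = x" using XA(2) by (auto simp: split_on_def)
  obtain p where p: "p \<in> endo" "\<And>x. x \<in> carrier M \<Longrightarrow> p x \<in> A0" "\<And>x. x \<in> A0 \<Longrightarrow> p x = x"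
    using summand_proj[OF A0] by blast
  \<comment> \<open>Since \<open>h\<close> vanishes on \<open>B\<close>, this is a projection onto
    \<open>A0\<close> that kills \<open>B\<close>, as required for \<open>A0 + B\<close> to be a
    direct sum and a summand.\<close>
  let ?r = "\<lambda>x. p (a (h x))"
  have "h x = \<zero>\<^bsub>M\<^esub>" if "x \<in> B" for x using f(3)[OF that] subD(7)[OF sB that] by (simp add: h_def)
  then have "\<And>x. x \<in> carrier M \<Longrightarrow> ?r x \<in> A0" "\<And>x. x \<in> A0 \<Longrightarrow> ?r x = x" "\<And>x. x \<in> B \<Longrightarrow> ?r x = \<zero>\<^bsub>M\<^esub>"
    using a p h by auto
  then have AB: "A0 \<inter> B = {\<zero>\<^bsub>M\<^esub>}" "summand (A0 <+>\<^bsub>M\<^esub> B)"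
    using summand_extend[OF B endo_comp[OF p(1) endo_comp[OF a(1) h]] _ _ sA0] by blast+
  then have "decomp (A0 <+>\<^bsub>M\<^esub> B) [A0, B]" using sA0 sB by (intro decomp_pair[THEN iffD2]) auto
  then obtain D where "decomp (carrier M) [D, A0, B]" using decomp_summand[OF AB(2)] by blast
  then have "decomp (carrier M) (B # [A0, D])" by (rule decomp_perm) simp
  then have "decomp (carrier M) ([X', B0] @ [A0, D])" using decomp_refine[OF B0] by blast
  then have "decomp (carrier M) [A0, X', B0, D]"
by (rule decomp_perm) simp
  then show thesis using that XA(1) B0 sim by blast
qed

text \<open>To avoid cancelling \<open>X\<close>, a second relative decomposition compares
  \<open>X\<close> with \<open>B'\<close>. Their common part \<open>Z\<close>, \<open>Z'\<close>
  drops out because \<open>A\<close> and \<open>B'\<close> share the complement \<open>C\<close>,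
  and \<open>X1 \<oplus> A0\<close> becomes isomorphic to \<open>B1\<close>. The rest
  \<open>X1\<close> of \<open>X\<close> is independent of \<open>B'\<close> and can be moved into
  \<open>B\<close>, where it leaves enough room to embed \<open>B1\<close> into
  \<open>B0\<close>.\<close>

lemma perspective_embeds:
  assumes "dsum A C" "dsum B' C" and B: "summand B" "decomp B [B', B'']"
    and A: "decomp A [X, A0]" and B0: "decomp B [X', B0]" and sim: "similar_via u v X X'"
  shows "embeds A0 B0"
proof -
  have AC: "decomp (carrier M) [A, C]" and BC: "decomp (carrier M) [B', C]"
    using assms dsum_decomp by auto
  obtain Y where Y: "decomp (carrier M) [Y, B]" using B(1) dsum_decomp dsum_sym unfolding direct_summand_def by blast
  have "decomp (carrier M) ([X, A0] @ [C])" using decomp_refine[OF A] AC by blast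
  then have sX: "summand X" by (rule summand_decomp_mem) simp
  have sB': "summand B'" using summand_decomp_mem[OF BC] by simp
  obtain Z Z' X1 B1 W w w' where Z: "decomp X [Z, X1]" "decomp B' [Z', B1]"
    "decomp (carrier M) [X1, Z', B1, W]" and simZ: "similar_via w w' Z Z'"
    using relative_decomposition[OF sX sB'] .
  define X1' where "X1' = u ` X1"
  have X1X: "X1 \<subseteq> X" using Z(1) plus_upper(2) unfolding decomp_pair by blast
  have sim1: "similar_via u v X1 X1'" unfolding X1'_def by (rule similar_sub[OF sim X1X])

  \<comment> \<open>Complements of \<open>Z \<oplus> C\<close>: the decomposition of
    \<open>A\<close> gives \<open>X1 \<oplus> A0\<close>, and that of \<open>B'\<close> gives
    \<open>B1\<close> once \<open>Z'\<close> is exchanged for \<open>Z\<close>.\<close>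
  have "decomp (carrier M) (X # [A0, C])" using \<open>decomp (carrier M) ([X, A0] @ [C])\<close> by simp
  then have "decomp (carrier M) ([Z, X1] @ [A0, C])" using decomp_refine[OF Z(1)] by blast
  then have "decomp (carrier M) ([X1, A0] @ [Z, C])" by (rule decomp_perm) simp
  then obtain S where S: "decomp S [X1, A0]" "decomp (carrier M) (S # [Z, C])" by (rule decomp_merge)
  have "decomp (carrier M) ([Z', B1] @ [C])" using decomp_refine[OF Z(2)] BC by blast
  then have "decomp (carrier M) (Z' # [B1, C])" by simp
  then have "decomp (carrier M) (Z # [B1, C])" by (rule similar_swap[OF similar_sym[OF simZ]])
  then have "decomp (carrier M) (B1 # [Z, C])" by (rule decomp_perm) simp
  then have 1: "embeds S B1" by (rule common_complement_embeds[OF S(2)])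
  have 2: "embeds A0 S" using S(1) plus_upper(2) unfolding decomp_pair by (intro embeds_subset) auto

  \<comment> \<open>Complements of \<open>X1' \<oplus> Z' \<oplus> Y\<close>: the decomposition of
    \<open>B\<close> through \<open>B'\<close> gives \<open>B1 \<oplus> B2\<close>; the one through
    \<open>X'\<close> gives \<open>B0\<close>, after \<open>X'\<close> is exchanged for
    \<open>X\<close> and the parts \<open>Z\<close>, \<open>X1\<close> of \<open>X\<close> for
    \<open>Z'\<close>, \<open>X1'\<close>.\<close>
  have "decomp (carrier M) (X1' # [Z', B1, W])" by (rule similar_swap[OF sim1 Z(3)])
  then have "decomp (carrier M) ([X1', Z', B1] @ [W])" by simp
  then obtain T where T: "decomp T [X1', Z', B1]" "decomp (carrier M) (T # [W])" by (rule decomp_merge)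
  have sT: "summand T" using summand_decomp_mem[OF T(2)] by simp
  have sB: "sub B" using summand_sub[OF B(1)] .
  have "X' \<subseteq> B" using B0 plus_upper(1) unfolding decomp_pair by blast
  then have "X1' \<subseteq> B" using X1X similar_viaD(3)[OF sim] by (auto simp: X1'_def)
  moreover have "B' \<subseteq> B" using B(2) plus_upper(1) unfolding decomp_pair by blast
  moreover have "T = X1' <+>\<^bsub>M\<^esub> B'"
  proof -
    obtain N where "decomp N [Z', B1]" "T = X1' <+>\<^bsub>M\<^esub> N" using T(1) unfolding decomp.simps(2)[of T] by blast
    then show ?thesis using decomp_unique[OF Z(2)] by blast
  qed
  ultimately have "T \<subseteq> B" using plus_least[OF sB] by simp
  then obtain B2 where "decomp B [T, B2]" using summand_within[OF sT _ sB] by blast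
  then have BT: "decomp B ([X1', Z', B1] @ [B2])" using decomp_refine[OF T(1)] by blast
  have "decomp (carrier M) (B # [Y])" using Y by (rule decomp_perm) simp
  then have BY: "decomp (carrier M) (L @ [Y])" if "decomp B L" for L
    using decomp_refine[OF that, of "carrier M" "[Y]"] by simp
  have "decomp (carrier M) ([B1, B2] @ [X1', Z', Y])" using BY[OF BT] by (rule decomp_perm) simp
  then obtain U where U: "decomp U [B1, B2]" "decomp (carrier M) (U # [X1', Z', Y])" by (rule decomp_merge)
  have "decomp (carrier M) (X' # [B0, Y])" using BY[OF B0] by simp
  then have "decomp (carrier M) (X # [B0, Y])" by (rule similar_swap[OF similar_sym[OF sim]])
  then have "decomp (carrier M) ([Z, X1] @ [B0, Y])" using decomp_refine[OF Z(1)] by blast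
  then have "decomp (carrier M) (Z # [X1, B0, Y])" by simp
  then have "decomp (carrier M) (Z' # [X1, B0, Y])" by (rule similar_swap[OF simZ])
  then have "decomp (carrier M) (X1 # [Z', B0, Y])" by (rule decomp_perm) simp
  then have "decomp (carrier M) (X1' # [Z', B0, Y])" by (rule similar_swap[OF sim1])
  then have "decomp (carrier M) (B0 # [X1', Z', Y])" by (rule decomp_perm) simp
  then have 3: "embeds U B0" by (rule common_complement_embeds[OF U(2)])
  have 4: "embeds B1 U" using U(1) plus_upper(1) unfolding decomp_pair by (intro embeds_subset) auto
  show ?thesis using 1 2 3 4 embeds_trans by blast
qed

text \<open>Cantor--Bernstein: with \<^verbatim>\<open>P = g Q \<oplus> C\<close> and \<^verbatim>\<open>\<phi> = g f\<close>, the summand \<^verbatim>\<open>E\<close> is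
  the sum of the \<^verbatim>\<open>\<phi>^n C\<close>, so that \<^verbatim>\<open>E = C \<oplus> \<phi> E\<close>. If \<^verbatim>\<open>g Q = \<phi> E \<oplus> F\<close>, then \<^verbatim>\<open>P = E \<oplus> F\<close>
  is isomorphic to \<^verbatim>\<open>g Q\<close> by \<^verbatim>\<open>\<phi>\<close> on \<^verbatim>\<open>E\<close> and the identity on \<^verbatim>\<open>F\<close>.\<close>

lemma embeds_antisym:
  assumes P: "summand P" and Q: "summand Q" and PQ: "embeds P Q" and QP: "embeds Q P"
  obtains h where "h \<in> endo" "bij_betw h P Q"
proof -
  obtain f f' where f: "f \<in> endo" "f ` P \<subseteq> Q" "f' \<in> endo" "\<And>x. x \<in> P \<Longrightarrow> f' (f x) = x"
    using PQ by (auto simp: embeds_def split_on_def)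
  obtain g g' where g: "g \<in> endo" "g ` Q \<subseteq> P" "g' \<in> endo" "\<And>x. x \<in> Q \<Longrightarrow> g' (g x) = x" "split_on g Q"
    using QP by (auto simp: embeds_def split_on_def)
  define \<phi> where "\<phi> x = g (f x)" for x
  have \<phi>: "\<phi> \<in> endo" unfolding \<phi>_def by (rule endo_comp[OF g(1) f(1)])
  have spl: "split_on \<phi> P"
    using f(2) f(4) g(4) by (intro split_onI[OF endo_comp[OF f(3) g(3)]]) (force simp: \<phi>_def)
  have \<phi>P: "\<phi> x \<in> g ` Q" if "x \<in> P" for x unfolding \<phi>_def using f(2) that by auto
  have gQ: "summand (g ` Q)" by (rule split_on_summand[OF g(1) Q g(5)])
  note sP = summand_sub[OF P] and sgQ = summand_sub[OF gQ]
  obtain C where C: "decomp P [g ` Q, C]" using summand_within[OF gQ g(2) sP] .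
  have sC: "sub C" and CgQ: "g ` Q \<inter> C = {\<zero>\<^bsub>M\<^esub>}" and PgC: "P = g ` Q <+>\<^bsub>M\<^esub> C" using C decomp_pair by auto
  have CP: "C \<subseteq> P" unfolding PgC by (rule plus_upper(2)[OF sgQ sC])
  \<comment> \<open>\<open>D n\<close> is the sum of the \<open>\<phi>^k C\<close> with
    \<open>k < n\<close>. The recursion adds \<open>C\<close> in front, so that it turns into
    \<open>E = C + \<phi> E\<close> for the union.\<close>
  define D where "D n = rec_nat {\<zero>\<^bsub>M\<^esub>} (\<lambda>_ W. C <+>\<^bsub>M\<^esub> \<phi> ` W) n" for n
  have D0: "D 0 = {\<zero>\<^bsub>M\<^esub>}" and DS: "D (Suc n) = C <+>\<^bsub>M\<^esub> \<phi> ` D n" for n by (simp_all add: D_def)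
  have \<phi>W: "summand (\<phi> ` W)" "\<phi> ` W \<subseteq> g ` Q" if "summand W" "W \<subseteq> P" for W
    using split_on_summand[OF \<phi> that(1) split_on_mono[OF spl that(2)]] \<phi>P that(2) by auto
  have D: "summand (D n) \<and> D n \<subseteq> P" for n
  proof (induction n)
    case 0 show ?case using D0 subD(2)[OF sP] by simp
  next
    case (Suc n)
    obtain V where "decomp (g ` Q) [\<phi> ` D n, V]" using summand_within[OF \<phi>W sgQ] Suc by blast
    then have "decomp P ([\<phi> ` D n, V] @ [C])" using decomp_refine C by blast
    then have "decomp P ([C, \<phi> ` D n] @ [V])" by (rule decomp_perm) simp
    then obtain S where S: "decomp S [C, \<phi> ` D n]" "decomp P (S # [V])" by (rule decomp_merge)
    have "D (Suc n) = S" using S(1) DS decomp_pair by simp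
    moreover obtain Y where "decomp (carrier M) (Y # [S, V])" using decomp_summand[OF P S(2)] by blast
    then have "summand S" by (rule summand_decomp_mem) simp
    moreover have "S \<subseteq> P" using S(2) plus_upper(1) unfolding decomp_pair by blast
    ultimately show ?case by simp
  qed
  have Dmono: "D n \<subseteq> D (Suc n)" for n
  proof (induction n)
    case 0 show ?case using D subD(2)[OF summand_sub, of "D (Suc 0)"] D0 by auto
  next
    case (Suc n) then show ?case unfolding DS by (intro plus_mono image_mono) auto
  qed
  define E where "E = (\<Union>n. D n)"
  have "subset.chain {A. summand A} (range D)"
    unfolding subset_chain_def using D lift_Suc_mono_le[of D] Dmono nat_le_linear by auto blast
  then have sE: "summand E" unfolding E_def by (intro chain_summand) auto
  have EP: "E \<subseteq> P" using D by (auto simp: E_def)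
  have "E = C <+>\<^bsub>M\<^esub> \<phi> ` E"
  proof
    show "E \<subseteq> C <+>\<^bsub>M\<^esub> \<phi> ` E"
    proof
      fix x assume "x \<in> E"
      then obtain n where "x \<in> D (Suc n)" using Dmono by (auto simp: E_def)
      then show "x \<in> C <+>\<^bsub>M\<^esub> \<phi> ` E" unfolding DS set_add_iff E_def by blast
    qed
    show "C <+>\<^bsub>M\<^esub> \<phi> ` E \<subseteq> E"
    proof
      fix x assume "x \<in> C <+>\<^bsub>M\<^esub> \<phi> ` E"
      then obtain n where "x \<in> C <+>\<^bsub>M\<^esub> \<phi> ` D n" unfolding set_add_iff E_def by blast
      then have "x \<in> D (Suc n)" by (simp add: DS)
      then show "x \<in> E" by (auto simp: E_def)
    qed
  qed
  moreover have "C \<inter> \<phi> ` E = {\<zero>\<^bsub>M\<^esub>}"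
    using \<phi>W(2)[OF sE EP] CgQ subD(2)[OF sC] subD(2)[OF summand_sub[OF \<phi>W(1)[OF sE EP]]] by blast
  ultimately have E: "decomp E [C, \<phi> ` E]" using sC summand_sub[OF \<phi>W(1)[OF sE EP]]
    by (intro decomp_pair[THEN iffD2]) simp
  obtain F where F: "decomp (g ` Q) [\<phi> ` E, F]" using summand_within[OF \<phi>W(1,2)[OF sE EP] sgQ] .
  then have "decomp P ([\<phi> ` E, F] @ [C])" using decomp_refine C by blast
  then have "decomp P ([C, \<phi> ` E] @ [F])" by (rule decomp_perm) simp
  then have EF: "decomp P [E, F]" using decomp_refine[OF E] by blast
  obtain Y where "decomp (carrier M) [Y, E, F]" using decomp_summand[OF P EF] by blast
  then have "decomp (carrier M) ([F, Y] @ [E])" by (rule decomp_perm) simp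
  \<comment> \<open>\<open>K\<close> is a complement of \<open>E\<close> that contains
    \<open>F\<close>, so the projection onto \<open>E\<close> along \<open>K\<close> separates the
    two parts of \<open>P\<close>.\<close>
  then obtain K where K: "decomp K [F, Y]" "decomp (carrier M) [K, E]" by (rule decomp_merge)
  have FK: "F \<subseteq> K" using K(1) plus_upper(1) unfolding decomp_pair by blast
  have "dsum E K" using K(2) dsum_decomp dsum_sym by blast
  then obtain e where e: "e \<in> endo" "\<And>x. x \<in> E \<Longrightarrow> e x = x" "\<And>x. x \<in> carrier M \<Longrightarrow> e x = \<zero>\<^bsub>M\<^esub> \<longleftrightarrow> x \<in> K"
    using dsum_proj by metis
  define \<theta> where "\<theta> x = \<phi> (e x) \<oplus>\<^bsub>M\<^esub> (x \<ominus>\<^bsub>M\<^esub> e x)" for x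
  have \<theta>: "\<theta> \<in> endo" unfolding \<theta>_def by (intro endo_plus endo_comp[OF \<phi> e(1)] endo_diff endo_id e(1))
  have sEF: "sub E" "sub F" "P = E <+>\<^bsub>M\<^esub> F" using EF decomp_pair by auto
  have \<theta>x: "\<theta> (d \<oplus>\<^bsub>M\<^esub> y) = \<phi> d \<oplus>\<^bsub>M\<^esub> y" if "d \<in> E" "y \<in> F" for d y
  proof -
    have c: "d \<in> carrier M" "y \<in> carrier M" using that sEF subD(7) by auto
    have "e (d \<oplus>\<^bsub>M\<^esub> y) = d" using e(1,2) e(3)[of y] c that FK by (simp add: endo_add subset_iff)
    moreover have "(d \<oplus>\<^bsub>M\<^esub> y) \<ominus>\<^bsub>M\<^esub> d = y" using c by (simp add: diff_simps)
    ultimately show ?thesis by (simp add: \<theta>_def)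
  qed
  have "bij_betw \<theta> P (g ` Q)"
    unfolding bij_betw_def
  proof
    show "inj_on \<theta> P"
    proof (rule inj_onI)
      fix x y assume xy: "x \<in> P" "y \<in> P" "\<theta> x = \<theta> y"
      obtain d a where x: "d \<in> E" "a \<in> F" "x = d \<oplus>\<^bsub>M\<^esub> a" using xy sEF(3) by (auto simp: set_add_iff)
      obtain d' b where y: "d' \<in> E" "b \<in> F" "y = d' \<oplus>\<^bsub>M\<^esub> b" using xy sEF(3) by (auto simp: set_add_iff)
      have "\<phi> d \<oplus>\<^bsub>M\<^esub> a = \<phi> d' \<oplus>\<^bsub>M\<^esub> b" using xy(3) x(3) y(3) \<theta>x[OF x(1,2)] \<theta>x[OF y(1,2)] by simp
      then have "\<phi> d = \<phi> d'" "a = b" using decomp_pair_eq[OF F imageI[OF x(1)] x(2) imageI[OF y(1)] y(2)] by simp_all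
      then have "d = d'" using split_on_inj[OF spl] x(1) y(1) EP by (meson inj_onD subsetD)
      then show "x = y" using x y \<open>a = b\<close> by simp
    qed
    have gQF: "g ` Q = \<phi> ` E <+>\<^bsub>M\<^esub> F" using F decomp_pair by simp
    show "\<theta> ` P = g ` Q"
    proof
      show "\<theta> ` P \<subseteq> g ` Q"
      proof
        fix y assume "y \<in> \<theta> ` P"
        then obtain x where x: "x \<in> P" "y = \<theta> x" by blast
        obtain d a where "d \<in> E" "a \<in> F" "x = d \<oplus>\<^bsub>M\<^esub> a" using x(1) unfolding sEF(3) set_add_iff by blast
        then show "y \<in> g ` Q" unfolding gQF x(2) by (auto simp: \<theta>x intro: set_addI)
      qed
      show "g ` Q \<subseteq> \<theta> ` P"
      proof
        fix y assume "y \<in> g ` Q"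
        then obtain d a where "d \<in> E" "a \<in> F" "y = \<phi> d \<oplus>\<^bsub>M\<^esub> a" unfolding gQF by (auto simp: set_add_iff)
        then show "y \<in> \<theta> ` P" unfolding sEF(3) using \<theta>x set_addI by (intro image_eqI[of _ _ "d \<oplus>\<^bsub>M\<^esub> a"]) auto
      qed
    qed
  qed
  moreover have "bij_betw g' (g ` Q) Q"
    using g(4) by (intro bij_betwI[of _ _ _ g]) auto
  ultimately have "bij_betw (g' \<circ> \<theta>) P Q" by (rule bij_betw_trans)
  then show thesis using that[OF endo_comp[OF g(3) \<theta>]] by (simp add: comp_def)
qed

section \<open>Construction of the common complement\<close>

theorem PSB_property: "PSB_property R M"
  unfolding PSB_property_def
proof (intro allI impI; elim exE conjE)
  fix A B B' A' assume A: "summand A" and B: "summand B"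
    and B': "direct_summand R (M\<lparr>carrier := B\<rparr>) B'" "perspective R M A B'"
    and A': "direct_summand R (M\<lparr>carrier := A\<rparr>) A'" "perspective R M B A'"
  obtain B'' where B'': "decomp B [B', B'']" using direct_summand_within[OF summand_sub[OF B] B'(1)] .
  obtain A'' where A'': "decomp A [A', A'']" using direct_summand_within[OF summand_sub[OF A] A'(1)] .
  obtain C where C: "dsum A C" "dsum B' C" using B'(2) by (auto simp: perspective_def)
  obtain C' where C': "dsum B C'" "dsum A' C'" using A'(2) by (auto simp: perspective_def)
  obtain X X' A0 B0 D u v where rel: "decomp A [X, A0]" "decomp B [X', B0]"
    "decomp (carrier M) [A0, X', B0, D]" and sim: "similar_via u v X X'"
    using relative_decomposition[OF A B] .
  have "embeds A0 B0" by (rule perspective_embeds[OF C B B'' rel(1,2) sim])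
  moreover have "embeds B0 A0" by (rule perspective_embeds[OF C' A A'' rel(2,1) similar_sym[OF sim]])
  moreover have "summand A0" "summand B0" using summand_decomp_mem[OF rel(3)] by simp_all
  ultimately obtain h where h: "h \<in> endo" "bij_betw h A0 B0" using embeds_antisym by blast
  have "decomp (carrier M) ([A0, B0] @ [X', D])" using rel(3) by (rule decomp_perm) simp
  then obtain S where S: "decomp S [A0, B0]" "decomp (carrier M) (S # [X', D])" by (rule decomp_merge)
  obtain G where G: "decomp S [A0, G]" "decomp S [B0, G]" using graph_complement[OF S(1) h] .
  \<comment> \<open>\<open>S \<oplus> D\<close> complements both \<open>X'\<close> and
    \<open>X\<close>. Refining \<open>S\<close> as \<open>A0 \<oplus> G\<close> next to
    \<open>X\<close>, and as \<open>B0 \<oplus> G\<close> next to \<open>X'\<close>, leaves the same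
    remainder \<open>G \<oplus> D\<close>.\<close>
  have "decomp (carrier M) (X' # [S, D])" using S(2) by (rule decomp_perm) simp
  then have "decomp (carrier M) (X # [S, D])" by (rule similar_swap[OF similar_sym[OF sim]])
  then have "decomp (carrier M) (S # [X, D])" by (rule decomp_perm) simp
  then have "decomp (carrier M) ([A0, G] @ [X, D])" using decomp_refine[OF G(1)] by blast
  then have "decomp (carrier M) ([X, A0] @ [G, D])" by (rule decomp_perm) simp
  then have "decomp (carrier M) (A # [G, D])" using decomp_refine[OF rel(1)] by blast
  then have "decomp (carrier M) ([G, D] @ [A])" by (rule decomp_perm) simp
  then obtain K where K: "decomp K [G, D]" "decomp (carrier M) [K, A]" by (rule decomp_merge)
  have "decomp (carrier M) ([B0, G] @ [X', D])" using decomp_refine[OF G(2)] S(2) by blast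
  then have "decomp (carrier M) ([X', B0] @ [G, D])" by (rule decomp_perm) simp
  then have "decomp (carrier M) (B # [G, D])" using decomp_refine[OF rel(2)] by blast
  then have "decomp (carrier M) ([G, D] @ [B])" by (rule decomp_perm) simp
  then have "decomp (carrier M) [K, B]" using decomp_refine[OF K(1)] by blast
  then show "perspective R M A B"
    unfolding perspective_def using K(2) dsum_decomp dsum_sym by blast
qed

end

section \<open>Discrete modules\<close>

context left_module
begin

text \<open>By the first isomorphism theorem, \<open>M\<close> modulo the kernel is isomorphic to
  the image of \<open>g\<close>, so \<open>D2\<close> applies to the kernel.\<close>

lemma D2_ker_summand:
  assumes D2: "cond_D2 R M" and g: "g \<in> endo" and K: "summand (g ` carrier M)"
  shows "summand {x \<in> carrier M. g x = \<zero>\<^bsub>M\<^esub>}"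
proof -
  define A where "A = {x \<in> carrier M. g x = \<zero>\<^bsub>M\<^esub>}"
  let ?Q = "quotient_module M A"
  have A: "sub A" unfolding A_def by (rule sub_ker[OF g])
  interpret Q: left_module R ?Q by (rule quotient_is_left_module[OF A])
  have carr: "X \<in> carrier ?Q \<longleftrightarrow> (\<exists>x\<in>carrier M. X = A +>\<^bsub>M\<^esub> x)" for X
    by (auto simp: quotient_module_def A_RCOSETS_def')
  have coset: "y \<in> A +>\<^bsub>M\<^esub> x \<longleftrightarrow> (\<exists>a\<in>A. y = a \<oplus>\<^bsub>M\<^esub> x)" for x y by (auto simp: a_r_coset_def')
  have self: "x \<in> A +>\<^bsub>M\<^esub> x" if "x \<in> carrier M" for x
    unfolding coset using that subD(2)[OF A] by (intro bexI[of _ "\<zero>\<^bsub>M\<^esub>"]) auto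
  have gcoset: "y \<in> carrier M" "g y = g x" if "x \<in> carrier M" "y \<in> A +>\<^bsub>M\<^esub> x" for x y
    using that g unfolding coset by (auto simp: A_def endo_add)
  \<comment> \<open>The induced map is evaluated at a chosen representative; \<open>g\<close> is
    constant on each coset of its kernel, so any other representative gives the same value.\<close>
  define F where "F X = g (SOME x. x \<in> X)" for X
  have F: "F X = g x" and mem: "x \<in> carrier M" if X: "X \<in> carrier ?Q" and x: "x \<in> X" for X x
  proof -
    obtain z where z: "z \<in> carrier M" "X = A +>\<^bsub>M\<^esub> z" using X carr by blast
    have "(SOME x. x \<in> X) \<in> X" using x by (rule someI)
    then show "F X = g x" "x \<in> carrier M" unfolding F_def using gcoset z x by auto
  qed
  have ex: "\<exists>x. x \<in> X" if "X \<in> carrier ?Q" for X using that carr self by blast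
  have "F \<in> lmodule_hom R ?Q (M\<lparr>carrier := g ` carrier M\<rparr>)"
    unfolding lmodule_hom_def
  proof (intro CollectI conjI ballI Pi_I)
    fix X assume X: "X \<in> carrier ?Q"
    then obtain x where x: "x \<in> X" using ex by blast
    show "F X \<in> carrier (M\<lparr>carrier := g ` carrier M\<rparr>)" using F[OF X x] mem[OF X x] by simp
    fix Y assume Y: "Y \<in> carrier ?Q"
    then obtain y where y: "y \<in> Y" using ex by blast
    have "x \<oplus>\<^bsub>M\<^esub> y \<in> X \<oplus>\<^bsub>?Q\<^esub> Y" using x y by (simp add: quotient_module_def set_addI)
    then have "F (X \<oplus>\<^bsub>?Q\<^esub> Y) = g (x \<oplus>\<^bsub>M\<^esub> y)" using X Y by (intro F) auto
    then show "F (X \<oplus>\<^bsub>?Q\<^esub> Y) = F X \<oplus>\<^bsub>M\<lparr>carrier := g ` carrier M\<rparr>\<^esub> F Y"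
      using F[OF X x] F[OF Y y] mem[OF X x] mem[OF Y y] g by (simp add: endo_add)
  next
    fix r X assume r: "r \<in> carrier R" and X: "X \<in> carrier ?Q"
    then obtain x where x: "x \<in> X" using ex by blast
    have "r \<odot>\<^bsub>M\<^esub> x \<in> A +>\<^bsub>M\<^esub> (r \<odot>\<^bsub>M\<^esub> x)" using r mem[OF X x] by (intro self) auto
    then have "r \<odot>\<^bsub>M\<^esub> x \<in> r \<odot>\<^bsub>?Q\<^esub> X" using x by (auto simp: quotient_module_def)
    then have "F (r \<odot>\<^bsub>?Q\<^esub> X) = g (r \<odot>\<^bsub>M\<^esub> x)" using X r by (intro F) auto
    then show "F (r \<odot>\<^bsub>?Q\<^esub> X) = r \<odot>\<^bsub>M\<lparr>carrier := g ` carrier M\<rparr>\<^esub> F X"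
      using F[OF X x] mem[OF X x] g r by (simp add: endo_smult)
  qed
  moreover have "bij_betw F (carrier ?Q) (g ` carrier M)"
    unfolding bij_betw_def
  proof
    show "inj_on F (carrier ?Q)"
    proof (rule inj_onI)
      fix X Y assume XY: "X \<in> carrier ?Q" "Y \<in> carrier ?Q" "F X = F Y"
      obtain x where x: "x \<in> carrier M" "X = A +>\<^bsub>M\<^esub> x" using XY(1)[unfolded carr] by blast
      obtain y where y: "y \<in> carrier M" "Y = A +>\<^bsub>M\<^esub> y" using XY(2)[unfolded carr] by blast
      have "g x = g y" using XY(3) F[OF XY(1)] F[OF XY(2)] self[OF x(1)] self[OF y(1)] x(2) y(2) by simp
      then have "x \<ominus>\<^bsub>M\<^esub> y \<in> A" unfolding A_def using x y g by (simp add: endo_minus)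
      moreover have "x = (x \<ominus>\<^bsub>M\<^esub> y) \<oplus>\<^bsub>M\<^esub> y" using x y by simp
      ultimately have "x \<in> A +>\<^bsub>M\<^esub> y" unfolding coset by blast
      then show "X = Y" unfolding x(2) y(2)
        using M.a_repr_independence[OF _ y(1) submodule.axioms(1)[OF A]] by simp
    qed
    show "F ` carrier ?Q = g ` carrier M"
    proof (intro equalityI subsetI)
      fix z assume "z \<in> F ` carrier ?Q"
      then obtain X x where "X \<in> carrier ?Q" "x \<in> X" "z = F X" using ex by blast
      then show "z \<in> g ` carrier M" using F mem by simp
    next
      fix z assume "z \<in> g ` carrier M"
      then obtain x where x: "x \<in> carrier M" "z = g x" by auto
      have X: "A +>\<^bsub>M\<^esub> x \<in> carrier ?Q" using carr x(1) by blast
      then show "z \<in> F ` carrier ?Q" using F[OF X self[OF x(1)]] x(2) by force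
    qed
  qed
  ultimately have "lmodule_isomorphic R ?Q (M\<lparr>carrier := g ` carrier M\<rparr>)"
    unfolding lmodule_isomorphic_def by auto
  then show ?thesis using D2 A K unfolding cond_D2_def A_def by blast
qed

text \<open>A complement \<open>Y\<close> of \<open>A\<close> satisfies \<open>S + Y = M\<close>,
  and smallness of \<open>S\<close> forces \<open>Y = M\<close>.\<close>

lemma small_summand_zero:
  assumes "small_in R M S" "summand A" "A \<subseteq> S"
  shows "A = {\<zero>\<^bsub>M\<^esub>}"
proof -
  obtain Y where Y: "dsum A Y" using assms(2) by (auto simp: direct_summand_def)
  note Y = dsumD[OF Y]
  have S: "sub S" and small: "\<And>K. \<lbrakk>sub K; S <+>\<^bsub>M\<^esub> K = carrier M\<rbrakk> \<Longrightarrow> K = carrier M"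
    using assms(1) by (auto simp: small_in_def)
  have "S <+>\<^bsub>M\<^esub> Y = carrier M"
    using plus_mono[OF assms(3), of Y Y] Y(3) subD(1)[OF sub_plus[OF S Y(2)]] by simp
  then have "Y = carrier M" by (rule small[OF Y(2)])
  then show ?thesis using Y(4) subD(1)[OF Y(1)] by blast
qed

text \<open>Put \<open>t = 1 - h\<close>. From \<open>M = S + t M\<close> smallness gives
  surjectivity. Then \<open>D2\<close> makes the kernel a summand, and it lies in \<open>S\<close>
  because \<open>t x = 0\<close> means \<open>x = h x\<close>; a summand inside a small submodule is
  zero.\<close>

lemma D2_minus_small_bij:
  assumes D2: "cond_D2 R M" and h: "h \<in> endo" and S: "small_in R M S" and hS: "\<And>x. x \<in> carrier M \<Longrightarrow> h x \<in> S"
  shows "bij_betw (\<lambda>x. x \<ominus>\<^bsub>M\<^esub> h x) (carrier M) (carrier M)"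
proof -
  define t where "t x = x \<ominus>\<^bsub>M\<^esub> h x" for x
  have t: "t \<in> endo" unfolding t_def by (rule endo_diff[OF endo_id h])
  have sS: "sub S" and small: "\<And>K. \<lbrakk>sub K; S <+>\<^bsub>M\<^esub> K = carrier M\<rbrakk> \<Longrightarrow> K = carrier M"
    using S by (auto simp: small_in_def)
  have st: "sub (t ` carrier M)" by (rule sub_image[OF t sub_carrier])
  have "x \<in> S <+>\<^bsub>M\<^esub> t ` carrier M" if "x \<in> carrier M" for x
  proof -
    have "x = h x \<oplus>\<^bsub>M\<^esub> t x" unfolding t_def using that h by simp
    then show ?thesis using set_addI[OF hS[OF that] imageI[OF that, of t], of M] by simp
  qed
  then have "S <+>\<^bsub>M\<^esub> t ` carrier M = carrier M" using subD(1)[OF sub_plus[OF sS st]] by blast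
  then have img: "t ` carrier M = carrier M" by (rule small[OF st])
  have "summand {x \<in> carrier M. t x = \<zero>\<^bsub>M\<^esub>}" using img by (intro D2_ker_summand[OF D2 t]) simp
  moreover have "{x \<in> carrier M. t x = \<zero>\<^bsub>M\<^esub>} \<subseteq> S"
  proof
    fix x assume "x \<in> {x \<in> carrier M. t x = \<zero>\<^bsub>M\<^esub>}"
    then have "x \<in> carrier M" "x = h x" using h by (auto simp: t_def diff_solve(1))
    then show "x \<in> S" using hS by metis
  qed
  ultimately have ker: "{x \<in> carrier M. t x = \<zero>\<^bsub>M\<^esub>} = {\<zero>\<^bsub>M\<^esub>}" by (rule small_summand_zero[OF S])
  have "inj_on t (carrier M)"
  proof (rule inj_onI)
    fix x y assume xy: "x \<in> carrier M" "y \<in> carrier M" "t x = t y"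
    then have "t (x \<ominus>\<^bsub>M\<^esub> y) = \<zero>\<^bsub>M\<^esub>" using t by (simp add: endo_minus)
    then have "x \<ominus>\<^bsub>M\<^esub> y \<in> {\<zero>\<^bsub>M\<^esub>}" unfolding ker[symmetric] using xy by simp
    then show "x = y" using xy by (simp add: diff_solve(1))
  qed
  then have "bij_betw t (carrier M) (carrier M)" using img by (simp add: bij_betw_def)
  then show ?thesis by (simp add: t_def[abs_def])
qed

text \<open>\<open>D1\<close> reduces the claim to the vanishing of the small part of the union
  inside \<open>M2\<close>. That part is not known to be a summand, so smallness alone does not
  suffice. Each of its elements \<open>s\<close>, however, lies in a member \<open>W\<close> of the
  chain; with \<open>e\<close> a projection onto \<open>W\<close> and \<open>p\<close> the
  projection onto \<open>M2\<close>, the map \<open>p e\<close> fixes \<open>s\<close> and has small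
  image. Then \<open>1 - p e\<close> is injective and kills \<open>s\<close>.\<close>

lemma discrete_chain_summand:
  assumes D1: "cond_D1 R M" and D2: "cond_D2 R M" and C: "C \<noteq> {}" "subset.chain {A. summand A} C"
  shows "summand (\<Union>C)"
proof -
  have sD: "sub (\<Union>C)" using C summand_sub by (intro sub_Union_chain) (auto simp: subset_chain_def)
  obtain M1 M2 where M12: "dsum M1 M2" "M1 \<subseteq> \<Union>C" and small: "small_in R M (\<Union>C \<inter> M2)"
    using D1 sD unfolding cond_D1_def by meson
  obtain p where p: "p \<in> endo" "\<And>x. x \<in> carrier M \<Longrightarrow> p x \<in> M2" "\<And>x. x \<in> M2 \<Longrightarrow> p x = x"
    "\<And>x. x \<in> carrier M \<Longrightarrow> p x = \<zero>\<^bsub>M\<^esub> \<longleftrightarrow> x \<in> M1" "\<And>x. x \<in> carrier M \<Longrightarrow> x \<ominus>\<^bsub>M\<^esub> p x \<in> M1"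
    by (rule dsum_proj[OF dsum_sym[OF M12(1)]]) (rule that)
  have pD: "p x \<in> \<Union>C \<inter> M2" if x: "x \<in> \<Union>C" for x
  proof -
    have xM: "x \<in> carrier M" using subD(7)[OF sD x] .
    have "x \<ominus>\<^bsub>M\<^esub> (x \<ominus>\<^bsub>M\<^esub> p x) \<in> \<Union>C"
      by (rule subD(6)[OF sD x subsetD[OF M12(2) p(5)[OF xM]]])
    then show ?thesis using p(1,2) xM by simp
  qed
  have zero: "s = \<zero>\<^bsub>M\<^esub>" if s: "s \<in> \<Union>C \<inter> M2" for s
  proof -
    obtain W where W: "W \<in> C" "s \<in> W" using s by auto
    then have sW: "summand W" using C(2) by (auto simp: subset_chain_def)
    obtain e where e: "e \<in> endo" "\<And>x. x \<in> carrier M \<Longrightarrow> e x \<in> W" "\<And>x. x \<in> W \<Longrightarrow> e x = x"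
      using summand_proj[OF sW] by blast
    have h: "(\<lambda>x. p (e x)) \<in> endo" by (rule endo_comp[OF p(1) e(1)])
    have sM: "s \<in> carrier M" using s subD(7)[OF sD] by auto
    have pe: "p (e x) \<in> \<Union>C \<inter> M2" if "x \<in> carrier M" for x using e(2)[OF that] W(1) by (intro pD UnionI)
    have "inj_on (\<lambda>x. x \<ominus>\<^bsub>M\<^esub> p (e x)) (carrier M)"
      using D2_minus_small_bij[OF D2 h small pe] bij_betw_imp_inj_on by blast
    moreover have "s \<ominus>\<^bsub>M\<^esub> p (e s) = \<zero>\<^bsub>M\<^esub> \<ominus>\<^bsub>M\<^esub> p (e \<zero>\<^bsub>M\<^esub>)" using e(3)[OF W(2)] p(1,3) s sM e(1) by simp
    ultimately show ?thesis using sM M.zero_closed by (rule inj_onD)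
  qed
  have "\<Union>C \<subseteq> M1"
  proof
    fix x assume x: "x \<in> \<Union>C"
    then show "x \<in> M1" using zero[OF pD[OF x]] p(4)[OF subD(7)[OF sD x]] by simp
  qed
  then have "\<Union>C = M1" using M12(2) by blast
  then show ?thesis using M12(1) by (auto simp: direct_summand_def)
qed

text \<open>By \<open>D1\<close> every proper submodule of \<open>Q\<close> is small, so the images
  of \<open>f\<close> and \<open>1 - f\<close>, which together span \<open>Q\<close>, are not both
  proper. By \<open>D2\<close> a surjective endomorphism of \<open>Q\<close> has a summand as its
  kernel, and indecomposability makes this kernel zero.\<close>

lemma discrete_indecomposable_local:
  assumes D1: "cond_D1 R M" and D2: "cond_D2 R M" and Q: "summand Q" "Q \<noteq> {\<zero>\<^bsub>M\<^esub>}"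
    and indec: "\<And>Z. \<lbrakk>summand Z; Z \<subseteq> Q\<rbrakk> \<Longrightarrow> Z = {\<zero>\<^bsub>M\<^esub>} \<or> Z = Q"
  shows "local_on Q"
  unfolding local_on_def
proof (intro ballI impI)
  fix f assume f: "f \<in> endo" "f ` Q \<subseteq> Q"
  note sQ = summand_sub[OF Q(1)]
  note QM = subD(7)[OF sQ]
  define t where "t x = x \<ominus>\<^bsub>M\<^esub> f x" for x
  have t: "t \<in> endo" unfolding t_def by (rule endo_diff[OF endo_id f(1)])
  have tQ: "t ` Q \<subseteq> Q" unfolding t_def using f(2) subD(6)[OF sQ] by auto
  obtain Y where QY: "dsum Q Y" using Q(1) by (auto simp: direct_summand_def)
  note Y = dsumD[OF QY]
  obtain q where q: "q \<in> endo" "\<And>x. x \<in> carrier M \<Longrightarrow> q x \<in> Q" "\<And>x. x \<in> Q \<Longrightarrow> q x = x"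
    using summand_proj[OF Q(1)] by blast
  have onto: "bij_betw g Q Q" if g: "g \<in> endo" "g ` Q = Q" for g
  proof -
    have gq: "(\<lambda>x. g (q x)) \<in> endo" by (rule endo_comp[OF g(1) q(1)])
    have "(\<lambda>x. g (q x)) ` carrier M = g ` q ` carrier M" by auto
    moreover have "q ` carrier M = Q" using q(2,3) QM by force
    ultimately have "summand ((\<lambda>x. g (q x)) ` carrier M)" using g(2) Q(1) by simp
    then have "summand {x \<in> carrier M. g (q x) = \<zero>\<^bsub>M\<^esub>}" by (rule D2_ker_summand[OF D2 gq])
    then obtain e where e: "e \<in> endo" "\<And>x. x \<in> carrier M \<Longrightarrow> e x \<in> {x \<in> carrier M. g (q x) = \<zero>\<^bsub>M\<^esub>}"
      "\<And>x. x \<in> {x \<in> carrier M. g (q x) = \<zero>\<^bsub>M\<^esub>} \<Longrightarrow> e x = x"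
      using summand_proj by blast
    define Z where "Z = {x \<in> Q. g x = \<zero>\<^bsub>M\<^esub>}"
    have "summand Z"
    \<comment> \<open>\<open>e\<close> projects onto the kernel of \<open>g q\<close>, and
      \<open>q\<close> carries that kernel onto the kernel \<open>Z\<close> of \<open>g\<close> on
      \<open>Q\<close>, as \<open>q\<close> is the identity on \<open>Q\<close>.\<close>
    proof (rule summandI[OF endo_comp[OF q(1) e(1)]])
      show "Z \<subseteq> carrier M" using QM by (auto simp: Z_def)
      show "q (e x) \<in> Z" if "x \<in> carrier M" for x
        using e(1) e(2)[OF that] q(2,3) that by (simp add: Z_def)
      show "q (e x) = x" if "x \<in> Z" for x
        using that e(3)[of x] q(3) QM by (simp add: Z_def)
    qed
    then have "Z = {\<zero>\<^bsub>M\<^esub>} \<or> Z = Q" by (rule indec) (auto simp: Z_def)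
    moreover have "Z \<noteq> Q"
    proof
      assume "Z = Q"
      then have "g x = \<zero>\<^bsub>M\<^esub>" if "x \<in> Q" for x using that by (auto simp: Z_def)
      then have "g ` Q \<subseteq> {\<zero>\<^bsub>M\<^esub>}" by blast
      then show False using g(2) Q(2) subD(2)[OF sQ] by blast
    qed
    ultimately have Z: "Z = {\<zero>\<^bsub>M\<^esub>}" by blast
    have "inj_on g Q"
    proof (rule inj_onI)
      fix x y assume xy: "x \<in> Q" "y \<in> Q" "g x = g y"
      then have "g (x \<ominus>\<^bsub>M\<^esub> y) = \<zero>\<^bsub>M\<^esub>" using g(1) QM by (simp add: endo_minus)
      then have "x \<ominus>\<^bsub>M\<^esub> y \<in> Z" unfolding Z_def using subD(6)[OF sQ] xy by simp
      then show "x = y" unfolding Z using xy QM by (simp add: diff_solve(1))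
    qed
    then show ?thesis using g(2) by (simp add: bij_betw_def)
  qed
  have hollow: "W = Q \<or> small_in R M W" if W: "sub W" "W \<subseteq> Q" for W
  proof -
    obtain M1 M2 where M12: "dsum M1 M2" "M1 \<subseteq> W" "small_in R M (W \<inter> M2)"
      using D1 W(1) unfolding cond_D1_def by meson
    have "summand M1" using M12(1) by (auto simp: direct_summand_def)
    then consider "M1 = {\<zero>\<^bsub>M\<^esub>}" | "M1 = Q" using indec M12(2) W(2) by blast
    then show ?thesis
    proof cases
      case 1
      then have "M2 = carrier M" using dsumD(2,3)[OF M12(1)] plus_zero(2) by simp
      then have "W \<inter> M2 = W" using subD(1)[OF W(1)] by blast
      then show ?thesis using M12(3) by simp
    next
      case 2 then show ?thesis using M12(2) W(2) by blast
    qed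
  qed
  have sf: "sub (f ` Q)" and st: "sub (t ` Q)" using f(1) t sQ sub_image by auto
  have "\<not> (small_in R M (f ` Q) \<and> small_in R M (t ` Q))"
  proof
    assume s: "small_in R M (f ` Q) \<and> small_in R M (t ` Q)"
    have "Q \<subseteq> f ` Q <+>\<^bsub>M\<^esub> t ` Q"
    proof
      fix x assume x: "x \<in> Q"
      then have "x = f x \<oplus>\<^bsub>M\<^esub> t x" unfolding t_def using f(1) QM by simp
      then show "x \<in> f ` Q <+>\<^bsub>M\<^esub> t ` Q" using set_addI[OF imageI[OF x, of f] imageI[OF x, of t], of M] by simp
    qed
    then have "carrier M \<subseteq> (f ` Q <+>\<^bsub>M\<^esub> t ` Q) <+>\<^bsub>M\<^esub> Y" unfolding Y(3)[symmetric] by (rule plus_mono) simp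
    then have "f ` Q <+>\<^bsub>M\<^esub> (t ` Q <+>\<^bsub>M\<^esub> Y) = carrier M"
      using subD(1) sf st Y(2) by (simp add: plus_assoc sub_plus equalityI)
    then have "t ` Q <+>\<^bsub>M\<^esub> Y = carrier M" using s sub_plus[OF st Y(2)] unfolding small_in_def by blast
    then have "Y = carrier M" using s Y(2) unfolding small_in_def by blast
    then show False using Y(4) Q(2) subD(1)[OF sQ] by blast
  qed
  then have "f ` Q = Q \<or> t ` Q = Q" using hollow[OF sf f(2)] hollow[OF st tQ] by blast
  then show "bij_betw f Q Q \<or> bij_betw (\<lambda>x. x \<ominus>\<^bsub>M\<^esub> f x) Q Q"
    using onto[OF f(1)] onto[OF t] by (auto simp: t_def[abs_def])
qed

text \<open>Fix \<open>x \<noteq> 0\<close> in \<open>K\<close> and a summand \<open>W\<close> of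
  \<open>K\<close> maximal with \<open>x \<notin> W\<close>. Its complement \<open>Q\<close> in
  \<open>K\<close> is indecomposable: if \<open>Q\<close> were \<open>Z \<oplus> Z'\<close> with
  both parts non-zero, then \<open>x\<close> would lie in \<open>W + Z\<close> and in
  \<open>W + Z'\<close>, which intersect in \<open>W\<close>.\<close>

lemma discrete_local_summand:
  assumes D1: "cond_D1 R M" and D2: "cond_D2 R M" and K: "summand K" "K \<noteq> {\<zero>\<^bsub>M\<^esub>}"
  shows "\<exists>Z \<subseteq> K. summand Z \<and> Z \<noteq> {\<zero>\<^bsub>M\<^esub>} \<and> local_on Z"
proof -
  note sK = summand_sub[OF K(1)]
  obtain x where x: "x \<in> K" "x \<noteq> \<zero>\<^bsub>M\<^esub>" using K(2) subD(2)[OF sK] by blast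
  let ?P = "{W. summand W \<and> W \<subseteq> K \<and> x \<notin> W}"
  have "\<exists>W\<in>?P. \<forall>V\<in>?P. W \<subseteq> V \<longrightarrow> V = W"
  proof (rule subset_Zorn_nonempty)
    have "{\<zero>\<^bsub>M\<^esub>} \<in> ?P" using x subD(2)[OF sK] by simp
    then show "?P \<noteq> {}" by blast
    fix C assume C: "C \<noteq> {}" "subset.chain ?P C"
    then have "subset.chain {A. summand A} C" by (auto simp: subset_chain_def)
    then have "summand (\<Union>C)" by (rule discrete_chain_summand[OF D1 D2 C(1)])
    then show "\<Union>C \<in> ?P" using C(2) by (auto simp: subset_chain_def)
  qed
  then obtain W where "W \<in> ?P" and "\<forall>V\<in>?P. W \<subseteq> V \<longrightarrow> V = W" ..
  then have W: "summand W" "W \<subseteq> K" "x \<notin> W"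
    and max: "\<And>V. \<lbrakk>summand V; V \<subseteq> K; x \<notin> V; W \<subseteq> V\<rbrakk> \<Longrightarrow> V = W" by simp_all
  note sW = summand_sub[OF W(1)]
  obtain Q where Q: "decomp K [W, Q]" using summand_within[OF W(1,2) sK] .
  obtain Y where Y: "decomp (carrier M) [Y, W, Q]" using decomp_summand[OF K(1) Q] by blast
  have sQ: "summand Q" using Y by (rule summand_decomp_mem) simp
  have QK: "Q \<subseteq> K" using Q plus_upper(2) unfolding decomp_pair by blast
  have Q0: "Q \<noteq> {\<zero>\<^bsub>M\<^esub>}"
  proof
    assume "Q = {\<zero>\<^bsub>M\<^esub>}"
    then have "K = W" using Q plus_zero(1)[OF sW] unfolding decomp_pair by simp
    then show False using x W(3) by simp
  qed
  have "Z = {\<zero>\<^bsub>M\<^esub>} \<or> Z = Q" if Z: "summand Z" "Z \<subseteq> Q" for Z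
  proof (rule ccontr)
    assume no: "\<not> (Z = {\<zero>\<^bsub>M\<^esub>} \<or> Z = Q)"
    obtain Z' where Z': "decomp Q [Z, Z']" using summand_within[OF Z summand_sub[OF sQ]] .
    have "Z' \<noteq> {\<zero>\<^bsub>M\<^esub>}"
    proof
      assume "Z' = {\<zero>\<^bsub>M\<^esub>}"
      then show False using Z' no plus_zero(1)[OF summand_sub[OF Z(1)]] unfolding decomp_pair by simp
    qed
    have "decomp K [Q, W]" using Q by (rule decomp_perm) simp
    then have ZZ'W: "decomp K ([Z, Z'] @ [W])" using decomp_refine[OF Z'] by blast
    have bigger: "\<exists>S. decomp S [W, A] \<and> x \<in> S" if d: "decomp K ([W, A] @ [B])" and A: "A \<noteq> {\<zero>\<^bsub>M\<^esub>}" for A B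
    proof -
      obtain S where S: "decomp S [W, A]" "decomp K [S, B]" using decomp_merge[OF d] .
      obtain Y where "decomp (carrier M) [Y, S, B]" using decomp_summand[OF K(1) S(2)] by blast
      then have "summand S" by (rule summand_decomp_mem) simp
      moreover have "S \<subseteq> K" using S(2) plus_upper(1) unfolding decomp_pair by blast
      moreover have "W \<subseteq> S" using S(1) plus_upper(1) unfolding decomp_pair by blast
      moreover have "S \<noteq> W"
      proof
        assume "S = W"
        moreover have "A \<subseteq> S" "W \<inter> A = {\<zero>\<^bsub>M\<^esub>}" using S(1) plus_upper(2) unfolding decomp_pair by blast+
        ultimately show False using A by blast
      qed
      ultimately have "x \<in> S" using max by blast
      then show ?thesis using S(1) by blast
    qed
    have "decomp K ([W, Z] @ [Z'])" "decomp K ([W, Z'] @ [Z])"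
      by (rule decomp_perm[OF ZZ'W]; simp)+
    then obtain S S' where S: "decomp S [W, Z]" "x \<in> S" and S': "decomp S' [W, Z']" "x \<in> S'"
      using bigger[of Z Z'] bigger[of Z' Z] no \<open>Z' \<noteq> {\<zero>\<^bsub>M\<^esub>}\<close> by blast
    obtain w z where wz: "w \<in> W" "z \<in> Z" "x = w \<oplus>\<^bsub>M\<^esub> z"
      using S unfolding decomp_pair by (auto simp: set_add_iff)
    obtain w' z' where wz': "w' \<in> W" "z' \<in> Z'" "x = w' \<oplus>\<^bsub>M\<^esub> z'"
      using S' unfolding decomp_pair by (auto simp: set_add_iff)
    have ZZ': "Z \<inter> Z' = {\<zero>\<^bsub>M\<^esub>}" "Z' \<subseteq> Q" using Z' plus_upper(2) unfolding decomp_pair by blast+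
    have "z = z'"
      using decomp_pair_eq(2)[OF Q wz(1) _ wz'(1)] wz wz' Z(2) ZZ'(2) by (metis subsetD)
    then have "z = \<zero>\<^bsub>M\<^esub>" using ZZ' wz wz' by blast
    then show False using wz W(3) subD(7)[OF sW] by simp
  qed
  then have "local_on Q" by (rule discrete_indecomposable_local[OF D1 D2 sQ Q0])
  then show ?thesis using QK sQ Q0 by blast
qed

lemma discrete_chain_local:
  assumes "discrete_module R M" shows "chain_local_module R M"
proof -
  have D: "cond_D1 R M" "cond_D2 R M" using assms by (auto simp: discrete_module_def)
  show ?thesis
    by (intro chain_local_module.intro chain_local_module_axioms.intro left_module_axioms
        discrete_chain_summand[OF D] discrete_local_summand[OF D])
qed

end

section \<open>Harada modules\<close>

context left_module
begin

section \<open>Sums over families of submodules\<close>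

lemma finsum_in_sub:
  assumes "sub A" "finite F" "\<And>i. i \<in> F \<Longrightarrow> f i \<in> A"
  shows "(\<Oplus>\<^bsub>M\<^esub>i\<in>F. f i) \<in> A"
  using assms(2,3)
proof (induction F)
  case empty then show ?case using subD(2)[OF assms(1)] by simp
next
  case (insert i F)
  have "f \<in> F \<rightarrow> carrier M" "f i \<in> carrier M" using insert.prems subD(7)[OF assms(1)] by auto
  then show ?case using insert subD(3)[OF assms(1)] by (simp add: M.finsum_insert)
qed

lemma smult_finsum:
  assumes "r \<in> carrier R" "finite F" "f \<in> F \<rightarrow> carrier M"
  shows "r \<odot>\<^bsub>M\<^esub> (\<Oplus>\<^bsub>M\<^esub>i\<in>F. f i) = (\<Oplus>\<^bsub>M\<^esub>i\<in>F. r \<odot>\<^bsub>M\<^esub> f i)"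
  using assms(2,3)
proof (induction F)
  case empty then show ?case using assms(1) by (simp add: smult_r_null)
next
  case (insert i F)
  then have f: "f \<in> F \<rightarrow> carrier M" "f i \<in> carrier M" by auto
  then have "(\<lambda>i. r \<odot>\<^bsub>M\<^esub> f i) \<in> F \<rightarrow> carrier M" using assms(1) by auto
  then show ?case using insert f assms(1) by (simp add: M.finsum_insert smult_r_distr)
qed

lemma family_sum_least:
  assumes "sub A" "\<And>i. i \<in> J \<Longrightarrow> N i \<subseteq> A" shows "family_sum M N J \<subseteq> A"
proof
  fix x assume "x \<in> family_sum M N J"
  then obtain F f where "finite F" "F \<subseteq> J" "\<And>i. i \<in> F \<Longrightarrow> f i \<in> N i" "x = (\<Oplus>\<^bsub>M\<^esub>i\<in>F. f i)"
    by (auto simp: family_sum_def)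
  then show "x \<in> A" using assms by (auto intro!: finsum_in_sub)
qed

lemma family_sum_upper:
  assumes "sub (N i)" "i \<in> J" shows "N i \<subseteq> family_sum M N J"
proof
  fix x assume "x \<in> N i"
  moreover then have "x = (\<Oplus>\<^bsub>M\<^esub>k\<in>{i}. x)" using subD(7)[OF assms(1)] by simp
  ultimately show "x \<in> family_sum M N J"
    unfolding family_sum_def using assms(2)
    by (intro CollectI exI[of _ "{i}"] exI[of _ "\<lambda>_. x"]) auto
qed

lemma family_sum_sub:
  assumes N: "\<And>i. i \<in> J \<Longrightarrow> sub (N i)" shows "sub (family_sum M N J)"
proof (rule subI)
  show "family_sum M N J \<subseteq> carrier M"
    using subD(1)[OF N] by (intro family_sum_least) auto
  show "\<zero>\<^bsub>M\<^esub> \<in> family_sum M N J"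
    unfolding family_sum_def by (intro CollectI exI[of _ "{}"]) auto
  fix x y assume x: "x \<in> family_sum M N J" and y: "y \<in> family_sum M N J"
  obtain F f where F: "finite F" "F \<subseteq> J" "\<And>i. i \<in> F \<Longrightarrow> f i \<in> N i" "x = (\<Oplus>\<^bsub>M\<^esub>i\<in>F. f i)"
    using x by (auto simp: family_sum_def)
  obtain G g where G: "finite G" "G \<subseteq> J" "\<And>i. i \<in> G \<Longrightarrow> g i \<in> N i" "y = (\<Oplus>\<^bsub>M\<^esub>i\<in>G. g i)"
    using y by (auto simp: family_sum_def)
  let ?f = "\<lambda>i. if i \<in> F then f i else \<zero>\<^bsub>M\<^esub>" and ?g = "\<lambda>i. if i \<in> G then g i else \<zero>\<^bsub>M\<^esub>"
  have fN: "?f i \<in> N i" "?g i \<in> N i" if "i \<in> F \<union> G" for i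
    using F(2,3) G(2,3) subD(2)[OF N] that by auto
  have c: "?f \<in> F \<union> G \<rightarrow> carrier M" "?g \<in> F \<union> G \<rightarrow> carrier M"
    using fN N[THEN subD(7)] F(2) G(2) by blast+
  have "x = (\<Oplus>\<^bsub>M\<^esub>i\<in>F\<union>G. ?f i)" unfolding F(4)
    using F(1) G(1) c by (intro M.add.finprod_mono_neutral_cong_left) auto
  moreover have "y = (\<Oplus>\<^bsub>M\<^esub>i\<in>F\<union>G. ?g i)" unfolding G(4)
    using F(1) G(1) c by (intro M.add.finprod_mono_neutral_cong_left) auto
  ultimately have "x \<oplus>\<^bsub>M\<^esub> y = (\<Oplus>\<^bsub>M\<^esub>i\<in>F\<union>G. ?f i \<oplus>\<^bsub>M\<^esub> ?g i)"
    using M.finsum_addf[OF c] by simp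
  moreover have "?f i \<oplus>\<^bsub>M\<^esub> ?g i \<in> N i" if "i \<in> F \<union> G" for i
    using fN[OF that] subD(3)[OF N] that F(2) G(2) by blast
  ultimately show "x \<oplus>\<^bsub>M\<^esub> y \<in> family_sum M N J"
    unfolding family_sum_def using F(1,2) G(1,2)
    by (intro CollectI exI[of _ "F \<union> G"] exI[of _ "\<lambda>i. ?f i \<oplus>\<^bsub>M\<^esub> ?g i"]) (auto simp del: if_split_asm)
next
  fix r x assume r: "r \<in> carrier R" and "x \<in> family_sum M N J"
  then obtain F f where F: "finite F" "F \<subseteq> J" "\<And>i. i \<in> F \<Longrightarrow> f i \<in> N i" "x = (\<Oplus>\<^bsub>M\<^esub>i\<in>F. f i)"
    by (auto simp: family_sum_def)
  have "f \<in> F \<rightarrow> carrier M" using F N[THEN subD(7)] by blast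
  then have "r \<odot>\<^bsub>M\<^esub> x = (\<Oplus>\<^bsub>M\<^esub>i\<in>F. r \<odot>\<^bsub>M\<^esub> f i)" using F(1,4) r smult_finsum by simp
  moreover have "r \<odot>\<^bsub>M\<^esub> f i \<in> N i" if "i \<in> F" for i using F(2,3) that subD(4)[OF N r] by blast
  ultimately show "r \<odot>\<^bsub>M\<^esub> x \<in> family_sum M N J"
    unfolding family_sum_def using F(1,2) by (intro CollectI exI[of _ F] exI[of _ "\<lambda>i. r \<odot>\<^bsub>M\<^esub> f i"]) auto
qed

lemma family_sum_empty: "family_sum M N {} = {\<zero>\<^bsub>M\<^esub>}"
  unfolding family_sum_def by auto

lemma family_sum_mono: "J \<subseteq> J' \<Longrightarrow> family_sum M N J \<subseteq> family_sum M N J'"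
  unfolding family_sum_def by blast

lemma family_sum_finite:
  assumes "x \<in> family_sum M N J"
  obtains F where "finite F" "F \<subseteq> J" "x \<in> family_sum M N F"
  using assms unfolding family_sum_def by blast

lemma family_sum_Un:
  assumes "\<And>i. i \<in> J \<union> J' \<Longrightarrow> sub (N i)"
  shows "family_sum M N (J \<union> J') = family_sum M N J <+>\<^bsub>M\<^esub> family_sum M N J'"
proof
  have s: "sub (family_sum M N J)" "sub (family_sum M N J')" "sub (family_sum M N (J \<union> J'))"
    using assms by (auto intro!: family_sum_sub)
  show "family_sum M N J <+>\<^bsub>M\<^esub> family_sum M N J' \<subseteq> family_sum M N (J \<union> J')"
    using s(3) by (intro plus_least family_sum_mono) auto
  show "family_sum M N (J \<union> J') \<subseteq> family_sum M N J <+>\<^bsub>M\<^esub> family_sum M N J'"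
  proof (rule family_sum_least)
    fix i assume i: "i \<in> J \<union> J'"
    then have "N i \<subseteq> family_sum M N J \<or> N i \<subseteq> family_sum M N J'"
      using family_sum_upper[of N i] assms by blast
    then show "N i \<subseteq> family_sum M N J <+>\<^bsub>M\<^esub> family_sum M N J'" using plus_upper[OF s(1,2)] by blast
  qed (use s in blast)
qed

lemma family_sum_insert:
  assumes "\<And>i. i \<in> insert k J \<Longrightarrow> sub (N i)"
  shows "family_sum M N (insert k J) = N k <+>\<^bsub>M\<^esub> family_sum M N J"
proof -
  have "family_sum M N {k} = N k"
    using family_sum_least[of "N k" "{k}" N] family_sum_upper[of N k "{k}"] assms by auto
  then show ?thesis using family_sum_Un[of "{k}" J N] assms by auto
qed

text \<open>The restrictions of \<open>f\<close> and \<open>1 - f\<close> to \<open>Z\<close> add up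
  to the identity, so they cannot both lie in the ideal of non-units. If \<open>Z\<close> were zero,
  then zero would be a unit and could not lie in that ideal.\<close>

lemma local_ring_local_on:
  assumes Z: "sub Z" and "local_ring (End_ring R (M\<lparr>carrier := Z\<rparr>))"
  shows "Z \<noteq> {\<zero>\<^bsub>M\<^esub>}" "local_on Z"
proof -
  let ?Z = "M\<lparr>carrier := Z\<rparr>"
  let ?E = "End_ring R ?Z"
  interpret Z: left_module R ?Z by (rule submodule_is_left_module[OF Z])
  interpret E: ring ?E by (rule Z.End_ring_is_ring)
  interpret I: ideal "carrier ?E - Units ?E" ?E using assms(2) by (simp add: local_ring_def)
  note sZ = subD[OF Z]
  have one: "\<one>\<^bsub>?E\<^esub> \<in> Units ?E" by simp
  show "Z \<noteq> {\<zero>\<^bsub>M\<^esub>}"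
  proof
    assume "Z = {\<zero>\<^bsub>M\<^esub>}"
    then have "\<zero>\<^bsub>?E\<^esub> = \<one>\<^bsub>?E\<^esub>" by (auto simp: End_ring_def)
    then show False using one I.zero_closed by auto
  qed
  show "local_on Z"
    unfolding local_on_def
  proof (intro ballI impI)
    fix f assume f: "f \<in> endo" "f ` Z \<subseteq> Z"
    let ?t = "\<lambda>x. x \<ominus>\<^bsub>M\<^esub> f x"
    have t: "?t \<in> endo" by (rule endo_diff[OF endo_id f(1)])
    have tZ: "?t ` Z \<subseteq> Z" using f(2) sZ(6) by auto
    have res: "restrict g Z \<in> carrier ?E" if g: "g \<in> endo" "g ` Z \<subseteq> Z" for g

    proof -
      have gZ: "g x \<in> Z" if "x \<in> Z" for x using g(2) that by auto
      show ?thesis unfolding End_ring_def lmodule_hom_def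
        by (simp add: Pi_iff gZ sZ(3,4,7) endo_add[OF g(1)] endo_smult[OF g(1)])
    qed
    have unit: "bij_betw g Z Z" if g: "g \<in> endo" "g ` Z \<subseteq> Z" "restrict g Z \<in> Units ?E" for g
    proof -
      obtain k where k: "k \<in> carrier ?E" "k \<otimes>\<^bsub>?E\<^esub> restrict g Z = \<one>\<^bsub>?E\<^esub>" "restrict g Z \<otimes>\<^bsub>?E\<^esub> k = \<one>\<^bsub>?E\<^esub>"
        using g(3) unfolding Units_def by blast
      have kZ: "k x \<in> Z" if "x \<in> Z" for x using k(1) that unfolding End_ring_def lmodule_hom_def by auto
      have "k (g x) = x" if "x \<in> Z" for x
        using fun_cong[OF k(2), of x] that g(2) by (auto simp: End_ring_def compose_def)
      moreover have "g (k x) = x" if "x \<in> Z" for x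
        using fun_cong[OF k(3), of x] that kZ by (auto simp: End_ring_def compose_def)
      ultimately show ?thesis using g(2) kZ by (intro bij_betwI[of _ _ _ k]) auto
    qed
    have "restrict f Z \<oplus>\<^bsub>?E\<^esub> restrict ?t Z = \<one>\<^bsub>?E\<^esub>"
      using f(1) sZ(7) by (auto simp: End_ring_def fun_eq_iff restrict_def)
    then have "restrict f Z \<in> Units ?E \<or> restrict ?t Z \<in> Units ?E"
      using I.a_closed[of "restrict f Z" "restrict ?t Z"] one res[OF f] res[OF t tZ] by auto
    then show "bij_betw f Z Z \<or> bij_betw ?t Z Z" using unit[OF f] unit[OF t tZ] by blast
  qed
qed

text \<open>The geometric series for the inverse stops after \<open>1 + g\<close>.\<close>

lemma square_zero_minus_bij:
  assumes g: "g \<in> endo" and gg: "\<And>x. x \<in> carrier M \<Longrightarrow> g (g x) = \<zero>\<^bsub>M\<^esub>"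
  shows "bij_betw (\<lambda>x. x \<ominus>\<^bsub>M\<^esub> g x) (carrier M) (carrier M)"
  using g gg by (intro bij_betwI[of _ _ _ "\<lambda>x. x \<oplus>\<^bsub>M\<^esub> g x"]) (auto simp: endo_simps)

end

section \<open>Coordinates for a decomposition into local components\<close>

locale local_decomposition = left_module +
  fixes I :: "'i set" and N :: "'i \<Rightarrow> 'c set"
  assumes harada: "harada_decomposition R M I N"
begin

abbreviation part where "part J \<equiv> family_sum M N J"

lemma N_sub: "i \<in> I \<Longrightarrow> sub (N i)"
  and part_I: "part I = carrier M"
  and N_indep: "i \<in> I \<Longrightarrow> N i \<inter> part (I - {i}) = {\<zero>\<^bsub>M\<^esub>}"
  and complement: "summand K \<Longrightarrow> \<exists>J \<subseteq> I. dsum K (part J)"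
  using harada by (auto simp: harada_decomposition_def direct_decomposition_def complements_summands_def)

lemma N_local: "i \<in> I \<Longrightarrow> N i \<noteq> {\<zero>\<^bsub>M\<^esub>}" "i \<in> I \<Longrightarrow> local_on (N i)"
  using harada local_ring_local_on[OF N_sub] by (auto simp: harada_decomposition_def)

lemma part_sub: "J \<subseteq> I \<Longrightarrow> sub (part J)"
  using N_sub by (intro family_sum_sub) auto

lemma N_part: "\<lbrakk>i \<in> J; i \<in> I\<rbrakk> \<Longrightarrow> N i \<subseteq> part J"
  using family_sum_upper[of N i] N_sub by blast

lemma dsum_N:
  assumes i: "i \<in> I" shows "dsum (N i) (part (I - {i}))"
proof -
  have "part (insert i (I - {i})) = N i <+>\<^bsub>M\<^esub> part (I - {i})"
    using N_sub i by (intro family_sum_insert) auto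
  then show ?thesis unfolding direct_sum_def using N_sub[OF i] part_sub[of "I - {i}"] N_indep[OF i] part_I i
    by (simp add: insert_absorb)
qed

definition coord where "coord i = (SOME p. p \<in> endo \<and> (\<forall>x \<in> carrier M. p x \<in> N i) \<and> (\<forall>x \<in> N i. p x = x) \<and>
  (\<forall>x \<in> part (I - {i}). p x = \<zero>\<^bsub>M\<^esub>))"

lemma coord:
  assumes i: "i \<in> I"
  shows "coord i \<in> endo" "\<And>x. x \<in> carrier M \<Longrightarrow> coord i x \<in> N i" "\<And>x. x \<in> N i \<Longrightarrow> coord i x = x"
    "\<And>x. x \<in> part (I - {i}) \<Longrightarrow> coord i x = \<zero>\<^bsub>M\<^esub>"
proof -
  let ?P = "\<lambda>p. p \<in> endo \<and> (\<forall>x \<in> carrier M. p x \<in> N i) \<and> (\<forall>x \<in> N i. p x = x) \<and> (\<forall>x \<in> part (I - {i}). p x = \<zero>\<^bsub>M\<^esub>)"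
  obtain p where p: "p \<in> endo" "\<And>x. x \<in> carrier M \<Longrightarrow> p x \<in> N i" "\<And>x. x \<in> N i \<Longrightarrow> p x = x"
    "\<And>x. x \<in> carrier M \<Longrightarrow> p x = \<zero>\<^bsub>M\<^esub> \<longleftrightarrow> x \<in> part (I - {i})" "\<And>x. x \<in> carrier M \<Longrightarrow> x \<ominus>\<^bsub>M\<^esub> p x \<in> part (I - {i})"
    by (rule dsum_proj[OF dsum_N[OF i]]) (rule that)
  have "p x = \<zero>\<^bsub>M\<^esub>" if "x \<in> part (I - {i})" for x
    using p(4)[of x] subD(7)[OF part_sub[of "I - {i}"] that] that by simp
  then have "?P p" using p(1-3) by simp
  then have "?P (SOME p. ?P p)" by (rule someI[of ?P])
  then have "?P (coord i)" unfolding coord_def .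
  then show "coord i \<in> endo" "\<And>x. x \<in> carrier M \<Longrightarrow> coord i x \<in> N i" "\<And>x. x \<in> N i \<Longrightarrow> coord i x = x"
    "\<And>x. x \<in> part (I - {i}) \<Longrightarrow> coord i x = \<zero>\<^bsub>M\<^esub>" by simp_all
qed

lemma coord_part: "\<lbrakk>i \<in> I; J \<subseteq> I; i \<notin> J; x \<in> part J\<rbrakk> \<Longrightarrow> coord i x = \<zero>\<^bsub>M\<^esub>"
  using coord(4)[of i x] family_sum_mono[of J "I - {i}" N] by blast

lemma coord_other: "\<lbrakk>i \<in> I; j \<in> I; i \<noteq> j; x \<in> N j\<rbrakk> \<Longrightarrow> coord i x = \<zero>\<^bsub>M\<^esub>"
  using coord_part[of i "{j}" x] N_part[of j "{j}"] by blast

lemma coord_finite: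
  assumes "x \<in> carrier M" shows "finite {i \<in> I. coord i x \<noteq> \<zero>\<^bsub>M\<^esub>}"
proof -
  obtain F where F: "finite F" "F \<subseteq> I" "x \<in> part F" using assms part_I family_sum_finite by metis
  then have "{i \<in> I. coord i x \<noteq> \<zero>\<^bsub>M\<^esub>} \<subseteq> F" using coord_part[OF _ F(2) _ F(3)] by blast
  then show ?thesis using F(1) finite_subset by blast
qed

text \<open>An element is the sum of its finitely many non-zero coordinates. With \<open>A\<close>
  the zero submodule, this shows that disjoint sets of components are independent.\<close>

lemma part_coord_induct:
  assumes "J \<subseteq> I" "x \<in> part J" and A: "sub A" and c: "\<And>i. i \<in> J \<Longrightarrow> coord i x \<in> A"
  shows "x \<in> A"
proof -
  obtain F where F: "finite F" "F \<subseteq> J" "x \<in> part F" using assms(2) family_sum_finite by metis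
  have "\<lbrakk>x \<in> part F; \<And>i. i \<in> F \<Longrightarrow> coord i x \<in> A\<rbrakk> \<Longrightarrow> x \<in> A" for x
    using F(1) subset_trans[OF F(2) assms(1)]
  proof (induction F arbitrary: x)
    case empty then show ?case using subD(2)[OF A] by (simp add: family_sum_empty)
  next
    case (insert k F)
    have "part (insert k F) = N k <+>\<^bsub>M\<^esub> part F" using N_sub insert.prems by (intro family_sum_insert) auto
    then obtain a y where ay: "a \<in> N k" "y \<in> part F" "x = a \<oplus>\<^bsub>M\<^esub> y" using insert.prems(1) by (auto simp: set_add_iff)
    have k: "k \<in> I" and FI: "F \<subseteq> I" using insert.prems by auto
    have m: "a \<in> carrier M" "y \<in> carrier M" using ay subD(7)[OF N_sub[OF k]] subD(7)[OF part_sub[OF FI]] by auto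
    have "coord k x = a"
      using ay m coord(1,3)[OF k] coord_part[OF k FI insert.hyps(2)] by (simp add: endo_add)
    then have "a \<in> A" using insert.prems(2)[of k] by simp
    moreover have "y \<in> A"
    proof (rule insert.IH[OF ay(2) _ FI])
      fix i assume i: "i \<in> F"
      then have iI: "i \<in> I" "i \<noteq> k" using FI insert.hyps(2) by auto
      have "coord i x = coord i y"
        using ay m coord(1)[OF iI(1)] coord_other[OF iI(1) k iI(2) ay(1)] by (simp add: endo_add)
      then show "coord i y \<in> A" using insert.prems(2)[of i] i by simp
    qed
    ultimately show ?case using ay(3) subD(3)[OF A] by simp
  qed
  then show ?thesis using F(2,3) c by blast
qed

lemma dsum_part:
  assumes J: "J \<subseteq> I" shows "dsum (part J) (part (I - J))"
proof -
  note s = part_sub[OF J] part_sub[of "I - J"]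
  have "x = \<zero>\<^bsub>M\<^esub>" if "x \<in> part J" "x \<in> part (I - J)" for x
  proof -
    have "x \<in> {\<zero>\<^bsub>M\<^esub>}"
    proof (rule part_coord_induct[OF J that(1) sub_zero])
      fix i assume "i \<in> J" then show "coord i x \<in> {\<zero>\<^bsub>M\<^esub>}" using coord_part[of i "I - J" x] J that(2) by auto
    qed
    then show ?thesis by simp
  qed
  then have "part J \<inter> part (I - J) = {\<zero>\<^bsub>M\<^esub>}" using subD(2)[OF s(1)] subD(2)[OF s(2)] by blast
  moreover have "part (J \<union> (I - J)) = part J <+>\<^bsub>M\<^esub> part (I - J)" using N_sub J by (intro family_sum_Un) auto
  then have "part J <+>\<^bsub>M\<^esub> part (I - J) = carrier M" using part_I J by (simp add: Un_absorb1)
  ultimately show ?thesis using s by (simp add: direct_sum_def)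
qed

lemma endo_eqI:
  assumes "f \<in> endo" "g \<in> endo" "\<And>i x. \<lbrakk>i \<in> I; x \<in> N i\<rbrakk> \<Longrightarrow> f x = g x" "x \<in> carrier M"
  shows "f x = g x"
proof -
  let ?E = "{x \<in> carrier M. f x \<ominus>\<^bsub>M\<^esub> g x = \<zero>\<^bsub>M\<^esub>}"
  have "part I \<subseteq> ?E"
  proof (rule family_sum_least)
    show "sub ?E" by (rule sub_ker[OF endo_diff[OF assms(1,2)]])
    show "N i \<subseteq> ?E" if "i \<in> I" for i using assms(1-3) that subD(7)[OF N_sub[OF that]] by auto
  qed
  then show ?thesis using assms by (auto simp: part_I diff_solve(1))
qed

text \<open>Universal property of the direct sum. Supports are finite, and the sum may be taken over
  any finite set of indices containing the support, so additivity is checked over the union of two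
  supports.\<close>

lemma endo_extend:
  assumes g: "\<And>i. i \<in> I \<Longrightarrow> g i \<in> endo"
  obtains h where "h \<in> endo" "\<And>i x. \<lbrakk>i \<in> I; x \<in> N i\<rbrakk> \<Longrightarrow> h x = g i x"
proof -
  define h where "h x = (\<Oplus>\<^bsub>M\<^esub>i\<in>{i \<in> I. coord i x \<noteq> \<zero>\<^bsub>M\<^esub>}. g i (coord i x))" for x
  have cM: "coord i x \<in> carrier M" "g i (coord i x) \<in> carrier M" if "i \<in> I" "x \<in> carrier M" for i x
    using that g coord(1) by auto
  have h: "h x = (\<Oplus>\<^bsub>M\<^esub>i\<in>F. g i (coord i x))"
    if x: "x \<in> carrier M" and F: "finite F" "{i \<in> I. coord i x \<noteq> \<zero>\<^bsub>M\<^esub>} \<subseteq> F" "F \<subseteq> I" for x F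
    unfolding h_def
  proof (rule M.add.finprod_mono_neutral_cong_left[OF F(1,2)])
    show "g i (coord i x) = \<zero>\<^bsub>M\<^esub>" if "i \<in> F - {i \<in> I. coord i x \<noteq> \<zero>\<^bsub>M\<^esub>}" for i
      using that F(3) g by auto
    show "(\<lambda>i. g i (coord i x)) \<in> F \<rightarrow> carrier M" using F(3) cM x by auto
  qed simp
  show thesis
  proof
    show "h \<in> endo"
    proof (rule endoI)
      show "h x \<in> carrier M" if "x \<in> carrier M" for x
        unfolding h_def using cM that by (intro M.finsum_closed) auto
      fix x y assume x: "x \<in> carrier M" and y: "y \<in> carrier M"
      let ?F = "{i \<in> I. coord i x \<noteq> \<zero>\<^bsub>M\<^esub>} \<union> {i \<in> I. coord i y \<noteq> \<zero>\<^bsub>M\<^esub>}"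
      have F: "finite ?F" "?F \<subseteq> I" using coord_finite x y by auto
      have "{i \<in> I. coord i (x \<oplus>\<^bsub>M\<^esub> y) \<noteq> \<zero>\<^bsub>M\<^esub>} \<subseteq> ?F" using x y coord(1) by (auto simp: endo_add)
      then have "h (x \<oplus>\<^bsub>M\<^esub> y) = (\<Oplus>\<^bsub>M\<^esub>i\<in>?F. g i (coord i (x \<oplus>\<^bsub>M\<^esub> y)))" using x y F by (intro h) auto
      also have "\<dots> = (\<Oplus>\<^bsub>M\<^esub>i\<in>?F. g i (coord i x) \<oplus>\<^bsub>M\<^esub> g i (coord i y))"
        using x y F(2) g coord(1) by (intro M.finsum_cong') (auto simp: endo_add)
      also have "\<dots> = h x \<oplus>\<^bsub>M\<^esub> h y"
        using x y F cM h[OF x F(1) _ F(2)] h[OF y F(1) _ F(2)] by (subst M.finsum_addf) auto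
      finally show "h (x \<oplus>\<^bsub>M\<^esub> y) = h x \<oplus>\<^bsub>M\<^esub> h y" .
    next
      fix r x assume r: "r \<in> carrier R" and x: "x \<in> carrier M"
      let ?F = "{i \<in> I. coord i x \<noteq> \<zero>\<^bsub>M\<^esub>}"
      have F: "finite ?F" "?F \<subseteq> I" using coord_finite x by auto
      have "{i \<in> I. coord i (r \<odot>\<^bsub>M\<^esub> x) \<noteq> \<zero>\<^bsub>M\<^esub>} \<subseteq> ?F" using x r coord(1) by (auto simp: endo_smult smult_r_null)
      then have "h (r \<odot>\<^bsub>M\<^esub> x) = (\<Oplus>\<^bsub>M\<^esub>i\<in>?F. g i (coord i (r \<odot>\<^bsub>M\<^esub> x)))" using x r F by (intro h) auto
      also have "\<dots> = (\<Oplus>\<^bsub>M\<^esub>i\<in>?F. r \<odot>\<^bsub>M\<^esub> g i (coord i x))"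
        using x r F(2) g coord(1) by (intro M.finsum_cong') (auto simp: endo_smult)
      also have "\<dots> = r \<odot>\<^bsub>M\<^esub> h x" unfolding h_def
        using x r F cM by (intro smult_finsum[symmetric]) auto
      finally show "h (r \<odot>\<^bsub>M\<^esub> x) = r \<odot>\<^bsub>M\<^esub> h x" .
    qed
    fix i x assume i: "i \<in> I" and x: "x \<in> N i"
    have xM: "x \<in> carrier M" using subD(7)[OF N_sub[OF i] x] .
    have "{j \<in> I. coord j x \<noteq> \<zero>\<^bsub>M\<^esub>} \<subseteq> {i}" using coord_other[OF _ i _ x] by blast
    then have "h x = (\<Oplus>\<^bsub>M\<^esub>j\<in>{i}. g j (coord j x))" using i by (intro h xM) auto
    then show "h x = g i x" using coord(3)[OF i x] g[OF i] xM by simp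
  qed
qed

text \<open>Semi-T-nilpotency of the family of components. Splitting the indices of the sequence by parity
  makes the two halves \<^verbatim>\<open>g\<close>, \<^verbatim>\<open>h\<close> of \<^verbatim>\<open>\<phi>\<close> square-zero, so \<^verbatim>\<open>1 - g\<close> and \<^verbatim>\<open>1 - h\<close> are automorphisms;
  the image of the decomposition under \<^verbatim>\<open>1 - g\<close> still complements summands. Applied to
  the summand \<^verbatim>\<open>K\<close>, this forces \<^verbatim>\<open>1 - \<phi>\<close> to be surjective, and a preimage of \<^verbatim>\<open>x 0\<close> would have
  infinitely many non-zero coordinates \<^verbatim>\<open>x n\<close>.\<close>

lemma semi_T_nilpotent:
  fixes i :: "nat \<Rightarrow> 'i"
  assumes inj: "inj i" and iI: "\<And>n. i n \<in> I" and f: "\<And>n. f n \<in> endo" "\<And>n. f n ` N (i n) \<subseteq> N (i (Suc n))"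
    and nbij: "\<And>n. \<not> bij_betw (f n) (N (i n)) (N (i (Suc n)))"
    and x: "\<And>n. x n \<in> N (i n)" "\<And>n. f n (x n) = x (Suc n)"
  shows "\<exists>n. x n = \<zero>\<^bsub>M\<^esub>"
proof (rule ccontr)
  assume "\<not> ?thesis"
  then have x0: "x n \<noteq> \<zero>\<^bsub>M\<^esub>" for n by simp
  have ieq: "i m = i n \<longleftrightarrow> m = n" for m n using inj by (auto dest: injD)
  have NM: "y \<in> carrier M" if "j \<in> I" "y \<in> N j" for j y using subD(7)[OF N_sub[OF that(1)] that(2)] .
  have fN: "f n y \<in> N (i (Suc n))" if "y \<in> N (i n)" for n y using f(2)[of n] that by auto
  \<comment> \<open>\<open>\<phi>\<close> is the shift along the sequence: \<open>f n\<close> on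
    \<open>N (i n)\<close>, and zero on every other component.\<close>
  have "(if j \<in> range i then f (inv_into UNIV i j) else (\<lambda>x. \<zero>\<^bsub>M\<^esub>)) \<in> endo" for j using f(1) by simp
  then obtain \<phi> where \<phi>: "\<phi> \<in> endo"
    and \<phi>N: "\<And>j y. \<lbrakk>j \<in> I; y \<in> N j\<rbrakk> \<Longrightarrow> \<phi> y = (if j \<in> range i then f (inv_into UNIV i j) else (\<lambda>x. \<zero>\<^bsub>M\<^esub>)) y"
    using endo_extend[of "\<lambda>j. if j \<in> range i then f (inv_into UNIV i j) else (\<lambda>x. \<zero>\<^bsub>M\<^esub>)"] by blast
  have \<phi>i: "\<phi> y = f n y" if "y \<in> N (i n)" for n y using \<phi>N[OF iI that] inj by simp
  have \<phi>o: "\<phi> y = \<zero>\<^bsub>M\<^esub>" if "y \<in> N j" "j \<in> I" "j \<notin> range i" for j y using \<phi>N[OF that(2,1)] that(3) by simp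

  define Ev where "Ev = {i (2 * n) |n. True}"
  define Od where "Od = {i (Suc (2 * n)) |n. True}"
  have EO: "Ev \<subseteq> I" "Od \<subseteq> I" using iI by (auto simp: Ev_def Od_def)
  have disj: "j \<notin> Od" if "j \<in> Ev" for j
    using that unfolding Ev_def Od_def by (auto simp: ieq) presburger
  have parity: "i n \<in> Ev \<or> i n \<in> Od" for n
    unfolding Ev_def Od_def by (cases "even n") (auto elim!: evenE oddE)
  have proj: "\<exists>p. p \<in> endo \<and> (\<forall>y\<in>part J. p y = y) \<and> (\<forall>y\<in>part (I - J). p y = \<zero>\<^bsub>M\<^esub>)" if J: "J \<subseteq> I" for J
  proof -
    obtain p where p: "p \<in> endo" "\<And>x. x \<in> carrier M \<Longrightarrow> p x \<in> part J" "\<And>x. x \<in> part J \<Longrightarrow> p x = x"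
      "\<And>x. x \<in> carrier M \<Longrightarrow> p x = \<zero>\<^bsub>M\<^esub> \<longleftrightarrow> x \<in> part (I - J)" "\<And>x. x \<in> carrier M \<Longrightarrow> x \<ominus>\<^bsub>M\<^esub> p x \<in> part (I - J)"
      by (rule dsum_proj[OF dsum_part[OF J]]) (rule that)
    have "p y = \<zero>\<^bsub>M\<^esub>" if "y \<in> part (I - J)" for y
      using p(4)[of y] subD(7)[OF part_sub[of "I - J"] that] that by simp
    then show ?thesis using p(1,3) by blast
  qed
  obtain pE where pE: "pE \<in> endo" "\<And>y. y \<in> part Ev \<Longrightarrow> pE y = y" "\<And>y. y \<in> part (I - Ev) \<Longrightarrow> pE y = \<zero>\<^bsub>M\<^esub>"
    using proj[OF EO(1)] by blast
  obtain pO where pO: "pO \<in> endo" "\<And>y. y \<in> part Od \<Longrightarrow> pO y = y" "\<And>y. y \<in> part (I - Od) \<Longrightarrow> pO y = \<zero>\<^bsub>M\<^esub>"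
    using proj[OF EO(2)] by blast
  define g where "g y = \<phi> (pE y)" for y
  define h where "h y = \<phi> (pO y)" for y
  have g: "g \<in> endo" and h: "h \<in> endo" unfolding g_def h_def
    using endo_comp[OF \<phi> pE(1)] endo_comp[OF \<phi> pO(1)] by simp_all
  have g1: "g y = \<phi> y" if "y \<in> N j" "j \<in> Ev" for y j
    unfolding g_def using pE(2)[OF subsetD[OF N_part[OF that(2) subsetD[OF EO(1) that(2)]] that(1)]] by simp
  have g2: "g y = \<zero>\<^bsub>M\<^esub>" if "y \<in> N j" "j \<in> I" "j \<notin> Ev" for y j
    unfolding g_def using pE(3)[OF subsetD[OF N_part[of j "I - Ev"] that(1)]] that \<phi> by simp
  have h1: "h y = \<phi> y" if "y \<in> N j" "j \<in> Od" for y j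
    unfolding h_def using pO(2)[OF subsetD[OF N_part[OF that(2) subsetD[OF EO(2) that(2)]] that(1)]] by simp
  have h2: "h y = \<zero>\<^bsub>M\<^esub>" if "y \<in> N j" "j \<in> I" "j \<notin> Od" for y j
    unfolding h_def using pO(3)[OF subsetD[OF N_part[of j "I - Od"] that(1)]] that \<phi> by simp
  have gg: "g (g y) = \<zero>\<^bsub>M\<^esub>" if "y \<in> carrier M" for y
  proof (rule endo_eqI[OF endo_comp[OF g g] endo_const _ that])
    fix j y assume j: "j \<in> I" "y \<in> N j"
    show "g (g y) = \<zero>\<^bsub>M\<^esub>"
    proof (cases "j \<in> Ev")
      case True
      then obtain n where n: "j = i (2 * n)" by (auto simp: Ev_def)
      have "g y = f (2 * n) y" using g1[OF j(2) True] \<phi>i[of y "2 * n"] j(2) n by simp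
      then have "g y \<in> N (i (Suc (2 * n)))" using fN[of y "2 * n"] j(2) n by simp
      moreover have "i (Suc (2 * n)) \<notin> Ev" using disj by (auto simp: Od_def)
      ultimately show ?thesis using g2 iI by blast
    qed (use g2[OF j(2,1)] g in simp)
  qed
  have hh: "h (h y) = \<zero>\<^bsub>M\<^esub>" if "y \<in> carrier M" for y
  proof (rule endo_eqI[OF endo_comp[OF h h] endo_const _ that])
    fix j y assume j: "j \<in> I" "y \<in> N j"
    show "h (h y) = \<zero>\<^bsub>M\<^esub>"
    proof (cases "j \<in> Od")
      case True
      then obtain n where n: "j = i (Suc (2 * n))" by (auto simp: Od_def)
      have "h y = f (Suc (2 * n)) y" using h1[OF j(2) True] \<phi>i[of y "Suc (2 * n)"] j(2) n by simp
      then have "h y \<in> N (i (Suc (Suc (2 * n))))" using fN[of y "Suc (2 * n)"] j(2) n by simp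
      moreover have "i (Suc (Suc (2 * n))) \<in> Ev" unfolding Ev_def by (auto intro!: exI[of _ "Suc n"])
      then have "i (Suc (Suc (2 * n))) \<notin> Od" by (rule disj)
      ultimately show ?thesis using h2 iI by blast
    qed (use h2[OF j(2,1)] h in simp)
  qed
  define t where "t y = y \<ominus>\<^bsub>M\<^esub> g y" for y
  define s where "s y = y \<ominus>\<^bsub>M\<^esub> h y" for y
  have t: "t \<in> endo" and s: "s \<in> endo" unfolding t_def s_def
    by (rule endo_diff[OF endo_id g] endo_diff[OF endo_id h])+
  have tb: "bij_betw t (carrier M) (carrier M)" and sb: "bij_betw s (carrier M) (carrier M)"
    unfolding t_def[abs_def] s_def[abs_def]
    by (rule square_zero_minus_bij[OF g gg], assumption, rule square_zero_minus_bij[OF h hh], assumption)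
  obtain t' where t': "t' \<in> endo" "\<And>y. y \<in> carrier M \<Longrightarrow> t' (t y) = y" "\<And>y. y \<in> carrier M \<Longrightarrow> t (t' y) = y"
    using endo_inverse[OF t tb] by blast
  have tb': "bij_betw t' (carrier M) (carrier M)" using t t' by (intro bij_betwI[of _ _ _ t]) auto
  define K where "K = s ` part Od"
  have "summand (part Od)" using dsum_part[OF EO(2)] by (auto simp: direct_summand_def)
  then have K: "summand K" unfolding K_def by (rule summand_image[OF s sb])
  \<comment> \<open>Complements are available for the original components, so \<open>K\<close> is
    pulled back by the inverse \<open>t'\<close> of \<open>t\<close>, and the complement found there
    is carried forward again.\<close>
  obtain L where L: "L \<subseteq> I" "dsum (t' ` K) (part L)" using complement[OF summand_image[OF t'(1) tb' K]] by blast
  have "t ` t' ` K = K" using t'(3) subD(7)[OF summand_sub[OF K]] by (simp add: image_image)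
  then have KT: "dsum K (t ` part L)" using dsum_image[OF t tb L(2)] by simp

  \<comment> \<open>For odd \<open>n\<close> with \<open>i n \<in> L\<close> and
    \<open>y \<in> N (i n)\<close>, the element \<open>y = t y\<close> lies in
    \<open>t (part L)\<close> and \<open>y \<ominus> f n y = s y\<close> lies in \<open>K\<close>;
    so the projection \<open>e\<close> along \<open>K\<close> takes \<open>f n y\<close> back to
    \<open>y\<close>. Then \<open>c\<close> fixes the image of \<open>f n\<close> and takes values
    in it, and locality of \<open>N (i (Suc n))\<close> makes \<open>f n\<close> bijective or
    \<open>x (Suc n)\<close> zero.\<close>
  have LO: "L \<inter> Od = {}"
  proof (rule ccontr)
    assume "L \<inter> Od \<noteq> {}"
    then obtain m where m: "i (Suc (2 * m)) \<in> L" by (auto simp: Od_def)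
    define n where "n = Suc (2 * m)"
    have nO: "i n \<in> Od" by (auto simp: n_def Od_def)
    have nE: "i n \<notin> Ev" using disj nO by blast
    obtain e where e: "e \<in> endo" "\<And>y. y \<in> carrier M \<Longrightarrow> e y \<in> t ` part L" "\<And>y. y \<in> t ` part L \<Longrightarrow> e y = y"
      "\<And>y. y \<in> carrier M \<Longrightarrow> e y = \<zero>\<^bsub>M\<^esub> \<longleftrightarrow> y \<in> K" "\<And>y. y \<in> carrier M \<Longrightarrow> y \<ominus>\<^bsub>M\<^esub> e y \<in> K"
      by (rule dsum_proj[OF dsum_sym[OF KT]]) (rule that)
    define c where "c y = f n (coord (i n) (e y))" for y
    have c: "c \<in> endo" unfolding c_def by (rule endo_comp[OF f(1) endo_comp[OF coord(1)[OF iI] e(1)]])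
    have ef: "e (f n y) = y" if y: "y \<in> N (i n)" for y
    proof -
      have yM: "y \<in> carrier M" using NM[OF iI y] .
      have "t y = y" unfolding t_def using g2[OF y iI nE] yM by simp
      moreover have "y \<in> part L" using N_part[of "i n" L] m iI y by (auto simp: n_def)
      ultimately have "y \<in> t ` part L" by (metis imageI)
      then have ey: "e y = y" by (rule e(3))
      have "s y \<in> K" unfolding K_def using N_part[OF nO iI] y by auto
      moreover have "s y = y \<ominus>\<^bsub>M\<^esub> f n y" unfolding s_def using h1[OF y nO] \<phi>i[OF y] by simp
      ultimately have "e (y \<ominus>\<^bsub>M\<^esub> f n y) = \<zero>\<^bsub>M\<^esub>" using e(4)[of "y \<ominus>\<^bsub>M\<^esub> f n y"] yM f(1)[of n] by simp
      then have "y \<ominus>\<^bsub>M\<^esub> e (f n y) = \<zero>\<^bsub>M\<^esub>" using e(1) yM f(1)[of n] ey by (simp add: endo_minus)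
      then show ?thesis using e(1) yM f(1)[of n] by (simp add: diff_solve(1))
    qed
    have cf: "c (f n y) = f n y" if "y \<in> N (i n)" for y
      unfolding c_def ef[OF that] using coord(3)[OF iI that] by simp
    have cN: "c y \<in> N (i (Suc n))" if "y \<in> carrier M" for y
      unfolding c_def using coord(2)[OF iI] e(1) that by (intro fN) auto
    have "c ` N (i (Suc n)) \<subseteq> N (i (Suc n))" using cN NM[OF iI] by blast
    then consider "bij_betw c (N (i (Suc n))) (N (i (Suc n)))"
      | "bij_betw (\<lambda>y. y \<ominus>\<^bsub>M\<^esub> c y) (N (i (Suc n))) (N (i (Suc n)))"
      using N_local(2)[OF iI[of "Suc n"]] c unfolding local_on_def by blast
    then show False
    proof cases
      case 1
      have "inj_on (f n) (N (i n))" using ef by (metis inj_onI)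
      moreover have "N (i (Suc n)) \<subseteq> f n ` N (i n)"
      proof
        fix z assume "z \<in> N (i (Suc n))"
        then obtain y where "y \<in> N (i (Suc n))" "z = c y" using 1 by (auto simp: bij_betw_def)
        then show "z \<in> f n ` N (i n)" unfolding c_def using coord(2)[OF iI] e(1) NM[OF iI] by simp
      qed
      ultimately have "bij_betw (f n) (N (i n)) (N (i (Suc n)))" using f(2)[of n] by (simp add: bij_betw_def subset_antisym)
      then show False using nbij by blast
    next
      case 2
      have y: "x (Suc n) \<in> N (i (Suc n))" "\<zero>\<^bsub>M\<^esub> \<in> N (i (Suc n))" using x(1) subD(2)[OF N_sub[OF iI]] by auto
      have "c (x (Suc n)) = x (Suc n)" using cf[OF x(1)] x(2)[of n] by simp
      then have "x (Suc n) \<ominus>\<^bsub>M\<^esub> c (x (Suc n)) = \<zero>\<^bsub>M\<^esub> \<ominus>\<^bsub>M\<^esub> c \<zero>\<^bsub>M\<^esub>" using NM[OF iI y(1)] c by simp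
      then have "x (Suc n) = \<zero>\<^bsub>M\<^esub>" using bij_betw_imp_inj_on[OF 2] y by (meson inj_onD)
      then show False using x0 by blast
    qed
  qed

  have \<phi>gh: "\<phi> y = g y \<oplus>\<^bsub>M\<^esub> h y" if "y \<in> carrier M" for y
  proof (rule endo_eqI[OF \<phi> endo_plus[OF g h] _ that])
    fix j y assume j: "j \<in> I" "y \<in> N j"
    have c: "\<phi> y \<in> carrier M" using \<phi> NM[OF j] by simp
    consider "j \<in> Ev" "j \<notin> Od" | "j \<in> Od" "j \<notin> Ev" | "j \<notin> Ev" "j \<notin> Od" using disj by blast
    then show "\<phi> y = g y \<oplus>\<^bsub>M\<^esub> h y"
    proof cases
      case 3
      then have "j \<notin> range i" using parity by blast
      then show ?thesis using \<phi>o[OF j(2,1)] g2[OF j(2,1)] h2[OF j(2,1)] 3 by simp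
    qed (use g1[OF j(2)] g2[OF j(2,1)] h1[OF j(2)] h2[OF j(2,1)] c in simp_all)
  qed
  have x0M: "x 0 \<in> carrier M" using NM[OF iI x(1)] .
  have "x 0 \<in> K <+>\<^bsub>M\<^esub> t ` part L" using dsumD(3)[OF KT] x0M by simp
  then obtain w1 w2 where w: "w1 \<in> part Od" "w2 \<in> part L" "x 0 = s w1 \<oplus>\<^bsub>M\<^esub> t w2"
    by (auto simp: K_def set_add_iff)
  have wM: "w1 \<in> carrier M" "w2 \<in> carrier M"
    using w subD(7)[OF part_sub[OF EO(2)]] subD(7)[OF part_sub[OF L(1)]] by auto
  have "w1 \<in> part (I - Ev)" using w(1) family_sum_mono[of Od "I - Ev" N] EO(2) disj by blast
  then have "g w1 = \<zero>\<^bsub>M\<^esub>" unfolding g_def using pE(3) \<phi> by simp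
  then have s1: "s w1 = w1 \<ominus>\<^bsub>M\<^esub> \<phi> w1" unfolding s_def using \<phi>gh[OF wM(1)] h wM by simp
  have "w2 \<in> part (I - Od)" using w(2) family_sum_mono[of L "I - Od" N] L(1) LO by blast
  then have "h w2 = \<zero>\<^bsub>M\<^esub>" unfolding h_def using pO(3) \<phi> by simp
  then have t2: "t w2 = w2 \<ominus>\<^bsub>M\<^esub> \<phi> w2" unfolding t_def using \<phi>gh[OF wM(2)] g wM by simp
  define w where "w = w1 \<oplus>\<^bsub>M\<^esub> w2"
  have wc: "w \<in> carrier M" using wM by (simp add: w_def)
  have "x 0 = w \<ominus>\<^bsub>M\<^esub> \<phi> w"
    unfolding w(3) s1 t2 w_def using wM \<phi> by (simp add: endo_add diff_simps)
  then have wx: "w = x 0 \<oplus>\<^bsub>M\<^esub> \<phi> w" using wc \<phi> by simp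
  have coord0: "coord (i 0) (\<phi> y) = \<zero>\<^bsub>M\<^esub>" if "y \<in> carrier M" for y
  proof (rule endo_eqI[OF endo_comp[OF coord(1)[OF iI] \<phi>] endo_const _ that])
    fix j y assume j: "j \<in> I" "y \<in> N j"
    show "coord (i 0) (\<phi> y) = \<zero>\<^bsub>M\<^esub>"
    proof (cases "j \<in> range i")
      case True
      then obtain n where n: "j = i n" by auto
      have "\<phi> y \<in> N (i (Suc n))" using \<phi>i[of y n] fN[of y n] j n by simp
      then show ?thesis using coord_other[OF iI iI, of 0 "Suc n" "\<phi> y"] ieq by simp
    qed (use \<phi>o[OF j(2,1)] coord(1)[OF iI] in simp)
  qed
  have coordS: "coord (i (Suc n)) (\<phi> y) = f n (coord (i n) y)" if "y \<in> carrier M" for y n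
  proof (rule endo_eqI[OF endo_comp[OF coord(1)[OF iI] \<phi>] endo_comp[OF f(1) coord(1)[OF iI]] _ that])
    fix j y assume j: "j \<in> I" "y \<in> N j"
    show "coord (i (Suc n)) (\<phi> y) = f n (coord (i n) y)"
    proof (cases "j \<in> range i")
      case True
      then obtain m where m: "j = i m" by auto
      have \<phi>y: "\<phi> y \<in> N (i (Suc m))" "\<phi> y = f m y" using \<phi>i[of y m] fN[of y m] j m by simp_all
      show ?thesis
      proof (cases "m = n")
        case True
        then show ?thesis using \<phi>y coord(3)[OF iI, of "\<phi> y" "Suc n"] coord(3)[OF iI, of y n] j m by simp
      next
        case False
        then show ?thesis using coord_other[OF iI iI, of "Suc n" "Suc m" "\<phi> y"] \<phi>y(1) ieq
            coord_other[OF iI iI, of n m y] j(2) m f(1)[of n] by simp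
      qed
    next
      case False
      then have "i n \<noteq> j" by auto
      then show ?thesis using \<phi>o[OF j(2,1) False] coord_other[OF iI j(1) _ j(2)] coord(1)[OF iI] f(1)[of n] by simp
    qed
  qed
  \<comment> \<open>In \<open>w = x 0 \<oplus> \<phi> w\<close>, the coordinate at
    \<open>i 0\<close> comes from \<open>x 0\<close> alone, and each later one is the image of its
    predecessor under \<open>f n\<close>.\<close>
  have "coord (i n) w = x n" for n
  proof (induction n)
    case 0
    have "coord (i 0) w = coord (i 0) (x 0) \<oplus>\<^bsub>M\<^esub> coord (i 0) (\<phi> w)"
      by (subst wx) (use x0M wc \<phi> coord(1)[OF iI] in \<open>simp add: endo_add\<close>)
    then show ?case using coord0[OF wc] coord(3)[OF iI x(1)] x0M by simp
  next
    case (Suc n)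
    have "coord (i (Suc n)) w = coord (i (Suc n)) (x 0) \<oplus>\<^bsub>M\<^esub> coord (i (Suc n)) (\<phi> w)"
      by (subst wx) (use x0M wc \<phi> coord(1)[OF iI] in \<open>simp add: endo_add\<close>)
    moreover have "coord (i (Suc n)) (x 0) = \<zero>\<^bsub>M\<^esub>" using coord_other[OF iI iI _ x(1), of "Suc n" 0] ieq by simp
    moreover have "coord (i (Suc n)) (\<phi> w) = x (Suc n)" using coordS[OF wc] Suc x(2) by simp
    ultimately show ?case using NM[OF iI x(1)] by simp
  qed
  then have "range i \<subseteq> {j \<in> I. coord j w \<noteq> \<zero>\<^bsub>M\<^esub>}" using iI x0 by auto
  then have "finite (range i)" using coord_finite[OF wc] finite_subset by blast
  then show False using inj finite_imageD by blast
qed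

text \<open>Independence in the sense of summands, which is stronger than trivial intersection. For
  a summand \<open>H\<close> it means that some projection onto \<open>N i\<close> kills
  \<open>H\<close>.\<close>

definition independent where "independent H i \<longleftrightarrow> H \<inter> N i = {\<zero>\<^bsub>M\<^esub>} \<and> summand (N i <+>\<^bsub>M\<^esub> H)"

lemma independent_antimono:
  assumes H: "summand H" "summand H'" "H \<subseteq> H'" and i: "i \<in> I" and ind: "independent H' i"
  shows "independent H i"
proof -
  note sN = N_sub[OF i] and sH = summand_sub[OF H(1)] and sH' = summand_sub[OF H(2)]
  obtain V where V: "decomp H' [H, V]" using summand_within[OF H(1,3) sH'] .
  have "decomp (N i <+>\<^bsub>M\<^esub> H') [N i, H']"
    using ind sN sH' by (intro decomp_pair[THEN iffD2]) (auto simp: independent_def)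
  moreover have "summand (N i <+>\<^bsub>M\<^esub> H')" using ind by (simp add: independent_def)
  ultimately obtain Y where "decomp (carrier M) [Y, N i, H']" using decomp_summand by blast
  then have "decomp (carrier M) (H' # [Y, N i])" by (rule decomp_perm) simp
  then have "decomp (carrier M) ([H, V] @ [Y, N i])" using decomp_refine[OF V] by blast
  then have "decomp (carrier M) ([N i, H] @ [V, Y])" by (rule decomp_perm) simp
  then obtain S where S: "decomp S [N i, H]" "decomp (carrier M) (S # [V, Y])" by (rule decomp_merge)
  have "summand S" using S(2) by (rule summand_decomp_mem) simp
  moreover have "S = N i <+>\<^bsub>M\<^esub> H" "N i \<inter> H = {\<zero>\<^bsub>M\<^esub>}" using S(1) unfolding decomp_pair by blast+
  ultimately show ?thesis unfolding independent_def by (simp add: Int_commute)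
qed

lemma independentI:
  assumes H: "summand H" and i: "i \<in> I" and r: "r \<in> endo" "\<And>x. x \<in> carrier M \<Longrightarrow> r x \<in> N i"
    "\<And>x. x \<in> N i \<Longrightarrow> r x = x" "\<And>x. x \<in> H \<Longrightarrow> r x = \<zero>\<^bsub>M\<^esub>"
  shows "independent H i"
  using summand_extend[OF H r(1-3) N_sub[OF i] r(4)] unfolding independent_def by (simp add: Int_commute)

text \<open>\<open>H\<close> has a complement \<open>part L\<close>. Modulo \<open>H\<close>, the
  element \<open>x\<close> is represented by some \<open>e x\<close> in \<open>part L\<close>, and
  one of its coordinates, at \<open>l\<close> say, avoids \<open>D\<close>. The map
  \<open>f\<close>, taking coordinate \<open>l\<close> after \<open>e\<close>, kills
  \<open>H\<close> and fixes \<open>N l\<close>; so \<open>N l\<close> is independent of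
  \<open>H\<close>. If \<open>f\<close> were bijective on \<open>N i\<close>, then \<open>f\<close>
  followed by the inverse would be a projection onto \<open>N i\<close> killing
  \<open>H\<close>.\<close>

lemma independent_step:
  assumes H: "summand H" "H \<subseteq> D" and D: "sub D" and i: "i \<in> I" "\<not> independent H i" and x: "x \<in> N i" "x \<notin> D"
  obtains l f where "l \<in> I" "independent H l" "f \<in> endo" "f ` N i \<subseteq> N l" "\<not> bij_betw f (N i) (N l)" "f x \<notin> D"
proof -
  obtain L where L: "L \<subseteq> I" "dsum H (part L)" using complement[OF H(1)] by blast
  obtain e where e: "e \<in> endo" "\<And>y. y \<in> carrier M \<Longrightarrow> e y \<in> part L" "\<And>y. y \<in> part L \<Longrightarrow> e y = y"
    "\<And>y. y \<in> carrier M \<Longrightarrow> e y = \<zero>\<^bsub>M\<^esub> \<longleftrightarrow> y \<in> H" "\<And>y. y \<in> carrier M \<Longrightarrow> y \<ominus>\<^bsub>M\<^esub> e y \<in> H"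
    by (rule dsum_proj[OF dsum_sym[OF L(2)]]) (rule that)
  have xM: "x \<in> carrier M" using subD(7)[OF N_sub[OF i(1)] x(1)] .
  have eH: "e y = \<zero>\<^bsub>M\<^esub>" if "y \<in> H" for y using e(4)[of y] subD(7)[OF summand_sub[OF H(1)] that] that by simp
  have "e x \<notin> D"
  proof
    assume "e x \<in> D"
    moreover have "x \<ominus>\<^bsub>M\<^esub> e x \<in> D" using e(5)[OF xM] H(2) by blast
    ultimately have "(x \<ominus>\<^bsub>M\<^esub> e x) \<oplus>\<^bsub>M\<^esub> e x \<in> D" by (rule subD(3)[OF D, rotated])
    then show False using x(2) xM e(1) by simp
  qed
  then obtain l where l: "l \<in> L" "coord l (e x) \<notin> D"
    using part_coord_induct[OF L(1) e(2)[OF xM] D] by blast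
  have lI: "l \<in> I" using l L by auto
  define f where "f y = coord l (e y)" for y
  have f: "f \<in> endo" unfolding f_def by (rule endo_comp[OF coord(1)[OF lI] e(1)])
  have fN: "f y \<in> N l" if "y \<in> carrier M" for y unfolding f_def using coord(2)[OF lI] e(1) that by simp
  have fH: "f y = \<zero>\<^bsub>M\<^esub>" if "y \<in> H" for y unfolding f_def using eH[OF that] coord(1)[OF lI] by simp
  have fl: "f y = y" if "y \<in> N l" for y
    unfolding f_def using e(3)[of y] N_part[OF l(1) lI] that coord(3)[OF lI] by auto
  have "independent H l" by (rule independentI[OF H(1) lI f fN fl fH])
  moreover have "\<not> bij_betw f (N i) (N l)"
  proof
    have sm: "summand (N j)" if "j \<in> I" for j using dsum_N[OF that] by (auto simp: direct_summand_def)
    assume "bij_betw f (N i) (N l)"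
    then obtain c where c: "c \<in> endo" "\<And>x. x \<in> carrier M \<Longrightarrow> c x \<in> N i" "\<And>x. x \<in> N i \<Longrightarrow> c (f x) = x"
      using iso_inverse[OF f sm[OF i(1)] sm[OF lI]] by metis
    have "independent H i"
    proof (rule independentI[OF H(1) i(1) endo_comp[OF c(1) f]])
      show "c (f y) \<in> N i" if "y \<in> carrier M" for y using c(2) f that by simp
      show "c (f y) = \<zero>\<^bsub>M\<^esub>" if "y \<in> H" for y using fH[OF that] c(1) by simp
    qed (rule c(3))
    then show False using i(2) by blast
  qed
  moreover have "f ` N i \<subseteq> N l" using fN subD(7)[OF N_sub[OF i(1)]] by blast
  ultimately show thesis using that lI f l(2) by (simp add: f_def)
qed

text \<open>The complement of the union is \<open>part L\<close> for a maximal set \<open>L\<close>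
  of components independent of all members of the chain. If the two did not span \<open>M\<close>, a
  component outside their sum could be pushed on to new components forever without the element
  becoming zero, against semi-T-nilpotency.\<close>

lemma harada_chain_summand:
  assumes C: "C \<noteq> {}" "subset.chain {A. summand A} C"
  shows "summand (\<Union>C)"
proof -
  have CA: "summand A" if "A \<in> C" for A using C(2) that by (auto simp: subset_chain_def)
  have sD: "sub (\<Union>C)" using C summand_sub by (intro sub_Union_chain) (auto simp: subset_chain_def)
  \<comment> \<open>Only finite subsets of \<open>L\<close> are tested, so the condition passes to
    unions of chains of index sets.\<close>
  let ?P = "{L. L \<subseteq> I \<and> (\<forall>A\<in>C. \<forall>F \<subseteq> L. finite F \<longrightarrow> A \<inter> part F = {\<zero>\<^bsub>M\<^esub>} \<and> summand (A <+>\<^bsub>M\<^esub> part F))}"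
  have "\<exists>L\<in>?P. \<forall>L'\<in>?P. L \<subseteq> L' \<longrightarrow> L' = L"
  proof (rule subset_Zorn_nonempty)
    have "A \<inter> {\<zero>\<^bsub>M\<^esub>} = {\<zero>\<^bsub>M\<^esub>}" "A <+>\<^bsub>M\<^esub> {\<zero>\<^bsub>M\<^esub>} = A" if "A \<in> C" for A
      using subD(2)[OF summand_sub[OF CA[OF that]]] summand_sub[OF CA[OF that]] by auto
    then have "{} \<in> ?P" using CA by (simp add: family_sum_empty)
    then show "?P \<noteq> {}" by blast
    fix B assume B: "B \<noteq> {}" "subset.chain ?P B"
    have BP: "L \<in> ?P" if "L \<in> B" for L using B(2) that unfolding subset_chain_def by blast
    have "A \<inter> part F = {\<zero>\<^bsub>M\<^esub>} \<and> summand (A <+>\<^bsub>M\<^esub> part F)" if F: "A \<in> C" "F \<subseteq> \<Union>B" "finite F" for A F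
    proof -
      obtain L where L: "L \<in> B" "F \<subseteq> L" using finite_subset_Union_chain[OF F(3,2) B] .
      show ?thesis using BP[OF L(1)] F(1,3) L(2) by simp
    qed
    moreover have "\<Union>B \<subseteq> I" using BP by blast
    ultimately show "\<Union>B \<in> ?P" by simp
  qed
  then obtain L where "L \<in> ?P" and "\<forall>L'\<in>?P. L \<subseteq> L' \<longrightarrow> L' = L" ..
  then have L: "L \<subseteq> I" "\<And>A F. \<lbrakk>A \<in> C; F \<subseteq> L; finite F\<rbrakk> \<Longrightarrow> A \<inter> part F = {\<zero>\<^bsub>M\<^esub>} \<and> summand (A <+>\<^bsub>M\<^esub> part F)"
    and max: "\<And>L'. \<lbrakk>L' \<in> ?P; L \<subseteq> L'\<rbrakk> \<Longrightarrow> L' = L" by simp_all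
  have sL: "sub (part L)" by (rule part_sub[OF L(1)])
  define D where "D = \<Union>C <+>\<^bsub>M\<^esub> part L"
  have D: "sub D" unfolding D_def by (rule sub_plus[OF sD sL])
  \<comment> \<open>A directed family of summands with union \<open>D\<close>. Since
    \<open>D\<close> itself is not known to be a summand, dependence on \<open>D\<close> is
    expressed by dependence on some member.\<close>
  define \<D> where "\<D> = {A <+>\<^bsub>M\<^esub> part F |A F. A \<in> C \<and> F \<subseteq> L \<and> finite F}"
  have \<D>: "summand H" "H \<subseteq> D" if HD: "H \<in> \<D>" for H
  proof -
    obtain A F where H: "A \<in> C" "F \<subseteq> L" "finite F" "H = A <+>\<^bsub>M\<^esub> part F" using HD by (auto simp: \<D>_def)
    show "summand H" using L(2)[OF H(1-3)] H(4) by simp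
    show "H \<subseteq> D" unfolding H(4) D_def using H(1) by (intro plus_mono family_sum_mono H(2)) auto
  qed
  have directed: "\<exists>H\<in>\<D>. H1 \<subseteq> H \<and> H2 \<subseteq> H" if "H1 \<in> \<D>" "H2 \<in> \<D>" for H1 H2
  proof -
    obtain A1 F1 where 1: "A1 \<in> C" "F1 \<subseteq> L" "finite F1" "H1 = A1 <+>\<^bsub>M\<^esub> part F1" using \<open>H1 \<in> \<D>\<close> by (auto simp: \<D>_def)
    obtain A2 F2 where 2: "A2 \<in> C" "F2 \<subseteq> L" "finite F2" "H2 = A2 <+>\<^bsub>M\<^esub> part F2" using \<open>H2 \<in> \<D>\<close> by (auto simp: \<D>_def)
    obtain A where A: "A \<in> C" "A1 \<subseteq> A" "A2 \<subseteq> A"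
    proof -
      have "A1 \<subseteq> A2 \<or> A2 \<subseteq> A1" using C(2) 1(1) 2(1) unfolding subset_chain_def by simp
      then show thesis using that[OF 1(1)] that[OF 2(1)] by blast
    qed
    have "A <+>\<^bsub>M\<^esub> part (F1 \<union> F2) \<in> \<D>"
      unfolding \<D>_def using A(1) 1(2,3) 2(2,3) by (intro CollectI exI[of _ A] exI[of _ "F1 \<union> F2"]) auto
    moreover have "H1 \<subseteq> A <+>\<^bsub>M\<^esub> part (F1 \<union> F2)" "H2 \<subseteq> A <+>\<^bsub>M\<^esub> part (F1 \<union> F2)"
      unfolding 1(4) 2(4) by (rule plus_mono[OF A(2) family_sum_mono[OF Un_upper1]]
          plus_mono[OF A(3) family_sum_mono[OF Un_upper2]])+
    ultimately show ?thesis by blast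
  qed
  have dependent: "\<exists>H\<in>\<D>. \<not> independent H i" if i: "i \<in> I" "i \<notin> L" for i
  proof (rule ccontr)
    assume no: "\<not> ?thesis"
    have "A \<inter> part F = {\<zero>\<^bsub>M\<^esub>} \<and> summand (A <+>\<^bsub>M\<^esub> part F)" if F: "A \<in> C" "F \<subseteq> insert i L" "finite F" for A F
    proof (cases "i \<in> F")
      case False
      then show ?thesis using F L(2) by blast
    next
      case True
      define F' where "F' = F - {i}"
      have F': "F' \<subseteq> L" "finite F'" "F = insert i F'" using F True by (auto simp: F'_def)
      define H where "H = A <+>\<^bsub>M\<^esub> part F'"
      have sF': "sub (part F')" using F' L(1) by (intro part_sub) auto
      note sA = summand_sub[OF CA[OF F(1)]]
      have "H \<in> \<D>" using F(1) F' by (auto simp: H_def \<D>_def)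
      then have "independent H i" using no by blast
      then have ind: "H \<inter> N i = {\<zero>\<^bsub>M\<^esub>}" "summand (N i <+>\<^bsub>M\<^esub> H)" by (auto simp: independent_def)
      have "decomp (N i <+>\<^bsub>M\<^esub> H) [N i, H]"
        using ind(1) N_sub[OF i(1)] sub_plus[OF sA sF'] by (intro decomp_pair[THEN iffD2]) (auto simp: H_def)
      then have "decomp (N i <+>\<^bsub>M\<^esub> H) (H # [N i])" by (rule decomp_perm) simp
      moreover have "decomp H [A, part F']"
        unfolding H_def using L(2)[OF F(1) F'(1,2)] sA sF' by (intro decomp_pair[THEN iffD2]) auto
      ultimately have "decomp (N i <+>\<^bsub>M\<^esub> H) ([A, part F'] @ [N i])" using decomp_refine by blast
      then have "decomp (N i <+>\<^bsub>M\<^esub> H) ([N i, part F'] @ [A])" by (rule decomp_perm) simp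
      then obtain T where T: "decomp T [N i, part F']" "decomp (N i <+>\<^bsub>M\<^esub> H) [T, A]" by (rule decomp_merge)
      have "part F = N i <+>\<^bsub>M\<^esub> part F'" unfolding F'(3) using N_sub i(1) F'(1) L(1) by (intro family_sum_insert) auto
      then have "T = part F" using T(1) unfolding decomp_pair by simp
      then have "decomp (N i <+>\<^bsub>M\<^esub> H) [part F, A]" using T(2) by simp
      then have "decomp (N i <+>\<^bsub>M\<^esub> H) [A, part F]" by (rule decomp_perm) simp
      then have "A \<inter> part F = {\<zero>\<^bsub>M\<^esub>}" "N i <+>\<^bsub>M\<^esub> H = A <+>\<^bsub>M\<^esub> part F" unfolding decomp_pair by blast+
      then show ?thesis using ind(2) by simp
    qed
    then have "insert i L \<in> ?P" using i(1) L(1) by simp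
    then show False using max[of "insert i L"] i(2) by blast
  qed
  have "carrier M \<subseteq> D"
  proof (rule ccontr)
    assume "\<not> carrier M \<subseteq> D"
    then obtain i0 x0 where i0: "i0 \<in> I" "x0 \<in> N i0" "x0 \<notin> D"
      using family_sum_least[of D I N] D part_I by blast
    have notL: "i \<notin> L" if "i \<in> I" "x \<in> N i" "x \<notin> D" for i x
      using N_part[of i L] that plus_upper(2)[OF sD sL] by (auto simp: D_def)
    \<comment> \<open>A state consists of a summand \<open>H\<close> of the family, a component
      \<open>i\<close> dependent on \<open>H\<close> and an element \<open>x\<close> of
      \<open>N i\<close> outside \<open>D\<close>. A step passes to a component independent of the
      old \<open>H\<close>, which is what keeps the indices distinct.\<close>
    let ?Q = "\<lambda>_ (H, i, x). H \<in> \<D> \<and> i \<in> I \<and> x \<in> N i \<and> x \<notin> D \<and> \<not> independent H i"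
    let ?S = "\<lambda>_ (H, i, x) (H', i', x'). H \<subseteq> H' \<and> independent H i' \<and>
      (\<exists>f\<in>endo. f ` N i \<subseteq> N i' \<and> \<not> bij_betw f (N i) (N i') \<and> f x = x')"
    have "\<exists>\<sigma>. \<forall>n. ?Q n (\<sigma> n) \<and> ?S n (\<sigma> n) (\<sigma> (Suc n))"
    proof (rule dependent_nat_choice)
      obtain H where "H \<in> \<D>" "\<not> independent H i0" using dependent notL i0 by blast
      then show "\<exists>s. ?Q 0 s" using i0 by (intro exI[of _ "(H, i0, x0)"]) simp
    next
      fix s and n :: nat assume s: "?Q n s"
      obtain H i x where Hix: "s = (H, i, x)" by (cases s) auto
      then have H: "H \<in> \<D>" "i \<in> I" "x \<in> N i" "x \<notin> D" "\<not> independent H i" using s by auto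
      obtain l f where l: "l \<in> I" "independent H l" and f: "f \<in> endo" "f ` N i \<subseteq> N l"
        "\<not> bij_betw f (N i) (N l)" "f x \<notin> D"
        by (rule independent_step[OF \<D>[OF H(1)] D H(2,5,3,4)])
      have fx: "f x \<in> N l" using f(2) H(3) by auto
      obtain H1 where H1: "H1 \<in> \<D>" "\<not> independent H1 l" using dependent notL l(1) fx f(4) by blast
      \<comment> \<open>The new summand has to contain the old one, for monotonicity, and the
        witness \<open>H1\<close> for the dependence of \<open>l\<close>.\<close>
      obtain H' where H': "H' \<in> \<D>" "H \<subseteq> H'" "H1 \<subseteq> H'" using directed[OF H(1) H1(1)] by blast
      have "\<not> independent H' l" using independent_antimono[OF \<D>(1)[OF H1(1)] \<D>(1)[OF H'(1)] H'(3) l(1)] H1(2) by blast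
      then show "\<exists>s'. ?Q (Suc n) s' \<and> ?S n s s'"
        using H' l f fx by (intro exI[of _ "(H', l, f x)"]) (auto simp: Hix)
    qed
    then obtain \<sigma> where "\<forall>n. ?Q n (\<sigma> n) \<and> ?S n (\<sigma> n) (\<sigma> (Suc n))" ..
    note \<sigma> = conjunct1[OF spec[OF this]] conjunct2[OF spec[OF this]]
    define H where "H n = fst (\<sigma> n)" for n
    define i where "i n = fst (snd (\<sigma> n))" for n
    define x where "x n = snd (snd (\<sigma> n))" for n
    have Q: "H n \<in> \<D>" "i n \<in> I" "x n \<in> N (i n)" "x n \<notin> D" "\<not> independent (H n) (i n)" for n
      using \<sigma>(1)[of n] by (auto simp: H_def i_def x_def split_beta)
    have S: "H n \<subseteq> H (Suc n)" "independent (H n) (i (Suc n))"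
      "\<exists>f\<in>endo. f ` N (i n) \<subseteq> N (i (Suc n)) \<and> \<not> bij_betw f (N (i n)) (N (i (Suc n))) \<and> f (x n) = x (Suc n)" for n
      using \<sigma>(2)[of n] by (auto simp: H_def i_def x_def split_beta)
    obtain f where f: "f n \<in> endo" "f n ` N (i n) \<subseteq> N (i (Suc n))"
      "\<not> bij_betw (f n) (N (i n)) (N (i (Suc n)))" "f n (x n) = x (Suc n)" for n
      using S(3) by metis
    have Hmono: "H m \<subseteq> H n" if "m \<le> n" for m n using lift_Suc_mono_le[of H, OF S(1) that] .
    \<comment> \<open>The component \<open>i n\<close> is independent of the summand just before it
      in the sequence, hence of the smaller \<open>H m\<close>, on which \<open>i m\<close>
      depends.\<close>
    have "i m \<noteq> i n" if "m < n" for m n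
    proof
      assume eq: "i m = i n"
      obtain k where k: "n = Suc k" "m \<le> k" using \<open>m < n\<close> by (cases n) auto
      have "independent (H m) (i n)"
        using independent_antimono[OF \<D>(1)[OF Q(1)] \<D>(1)[OF Q(1)] Hmono[OF k(2)] Q(2)] S(2)[of k] k(1) by simp
      then show False using Q(5)[of m] eq by simp
    qed
    then have "inj i" by (metis injI linorder_neqE_nat)
    then have "\<exists>n. x n = \<zero>\<^bsub>M\<^esub>" using Q(2) f(1-3) Q(3) f(4) by (rule semi_T_nilpotent)
    then show False using Q(4) subD(2)[OF D] by metis
  qed
  moreover have "\<Union>C \<inter> part L = {\<zero>\<^bsub>M\<^esub>}"
  proof -
    have "x = \<zero>\<^bsub>M\<^esub>" if x: "x \<in> \<Union>C" "x \<in> part L" for x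
    proof -
      obtain A where A: "A \<in> C" "x \<in> A" using x(1) by blast
      obtain F where F: "finite F" "F \<subseteq> L" "x \<in> part F" using family_sum_finite[OF x(2)] .
      then show ?thesis using L(2)[OF A(1) F(2,1)] A(2) by blast
    qed
    then show ?thesis using subD(2)[OF sD] subD(2)[OF sL] by blast
  qed
  ultimately have "dsum (\<Union>C) (part L)"
    using sD sL subD(1)[OF D] unfolding direct_sum_def D_def by blast
  then show ?thesis by (auto simp: direct_summand_def)
qed

text \<open>A complement \<open>part L\<close> of the non-zero \<open>K\<close> omits some index
  \<open>i\<close>. For \<open>x \<in> N i\<close> the difference of \<open>x\<close> and its
  projection \<open>p x\<close> to \<open>K\<close> lies in \<open>part L\<close> and has no
  coordinate at \<open>i\<close>; so \<open>coord i\<close> inverts \<open>p\<close> on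
  \<open>N i\<close>. Hence \<open>N i\<close> is isomorphic to a summand inside \<open>K\<close>,
  and locality is transported along this isomorphism.\<close>

lemma harada_local_summand:
  assumes K: "summand K" "K \<noteq> {\<zero>\<^bsub>M\<^esub>}"
  shows "\<exists>Z \<subseteq> K. summand Z \<and> Z \<noteq> {\<zero>\<^bsub>M\<^esub>} \<and> local_on Z"
proof -
  obtain L where L: "L \<subseteq> I" "dsum K (part L)" using complement[OF K(1)] by blast
  have "L \<noteq> I"
  proof
    assume "L = I"
    then show False using dsumD(1,4)[OF L(2)] part_I subD(1) K(2) by blast
  qed
  then obtain i where i: "i \<in> I" "i \<notin> L" using L(1) by blast
  obtain p where p: "p \<in> endo" "\<And>x. x \<in> carrier M \<Longrightarrow> p x \<in> K" "\<And>x. x \<in> K \<Longrightarrow> p x = x"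
    "\<And>x. x \<in> carrier M \<Longrightarrow> p x = \<zero>\<^bsub>M\<^esub> \<longleftrightarrow> x \<in> part L" "\<And>x. x \<in> carrier M \<Longrightarrow> x \<ominus>\<^bsub>M\<^esub> p x \<in> part L"
    by (rule dsum_proj[OF L(2)]) (rule that)
  note ci = coord[OF i(1)]
  note sN = N_sub[OF i(1)]
  define Z where "Z = p ` N i"
  have cp: "coord i (p x) = x" if x: "x \<in> N i" for x
  proof -
    have xM: "x \<in> carrier M" using subD(7)[OF sN x] .
    have "coord i (x \<ominus>\<^bsub>M\<^esub> p x) = \<zero>\<^bsub>M\<^esub>" by (rule coord_part[OF i(1) L(1) i(2) p(5)[OF xM]])
    then have "x \<ominus>\<^bsub>M\<^esub> coord i (p x) = \<zero>\<^bsub>M\<^esub>" using ci(1,3) x xM p(1) by (simp add: endo_minus)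
    then show ?thesis using ci(1) xM p(1) by (simp add: diff_solve(1))
  qed
  have pc: "p (coord i z) = z" if "z \<in> Z" for z using that cp by (auto simp: Z_def)
  have cZ: "coord i z \<in> N i" if "z \<in> Z" for z using that cp by (auto simp: Z_def)
  have "summand (N i)" using dsum_N[OF i(1)] by (auto simp: direct_summand_def)
  then have Z: "summand Z" unfolding Z_def using split_onI[OF ci(1) cp] by (rule split_on_summand[OF p(1)])
  have "Z \<subseteq> K" using p(2) subD(7)[OF sN] by (auto simp: Z_def)
  moreover have "Z \<noteq> {\<zero>\<^bsub>M\<^esub>}"
  proof
    assume "Z = {\<zero>\<^bsub>M\<^esub>}"
    then have "p x = \<zero>\<^bsub>M\<^esub>" if "x \<in> N i" for x using that by (auto simp: Z_def)
    then have "x = \<zero>\<^bsub>M\<^esub>" if "x \<in> N i" for x using cp[OF that] that ci(1) by simp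
    then show False using N_local(1)[OF i(1)] subD(2)[OF sN] by blast
  qed
  moreover have "local_on Z"
    unfolding local_on_def
  proof (intro ballI impI)
    fix f assume f: "f \<in> endo" "f ` Z \<subseteq> Z"
    have ZM: "z \<in> carrier M" if "z \<in> Z" for z using subD(7)[OF summand_sub[OF Z] that] .
    have pZ: "p x \<in> Z" if "x \<in> N i" for x using that by (auto simp: Z_def)
    have bp: "bij_betw p (N i) Z" using cp pc pZ cZ by (intro bij_betwI[of _ _ _ "coord i"]) auto
    have bc: "bij_betw (coord i) Z (N i)" using cp pc pZ cZ by (intro bij_betwI[of _ _ _ p]) auto
    define k where "k x = coord i (f (p x))" for x
    have k: "k \<in> endo" unfolding k_def by (rule endo_comp[OF ci(1) endo_comp[OF f(1) p(1)]])
    have fZ: "f z \<in> Z" if "z \<in> Z" for z using f(2) that by auto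
    have "k ` N i \<subseteq> N i" unfolding k_def using cZ fZ pZ by auto
    then have kk: "bij_betw k (N i) (N i) \<or> bij_betw (\<lambda>x. x \<ominus>\<^bsub>M\<^esub> k x) (N i) (N i)"
      using N_local(2)[OF i(1)] k unfolding local_on_def by blast
    have transfer: "bij_betw g Z Z" if g: "bij_betw q (N i) (N i)" "\<And>z. z \<in> Z \<Longrightarrow> g z = p (q (coord i z))" for g q
    proof -
      have "bij_betw (p \<circ> (q \<circ> coord i)) Z Z"
        by (rule bij_betw_trans[OF bij_betw_trans[OF bc g(1)] bp])
      then show ?thesis using g(2) by (subst bij_betw_cong[of Z g "p \<circ> (q \<circ> coord i)"]) auto
    qed
    have 1: "f z = p (k (coord i z))" if "z \<in> Z" for z
      unfolding k_def pc[OF that] using pc[OF fZ[OF that]] by simp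
    have 2: "z \<ominus>\<^bsub>M\<^esub> f z = p (coord i z \<ominus>\<^bsub>M\<^esub> k (coord i z))" if "z \<in> Z" for z
      using 1[OF that] pc[OF that] ZM[OF that] p(1) ci(1) k by (simp add: endo_minus)
    show "bij_betw f Z Z \<or> bij_betw (\<lambda>x. x \<ominus>\<^bsub>M\<^esub> f x) Z Z"
      using kk transfer[of k f, OF _ 1] transfer[of "\<lambda>x. x \<ominus>\<^bsub>M\<^esub> k x" "\<lambda>x. x \<ominus>\<^bsub>M\<^esub> f x", OF _ 2] by blast
  qed
  ultimately show ?thesis using Z by blast
qed

lemma harada_chain_local: "chain_local_module R M"
  by (intro chain_local_module.intro chain_local_module_axioms.intro left_module_axioms
      harada_chain_summand harada_local_summand)

end

theorem corollary2p7:
  fixes R :: "('r, 's) ring_scheme" and M :: "('r, 'm, 't) module_scheme"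
  assumes "left_module R M"
  shows "(harada_module R M \<longrightarrow> PSB_property R M) \<and>
         (discrete_module R M \<longrightarrow> PSB_property R M)"
proof (intro conjI impI)
  assume "harada_module R M"
  then obtain I :: "'m set set" and N where "harada_decomposition R M I N"
    by (auto simp: harada_module_def)
  then have "local_decomposition R M I N"
    using assms by (simp add: local_decomposition_def local_decomposition_axioms_def)
  then show "PSB_property R M"
    by (intro chain_local_module.PSB_property local_decomposition.harada_chain_local)
next
  assume "discrete_module R M"
  then show "PSB_property R M"
    using left_module.discrete_chain_local[OF assms] chain_local_module.PSB_property by blast
qed

end
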